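(* The problem of listing the maximal edge-induced chordal subgraphs of a graph $G$ is proximity searchable, and it can be solved (every solution output exactly once) with $O(m^4n)$ time delay.
   Context: $G$ is a simple undirected graph with $n$ vertices and $m$ edges (isolated vertices disregarded). A graph is chordal if every cycle of length greater than 3 has a chord. A maximal edge-induced chordal subgraph is an inclusion-maximal $F\subseteq E(G)$ such that the graph with edge set $F$ and vertex set the endpoints of $F$ is chordal. A listing problem with universe $\mathcal{U}$ (here $E(G)$) and set $\mathcal{S}$ of solutions to list is proximity searchable if there exist $\tilde{\cap}:\mathcal{S}\times\mathcal{S}\to 2^{\mathcal{U}}$ and $\mathrm{neighbors}:\mathcal{S}\to 2^{\mathcal{S}}$ such that one solution can be found in time polynomial in $|\mathcal{U}|$, $\mathrm{neighbors}$ is computable in time polynomial in $|\mathcal{U}|$, and for any two distinct $S,S^*\in\mathcal{S}$ some $S'\in\mathrm{neighbors}(S)$ satisfies $|S'\,\tilde{\cap}\,S^*|>|S\,\tilde{\cap}\,S^*|$. Delay is the maximum time before the first output, between consecutive outputs, and after the last output. *)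

theory Defs
  imports Main
begin

section \<open>Chordal graphs and maximal edge-induced chordal subgraphs\<close>

text \<open>
  A simple graph without isolated vertices is given by its set of edges, each edge being a
  two-element set; its vertex set is the union of the edges. So an edge set F also stands for
  the edge-induced subgraph with edge set F and vertex set the endpoints of F.
\<close>

definition simple_graph :: "'a set set \<Rightarrow> bool" where
  "simple_graph E \<longleftrightarrow> finite E \<and> (\<forall>e\<in>E. card e = 2)"

definition is_cycle :: "'a set set \<Rightarrow> 'a list \<Rightarrow> bool" where
  "is_cycle F vs \<longleftrightarrow> length vs \<ge> 3 \<and> distinct vs \<and>
     (\<forall>i<length vs. {vs ! i, vs ! (Suc i mod length vs)} \<in> F)"

definition has_chord :: "'a set set \<Rightarrow> 'a list \<Rightarrow> bool" where
  "has_chord F vs \<longleftrightarrow> (\<exists>i<length vs. \<exists>j<length vs. i \<noteq> j \<and>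
     j \<noteq> Suc i mod length vs \<and> i \<noteq> Suc j mod length vs \<and> {vs ! i, vs ! j} \<in> F)"

definition chordal :: "'a set set \<Rightarrow> bool" where
  "chordal F \<longleftrightarrow> (\<forall>vs. is_cycle F vs \<and> length vs > 3 \<longrightarrow> has_chord F vs)"

definition maximal_chordal_subgraphs :: "'a set set \<Rightarrow> 'a set set set" where
  "maximal_chordal_subgraphs E =
     {F. F \<subseteq> E \<and> chordal F \<and> (\<forall>F'. F \<subset> F' \<and> F' \<subseteq> E \<longrightarrow> \<not> chordal F')}"


section \<open>Random access machine\<close>

text \<open>
  Unit-cost RAM with registers and a memory of natural numbers, programmed with structured
  control flow. A program mentions finitely many registers only. Arithmetic is by increment
  and decrement, and addresses are of the form base + index. There is deliberately no
  unit-cost addition or multiplication: in a run of t steps every number is at most the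
  largest input or program constant plus t, so a word of O(log t) bits holds it, even in the
  exponentially long runs of a listing algorithm.
\<close>

datatype test = LESS nat nat | EQUAL nat nat

datatype com =
    SKIP
  | IMM nat nat          \<comment> \<open>X i := k\<close>
  | COPY nat nat         \<comment> \<open>X i := X j\<close>
  | INC nat
  | DEC nat              \<comment> \<open>truncated at 0\<close>
  | LOAD nat nat nat     \<comment> \<open>X i := M (X j + X k)\<close>
  | STORE nat nat nat    \<comment> \<open>M (X j + X k) := X i\<close>
  | PUT nat              \<comment> \<open>appends X i to the solution being written\<close>
  | EMIT                 \<comment> \<open>completes the solution being written\<close>
  | SEQ com com
  | IF test com com
  | WHILE test com

type_synonym state = "(nat \<Rightarrow> nat) \<times> (nat \<Rightarrow> nat)"

fun holds :: "test \<Rightarrow> state \<Rightarrow> bool" where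
  "holds (LESS i j) (X, M) \<longleftrightarrow> X i < X j"
| "holds (EQUAL i j) (X, M) \<longleftrightarrow> X i = X j"

text \<open>
  The big-step semantics records one event for each unit of time, so that the length of the
  trace of a run is its running time.
\<close>

datatype event = Tick | Put nat | Emit

inductive exec :: "com \<Rightarrow> state \<Rightarrow> event list \<Rightarrow> state \<Rightarrow> bool" where
  Skip: "exec SKIP s [Tick] s"
| Imm: "exec (IMM i k) (X, M) [Tick] (X(i := k), M)"
| Copy: "exec (COPY i j) (X, M) [Tick] (X(i := X j), M)"
| Inc: "exec (INC i) (X, M) [Tick] (X(i := X i + 1), M)"
| Dec: "exec (DEC i) (X, M) [Tick] (X(i := X i - 1), M)"
| Load: "exec (LOAD i j k) (X, M) [Tick] (X(i := M (X j + X k)), M)"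
| Store: "exec (STORE i j k) (X, M) [Tick] (X, M(X j + X k := X i))"
| Put: "exec (PUT i) (X, M) [Put (X i)] (X, M)"
| Emit: "exec EMIT s [Emit] s"
| Seq: "exec c1 s1 t1 s2 \<Longrightarrow> exec c2 s2 t2 s3 \<Longrightarrow> exec (SEQ c1 c2) s1 (t1 @ t2) s3"
| IfTrue: "holds b s \<Longrightarrow> exec c1 s t s' \<Longrightarrow> exec (IF b c1 c2) s (Tick # t) s'"
| IfFalse: "\<not> holds b s \<Longrightarrow> exec c2 s t s' \<Longrightarrow> exec (IF b c1 c2) s (Tick # t) s'"
| WhileFalse: "\<not> holds b s \<Longrightarrow> exec (WHILE b c) s [Tick] s"
| WhileTrue: "holds b s1 \<Longrightarrow> exec c s1 t1 s2 \<Longrightarrow> exec (WHILE b c) s2 t2 s3 \<Longrightarrow>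
    exec (WHILE b c) s1 (Tick # t1 @ t2) s3"

lemma exec_deterministic:
  "exec c s t s1 \<Longrightarrow> exec c s t' s2 \<Longrightarrow> t = t' \<and> s1 = s2"
proof (induction arbitrary: t' s2 rule: exec.induct)
  case (Seq c1 s1 t1 s2 c2 t2 s3)
  from Seq.prems show ?case by cases (use Seq.IH in blast)
next
  case (IfTrue b s c1 t s' c2)
  from IfTrue.prems show ?case by cases (use IfTrue.IH IfTrue.hyps in blast)+
next
  case (IfFalse b s c2 t s' c1)
  from IfFalse.prems show ?case by cases (use IfFalse.IH IfFalse.hyps in blast)+
next
  case (WhileFalse b s c)
  from WhileFalse.prems show ?case by cases (use WhileFalse.hyps in blast)+
next
  case (WhileTrue b s1 c t1 s2 t2 s3)
  from WhileTrue.prems show ?case by cases (use WhileTrue.IH WhileTrue.hyps in blast)+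
qed (erule exec.cases; simp)+

text \<open>
  The input is a list of words (lists of numbers), stored one after the other from address 0
  on; register i initially holds the length of the i-th word. All else is 0.
\<close>

definition init :: "nat list list \<Rightarrow> state" where
  "init ws =
     ((\<lambda>i. if i < length ws then length (ws ! i) else 0),
      (\<lambda>a. if a < length (concat ws) then concat ws ! a else 0))"

text \<open>
  Cutting a trace after each Emit gives one segment for each output, ending in its Emit, and
  a last segment for the time between the last output and termination.
\<close>

fun segments :: "event list \<Rightarrow> event list list" where
  "segments [] = [[]]"
| "segments (e # t) =
     (if e = Emit then [e] # segments t else (e # hd (segments t)) # tl (segments t))"

fun written :: "event list \<Rightarrow> nat list" where
  "written [] = []"
| "written (Put a # t) = a # written t"
| "written (Tick # t) = written t"
| "written (Emit # t) = written t"

definition outputs :: "event list \<Rightarrow> nat list list" where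
  "outputs t = map written (butlast (segments t))"

definition delay :: "event list \<Rightarrow> nat" where
  "delay t = Max (length ` set (segments t))"


section \<open>Listing problems\<close>

text \<open>
  The last two components tell which words represent an instance and, given the instance, a
  solution. An object may be represented by several words.
\<close>

record ('i, 'u, 's) listing_problem =
  instances :: "'i set"
  universe :: "'i \<Rightarrow> 'u set"
  solutions :: "'i \<Rightarrow> 's set"
  inst_word :: "'i \<Rightarrow> nat list \<Rightarrow> bool"
  sol_word :: "'i \<Rightarrow> 's \<Rightarrow> nat list \<Rightarrow> bool"

definition run_lists ::
  "('i, 'u, 's) listing_problem \<Rightarrow> 'i \<Rightarrow> com \<Rightarrow> nat list list \<Rightarrow> event list \<Rightarrow> 's list \<Rightarrow> bool"
where
  "run_lists Q x P ws t Ss \<longleftrightarrow>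
     (\<exists>s. exec P (init ws) t s) \<and> list_all2 (sol_word Q x) Ss (outputs t)"

definition polytime_first_solution :: "('i, 'u, 's) listing_problem \<Rightarrow> bool" where
  "polytime_first_solution Q \<longleftrightarrow>
     (\<exists>P c k. \<forall>x\<in>instances Q. \<forall>w. inst_word Q x w \<longrightarrow>
        (\<exists>t. \<exists>S\<in>solutions Q x. run_lists Q x P [w] t [S] \<and>
             length t \<le> c * card (universe Q x) ^ k + c))"

definition polytime_neighbors ::
  "('i, 'u, 's) listing_problem \<Rightarrow> ('i \<Rightarrow> 's \<Rightarrow> 's set) \<Rightarrow> bool" where
  "polytime_neighbors Q nb \<longleftrightarrow>
     (\<exists>P c k. \<forall>x\<in>instances Q. \<forall>w. inst_word Q x w \<longrightarrow>
        (\<forall>S\<in>solutions Q x. \<forall>v. sol_word Q x S v \<longrightarrow>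
          (\<exists>t Ss. run_lists Q x P [w, v] t Ss \<and> set Ss = nb x S \<and>
                  length t \<le> c * card (universe Q x) ^ k + c)))"

definition proximity_searchable :: "('i, 'u, 's) listing_problem \<Rightarrow> bool" where
  "proximity_searchable Q \<longleftrightarrow>
     (\<exists>(cap :: 'i \<Rightarrow> 's \<Rightarrow> 's \<Rightarrow> 'u set) (nb :: 'i \<Rightarrow> 's \<Rightarrow> 's set).
        (\<forall>x\<in>instances Q. \<forall>S\<in>solutions Q x. \<forall>S'\<in>solutions Q x. cap x S S' \<subseteq> universe Q x) \<and>
        (\<forall>x\<in>instances Q. \<forall>S\<in>solutions Q x. nb x S \<subseteq> solutions Q x) \<and>
        polytime_first_solution Q \<and>
        polytime_neighbors Q nb \<and>
        (\<forall>x\<in>instances Q. \<forall>S\<in>solutions Q x. \<forall>S'\<in>solutions Q x. S \<noteq> S' \<longrightarrow>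
           (\<exists>T\<in>nb x S. card (cap x T S') > card (cap x S S'))))"

definition lists_with_delay ::
  "('i, 'u, 's) listing_problem \<Rightarrow> com \<Rightarrow> ('i \<Rightarrow> nat) \<Rightarrow> bool" where
  "lists_with_delay Q P f \<longleftrightarrow>
     (\<forall>x\<in>instances Q. \<forall>w. inst_word Q x w \<longrightarrow>
        (\<exists>t Ss. run_lists Q x P [w] t Ss \<and> distinct Ss \<and> set Ss = solutions Q x \<and>
                delay t \<le> f x))"


section \<open>Listing maximal edge-induced chordal subgraphs\<close>

text \<open>
  As input of an algorithm, a graph has vertices 0, ..., n - 1. A word for a set of edges
  lists the edges, each once, in any order and orientation; a word for a graph consists of
  n, m and a word for its edge set.
\<close>

definition edges_word :: "nat set set \<Rightarrow> nat list \<Rightarrow> bool" where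
  "edges_word F w \<longleftrightarrow>
     (\<exists>es. w = concat (map (\<lambda>(u, v). [u, v]) es) \<and>
           distinct (map (\<lambda>(u, v). {u, v}) es) \<and> set (map (\<lambda>(u, v). {u, v}) es) = F)"

definition graph_word :: "nat set set \<Rightarrow> nat list \<Rightarrow> bool" where
  "graph_word E w \<longleftrightarrow> (\<exists>w'. edges_word E w' \<and> w = card (\<Union>E) # card E # w')"

definition chordal_listing :: "(nat set set, nat set, nat set set) listing_problem" where
  "chordal_listing =
     \<lparr>instances = {E. simple_graph E \<and> \<Union>E = {..<card (\<Union>E)}},
      universe = (\<lambda>E. E),
      solutions = maximal_chordal_subgraphs,
      inst_word = graph_word,
      sol_word = (\<lambda>E. edges_word)\<rparr>"

end

theory Submission
  imports Defs
begin

text \<open>If F \<subset> F' are chordal, take an edge uv of F' - F whose ends have the most common neighbours in F.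
  Then F + uv is chordal. Otherwise F has an induced path from u to v that avoids their common
  neighbours. It forms a cycle of F' with uv, so F' joins two vertices at distance two on it; in F
  these are adjacent to all common neighbours of u and v and also to the vertex between them,
  contradicting the choice of uv. Hence m greedy passes over the edges reach a maximal solution, and
  testing an edge is a search that takes O(mn) steps.

  A solution S has a neighbour for each orientation (v, x) of an edge: among the edges at v keep
  those to common neighbours of v and x, add vx, which leaves a chordal graph, and complete greedily.
  Adding the vertices of a solution S' in reverse perfect elimination order gives an order of its edges
  in which, whenever vx comes after vy, it also comes after xy. If vx is the first edge of S' that S
  lacks, then the neighbour of S for (v, x) contains vx and all edges of S' before it. So a proximity
  that counts the edges before the first missing one increases.

  The listing is a breadth-first search of the graph of solutions, with a queue of the solutions found
  and a binary trie to recognise them. It outputs a solution when it takes it from the queue, so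
  the delay is the time for 2m completions, each of m passes with m searches.\<close>

section \<open>Maximal chordal subgraphs\<close>

text \<open>Chordality is not inherited by subsets of the edges. So an edge refused once may be
  addable later (on a path abcd the edge ad becomes addable after ac), which is why one pass is not
  enough. Stability under single edges implies maximality only because chordal graphs are sandwich
  monotone: between two nested chordal edge sets one can climb edge by edge. The same obstacle
  shapes the neighbours: adding vx to a solution may destroy chordality, and pruning the edges at
  one end repairs it, since a vertex adjacent to both ends of an induced path of a chordal graph is
  adjacent to all of it. This fan property carries both halves of the combinatorics. The machine
  side is shaped by the absence of addition and multiplication. Arrays are interleaved with stride
  16 and running counters replace products. The number of solutions may be exponential and must not
  enter the delay: hence a trie, whose look-ups have length m. The loops inside one round are
  bounded by m or n, so that its time is at most a monomial computed from the program text.\<close>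

lemma simple_graph_mono: "simple_graph E \<Longrightarrow> F \<subseteq> E \<Longrightarrow> simple_graph F"
  unfolding simple_graph_def using finite_subset by blast

lemma simple_graph_irrefl: "simple_graph F \<Longrightarrow> {a, b} \<in> F \<Longrightarrow> a \<noteq> b"
  unfolding simple_graph_def by force

lemma simple_graph_finite_vertices: "simple_graph F \<Longrightarrow> finite (\<Union>F)"
  unfolding simple_graph_def by (intro finite_Union) (auto intro: card_ge_0_finite)

subsection \<open>Cycles and induced paths\<close>

lemma is_cycle_rotate1:
  assumes "is_cycle F vs" shows "is_cycle F (rotate1 vs)"
proof -
  have m: "Suc i mod length vs < length vs" if "i < length vs" for i
    using that by (intro mod_less_divisor) linarith
  then show ?thesis using assms unfolding is_cycle_def
    by (auto simp: nth_rotate1)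
qed

lemma Suc_mod_inj:
  assumes "i < n" "j < n" "Suc i mod n = Suc j mod n" shows "i = j"
  using assms by (auto simp: mod_Suc split: if_splits)

lemma has_chord_rotate1:
  assumes "has_chord F (rotate1 vs)" shows "has_chord F vs"
proof -
  let ?n = "length vs"
  obtain i j where ij: "i < ?n" "j < ?n" "i \<noteq> j" "j \<noteq> Suc i mod ?n" "i \<noteq> Suc j mod ?n"
    "{rotate1 vs ! i, rotate1 vs ! j} \<in> F"
    using assms unfolding has_chord_def by auto
  then have *: "{vs ! (Suc i mod ?n), vs ! (Suc j mod ?n)} \<in> F"
    by (simp add: nth_rotate1)
  have pos: "?n > 0" using ij(1) by linarith
  show ?thesis unfolding has_chord_def
    apply (rule exI[of _ "Suc i mod ?n"], rule conjI, use pos in simp)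
    apply (rule exI[of _ "Suc j mod ?n"], intro conjI)
    using pos * ij Suc_mod_inj[of i ?n j] Suc_mod_inj[of j ?n "Suc i mod ?n"]
      Suc_mod_inj[of i ?n "Suc j mod ?n"] by auto
qed

text \<open>A rotation moves a chosen edge of a cycle to the closing position, or a chosen vertex to
  index 0; after that \<open>is_cycle_iff\<close> and \<open>has_chord_iff\<close> allow indices
  without a modulus.\<close>

lemma is_cycle_rotate: "is_cycle F vs \<Longrightarrow> is_cycle F (rotate k vs)"
  by (induction k) (auto simp: is_cycle_rotate1)

lemma has_chord_rotate: "has_chord F (rotate k vs) \<Longrightarrow> has_chord F vs"
  by (induction k) (auto dest: has_chord_rotate1)

lemma is_cycle_iff:
  assumes "length vs \<ge> 3"
  shows "is_cycle F vs \<longleftrightarrow> distinct vs \<and> (\<forall>i. Suc i < length vs \<longrightarrow> {vs ! i, vs ! Suc i} \<in> F) \<and>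
     {vs ! (length vs - 1), vs ! 0} \<in> F"
proof -
  let ?n = "length vs"
  have "(\<forall>i<?n. {vs ! i, vs ! (Suc i mod ?n)} \<in> F) \<longleftrightarrow>
    (\<forall>i. Suc i < ?n \<longrightarrow> {vs ! i, vs ! Suc i} \<in> F) \<and> {vs ! (?n - 1), vs ! 0} \<in> F"
    (is "?L \<longleftrightarrow> ?R")
  proof
    assume L: ?L
    have "{vs ! i, vs ! Suc i} \<in> F" if "Suc i < ?n" for i
      using L[rule_format, of i] that by simp
    moreover have "{vs ! (?n - 1), vs ! 0} \<in> F"
      using L[rule_format, of "?n - 1"] assms by (cases ?n) auto
    ultimately show ?R by blast
  next
    assume R: ?R
    show ?L
    proof (intro allI impI)
      fix i assume "i < ?n"
      then consider "Suc i < ?n" | "i = ?n - 1" by linarith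
      then show "{vs ! i, vs ! (Suc i mod ?n)} \<in> F"
      proof cases
        case 2
        then have "Suc i = ?n" using assms by linarith
        then show ?thesis using R 2 by simp
      qed (use R in simp)
    qed
  qed
  then show ?thesis using assms unfolding is_cycle_def by auto
qed

lemma has_chord_iff:
  assumes "length vs > 3"
  shows "has_chord F vs \<longleftrightarrow> (\<exists>i j. Suc i < j \<and> j < length vs \<and> (i \<noteq> 0 \<or> Suc j \<noteq> length vs) \<and>
     {vs ! i, vs ! j} \<in> F)"
proof -
  let ?n = "length vs"
  have Sm: "Suc i mod ?n = (if Suc i = ?n then 0 else Suc i)" if "i < ?n" for i
    using that by auto
  show ?thesis
  proof
    assume "has_chord F vs"
    then obtain i j where ij: "i < ?n" "j < ?n" "i \<noteq> j" "j \<noteq> Suc i mod ?n" "i \<noteq> Suc j mod ?n"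
      "{vs ! i, vs ! j} \<in> F" unfolding has_chord_def by blast
    consider "i < j" | "j < i" using ij(3) by linarith
    then show "\<exists>i j. Suc i < j \<and> j < ?n \<and> (i \<noteq> 0 \<or> Suc j \<noteq> ?n) \<and> {vs ! i, vs ! j} \<in> F"
    proof cases
      case 1
      then have "Suc i < j \<and> j < ?n \<and> (i \<noteq> 0 \<or> Suc j \<noteq> ?n)"
        using ij Sm[of i] Sm[of j] by (auto split: if_splits)
      then show ?thesis using ij(6) by blast
    next
      case 2
      then have "Suc j < i \<and> i < ?n \<and> (j \<noteq> 0 \<or> Suc i \<noteq> ?n)"
        using ij Sm[of i] Sm[of j] by (auto split: if_splits)
      then show ?thesis using ij(6) by (metis insert_commute)
    qed
  next
    assume "\<exists>i j. Suc i < j \<and> j < ?n \<and> (i \<noteq> 0 \<or> Suc j \<noteq> ?n) \<and> {vs ! i, vs ! j} \<in> F"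
    then obtain i j where ij: "Suc i < j" "j < ?n" "i \<noteq> 0 \<or> Suc j \<noteq> ?n" "{vs ! i, vs ! j} \<in> F"
      by blast
    then show "has_chord F vs" unfolding has_chord_def
      using Sm[of i] Sm[of j]
      by (intro exI[of _ i] conjI exI[of _ j]) (auto split: if_splits)
  qed
qed

section \<open>Induced paths and fans\<close>

definition induced_path :: "'a set set \<Rightarrow> 'a list \<Rightarrow> bool" where
  "induced_path F ps \<longleftrightarrow> ps \<noteq> [] \<and> distinct ps \<and>
     (\<forall>i. Suc i < length ps \<longrightarrow> {ps ! i, ps ! Suc i} \<in> F) \<and>
     (\<forall>i j. Suc i < j \<longrightarrow> j < length ps \<longrightarrow> {ps ! i, ps ! j} \<notin> F)"

lemma chordless_cycle:
  assumes "is_cycle F vs" "\<not> has_chord F vs" "length vs > 3" "Suc i < j" "j < length vs"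
    "{vs ! i, vs ! j} \<in> F"
  shows "i = 0 \<and> Suc j = length vs"
  using assms has_chord_iff[OF assms(3)] by blast

lemma induced_path_tl:
  assumes "induced_path F (p # q # ps)" shows "induced_path F (q # ps)"
  using assms unfolding induced_path_def
proof (safe, goal_cases)
  case (2 i) then show ?case by (metis Suc_less_eq length_Cons nth_Cons_Suc)
next
  case (3 i j) then show ?case by (metis Suc_less_eq length_Cons nth_Cons_Suc)
qed simp

text \<open>A first neighbour further along the path would close a chordless cycle.\<close>

lemma fan_second:
  assumes ch: "chordal F" and p: "induced_path F ps" and w: "w \<notin> set ps"
    and len: "length ps \<ge> 2"
    and adj: "{w, ps ! 0} \<in> F" "{w, ps ! (length ps - 1)} \<in> F"
  shows "{w, ps ! 1} \<in> F"
proof -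
  define j where "j = (LEAST j. j \<ge> 1 \<and> j < length ps \<and> {w, ps ! j} \<in> F)"
  have ex: "length ps - 1 \<ge> 1 \<and> length ps - 1 < length ps \<and> {w, ps ! (length ps - 1)} \<in> F"
    using len adj by auto
  have j: "j \<ge> 1 \<and> j < length ps \<and> {w, ps ! j} \<in> F"
    unfolding j_def by (rule LeastI[of "\<lambda>j. j \<ge> 1 \<and> j < length ps \<and> {w, ps ! j} \<in> F"]) (rule ex)
  have jmin: "{w, ps ! i} \<notin> F" if "1 \<le> i" "i < j" for i
    using not_less_Least[of i "\<lambda>j. j \<ge> 1 \<and> j < length ps \<and> {w, ps ! j} \<in> F"] that j
    unfolding j_def by auto
  have "j = 1"
  proof (rule ccontr)
    assume "j \<noteq> 1"
    define vs where "vs = w # take (Suc j) ps"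
    have lv: "length vs = j + 2" using j unfolding vs_def by simp
    have l3: "length vs > 3" using lv j \<open>j \<noteq> 1\<close> by linarith
    have nth: "vs ! Suc i = ps ! i" if "i \<le> j" for i using that unfolding vs_def by simp
    have "is_cycle F vs"
    proof (subst is_cycle_iff, goal_cases)
      case 1 show ?case using l3 by simp
    next
      case 2
      have "distinct vs" using p w unfolding vs_def induced_path_def
        by (auto dest: in_set_takeD)
      moreover have "{vs ! i, vs ! Suc i} \<in> F" if "Suc i < length vs" for i
      proof (cases i)
        case 0 then show ?thesis using adj(1) nth[of 0] by (simp add: vs_def)
      next
        case (Suc i') then show ?thesis using that lv nth[of i'] nth[of i] j p
          unfolding induced_path_def by simp
      qed
      moreover have "{vs ! (length vs - 1), vs ! 0} \<in> F"
        using j nth[of j] lv by (simp add: vs_def insert_commute)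
      ultimately show ?case by blast
    qed
    then have "has_chord F vs" using ch l3 unfolding chordal_def by blast
    then obtain i k where ik: "Suc i < k" "k < length vs" "i \<noteq> 0 \<or> Suc k \<noteq> length vs"
      "{vs ! i, vs ! k} \<in> F" using has_chord_iff[OF l3] by blast
    obtain k' where k': "k = Suc k'" using ik(1) by (cases k) auto
    show False
    proof (cases i)
      case 0
      then show False using jmin[of k'] ik lv k' nth[of k'] by (simp add: vs_def)
    next
      case (Suc i')
      then show False using ik lv k' nth[of k'] nth[of i'] j p
        unfolding induced_path_def by auto
    qed
  qed
  then show ?thesis using j by simp
qed

text \<open>By \<open>fan_second\<close> w is adjacent to the second vertex, and the tail of the
  path is a shorter induced path with both ends adjacent to w.\<close>

lemma fan:
  assumes "chordal F" "induced_path F ps" "w \<notin> set ps"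
    and "{w, ps ! 0} \<in> F" "{w, ps ! (length ps - 1)} \<in> F" "i < length ps"
  shows "{w, ps ! i} \<in> F"
  using assms(2-)
proof (induction ps arbitrary: i)
  case Nil then show ?case by simp
next
  case (Cons p ps)
  show ?case
  proof (cases i)
    case 0 then show ?thesis using Cons.prems by simp
  next
    case (Suc k)
    then obtain q qs where ps: "ps = q # qs" using Cons.prems by (cases ps) auto
    have "{w, q} \<in> F" using fan_second[OF assms(1) Cons.prems(1,2)] Cons.prems ps by simp
    then have "{w, ps ! k} \<in> F"
      using Cons.IH[of k] Cons.prems Suc ps induced_path_tl[of F p q qs] by simp
    then show ?thesis using Suc by simp
  qed
qed

subsection \<open>Reachability\<close>

text \<open>Only the vertices entered are tested against \<open>B\<close>: the start may lie in
  \<open>B\<close>, so reversing a walk in \<open>reach_sym\<close> requires that it does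
  not.\<close>

definition reach :: "'a set set \<Rightarrow> 'a set \<Rightarrow> 'a \<Rightarrow> 'a \<Rightarrow> bool" where
  "reach F B = (\<lambda>a b. {a, b} \<in> F \<and> b \<notin> B)\<^sup>*\<^sup>*"

definition nbrs :: "'a set set \<Rightarrow> 'a \<Rightarrow> 'a set" where
  "nbrs F v = {y. {v, y} \<in> F}"

lemma reach_refl [simp]: "reach F B u u" unfolding reach_def by simp

lemma reach_step: "reach F B u v \<Longrightarrow> {v, w} \<in> F \<Longrightarrow> w \<notin> B \<Longrightarrow> reach F B u w"
  unfolding reach_def by (rule rtranclp.rtrancl_into_rtrancl) auto

lemma reach_trans: "reach F B u v \<Longrightarrow> reach F B v w \<Longrightarrow> reach F B u w"
  unfolding reach_def by simp

lemma reach_induct [consumes 1, case_names refl step]: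
  assumes "reach F B u v" "P u"
    "\<And>v w. reach F B u v \<Longrightarrow> P v \<Longrightarrow> {v, w} \<in> F \<Longrightarrow> w \<notin> B \<Longrightarrow> P w"
  shows "P v"
  using assms(1) unfolding reach_def
  by (induction rule: rtranclp_induct) (use assms reach_def in metis)+

lemma reach_sym:
  assumes "reach F B u v" "u \<notin> B" shows "reach F B v u"
proof -
  have "reach F B v u \<and> v \<notin> B"
    using assms(1)
  proof (induction rule: reach_induct)
    case refl then show ?case using assms(2) by simp
  next
    case (step v w)
    have "reach F B w v" using reach_step[of F B w w v] step by (simp add: insert_commute)
    then show ?case using step reach_trans[of F B w v u] by blast
  qed
  then show ?thesis ..
qed

lemma reach_nth:
  assumes "\<And>i. Suc i < length ps \<Longrightarrow> {ps ! i, ps ! Suc i} \<in> F"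
    "\<And>i. 0 < i \<Longrightarrow> i < length ps \<Longrightarrow> ps ! i \<notin> B" "k < length ps"
  shows "reach F B (ps ! 0) (ps ! k)"
  using assms(3)
proof (induction k)
  case (Suc k)
  then show ?case using reach_step[of F B "ps ! 0" "ps ! k" "ps ! Suc k"] assms by simp
qed simp

lemma induced_path_take:
  assumes "induced_path F ps" "k < length ps" shows "induced_path F (take (Suc k) ps)"
  using assms unfolding induced_path_def by auto

lemma induced_path_snoc:
  assumes "induced_path F ps" "w \<notin> set ps" "{ps ! (length ps - 1), w} \<in> F"
    "\<And>i. i < length ps - 1 \<Longrightarrow> {ps ! i, w} \<notin> F"
  shows "induced_path F (ps @ [w])"
  unfolding induced_path_def
proof (intro conjI allI impI)
  fix i assume "Suc i < length (ps @ [w])"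
  then consider "Suc i < length ps" | "i = length ps - 1" "ps \<noteq> []" by force
  then show "{(ps @ [w]) ! i, (ps @ [w]) ! Suc i} \<in> F"
    by cases (use assms in \<open>auto simp: induced_path_def nth_append\<close>)
next
  fix i j assume "Suc i < j" "j < length (ps @ [w])"
  then consider "j < length ps" | "j = length ps" by force
  then show "{(ps @ [w]) ! i, (ps @ [w]) ! j} \<notin> F"
    by cases (use assms \<open>Suc i < j\<close> in \<open>auto simp: induced_path_def nth_append\<close>)
qed (use assms in \<open>auto simp: induced_path_def\<close>)

text \<open>The path is kept induced while the walk grows. A new vertex that is already on the path
  cuts it back to that place; any other is attached to the first path vertex adjacent to it, and the
  part after that vertex is dropped, so no chord arises.\<close>

lemma reach_induced_path:
  assumes "reach F B u v"
  shows "\<exists>ps. induced_path F ps \<and> ps ! 0 = u \<and> ps ! (length ps - 1) = v \<and>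
    (\<forall>i. 0 < i \<longrightarrow> i < length ps \<longrightarrow> ps ! i \<notin> B)"
  using assms
proof (induction rule: reach_induct)
  case refl
  show ?case by (rule exI[of _ "[u]"]) (auto simp: induced_path_def)
next
  case (step v w)
  then obtain ps where ps: "induced_path F ps" "ps ! 0 = u" "ps ! (length ps - 1) = v"
    "\<forall>i. 0 < i \<longrightarrow> i < length ps \<longrightarrow> ps ! i \<notin> B" by blast
  have ne: "ps \<noteq> []" using ps(1) unfolding induced_path_def by blast
  show ?case
  proof (cases "w \<in> set ps")
    case True
    then obtain k where k: "k < length ps" "ps ! k = w" by (auto simp: in_set_conv_nth)
    show ?thesis
      by (rule exI[of _ "take (Suc k) ps"])
        (use ps k induced_path_take[OF ps(1) k(1)] in auto)
  next
    case False
    define k where "k = (LEAST k. {ps ! k, w} \<in> F)"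
    have kF: "{ps ! k, w} \<in> F" unfolding k_def
      by (rule LeastI[of _ "length ps - 1"]) (use ps step in simp)
    have kle: "k \<le> length ps - 1" unfolding k_def by (rule Least_le) (use ps step in simp)
    have kmin: "{ps ! i, w} \<notin> F" if "i < k" for i
      using that unfolding k_def by (rule not_less_Least)
    have kl: "k < length ps" using kle ne by (cases ps) auto
    let ?q = "take (Suc k) ps"
    have lq: "length ?q = Suc k" using kl by simp
    have nq: "?q ! i = ps ! i" if "i \<le> k" for i using that by simp
    have "induced_path F (?q @ [w])"
    proof (rule induced_path_snoc[OF induced_path_take[OF ps(1) kl]])
      show "w \<notin> set ?q" using False by (auto dest: in_set_takeD)
      show "{?q ! (length ?q - 1), w} \<in> F" unfolding lq using kF by simp
      show "{?q ! i, w} \<notin> F" if "i < length ?q - 1" for i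
        using that kmin nq unfolding lq by simp
    qed
    moreover have "(?q @ [w]) ! i \<notin> B" if "0 < i" "i < length (?q @ [w])" for i
    proof (cases "i \<le> k")
      case True then show ?thesis using ps(4) kl that nq lq by (simp add: nth_append del: length_take)
    next
      case False
      then have "i = Suc k" using that lq by simp
      then show ?thesis using step lq by (simp add: nth_append del: length_take)
    qed
    moreover have "(?q @ [w]) ! 0 = u" using ps(2) nq lq by (simp add: nth_append del: length_take)
    moreover have "(?q @ [w]) ! (length (?q @ [w]) - 1) = w"
      using lq by (simp add: nth_append del: length_take)
    ultimately show ?thesis by blast
  qed
qed

subsection \<open>Adding and removing edges\<close>

text \<open>An induced path from u to v that avoids their common neighbours would become a chordless
  cycle with uv; the condition says that deleting the common neighbours separates the ends.\<close>

definition addable :: "'a set set \<Rightarrow> 'a \<Rightarrow> 'a \<Rightarrow> bool" where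
  "addable F u v \<longleftrightarrow> \<not> reach F (nbrs F u \<inter> nbrs F v) u v"

section \<open>Edges that can be added to a chordal graph\<close>

lemma induced_path_of_chordless_cycle:
  assumes "is_cycle F vs" "\<not> has_chord F vs" "length vs > 3" "F' \<subseteq> F" "{vs ! (length vs - 1), vs ! 0} \<notin> F'"
    "\<And>i. Suc i < length vs \<Longrightarrow> {vs ! i, vs ! Suc i} \<in> F'"
  shows "induced_path F' vs"
  unfolding induced_path_def
proof (intro conjI allI impI)
  fix i j assume ij: "Suc i < j" "j < length vs"
  show "{vs ! i, vs ! j} \<notin> F'"
  proof
    assume *: "{vs ! i, vs ! j} \<in> F'"
    then have "i = 0" "Suc j = length vs"
      using chordless_cycle[OF assms(1-3) ij] assms(4) by auto
    moreover have "j = length vs - 1" using \<open>Suc j = length vs\<close> by simp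
    ultimately show False using * assms(5) by (metis insert_commute)
  qed
qed (use assms in \<open>auto simp: is_cycle_def\<close>)

text \<open>A new chordless cycle must use uv. Turned so that uv closes it, it is an induced path of
  F. Having at least four vertices, it contains no common neighbour of its ends, and so it is a walk
  forbidden by \<open>addable\<close>.\<close>

lemma chordal_insert:
  assumes ch: "chordal F" and u: "u \<noteq> v" and add: "addable F u v"
  shows "chordal (insert {u, v} F)"
proof (rule ccontr)
  let ?F = "insert {u, v} F"
  assume "\<not> chordal ?F"
  then obtain vs where vs: "is_cycle ?F vs" "length vs > 3" "\<not> has_chord ?F vs"
    unfolding chordal_def by blast
  have "\<not> is_cycle F vs"
  proof
    assume "is_cycle F vs"
    then have "has_chord F vs" using ch vs unfolding chordal_def by blast
    then show False using vs(3) unfolding has_chord_def by blast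
  qed
  then obtain i where i: "i < length vs" "{vs ! i, vs ! (Suc i mod length vs)} \<notin> F"
    using vs unfolding is_cycle_def by auto
  \<comment> \<open>This rotation makes the edge that is missing from F the closing one.\<close>
  define ws where "ws = rotate (Suc i) vs"
  let ?n = "length ws"
  have n: "?n = length vs" unfolding ws_def by simp
  have ws: "is_cycle ?F ws" "\<not> has_chord ?F ws" "?n > 3"
    using is_cycle_rotate[OF vs(1), of "Suc i"] has_chord_rotate[of ?F "Suc i" vs] vs n
    unfolding ws_def by (blast, blast, simp)
  have "ws ! 0 = vs ! (Suc i mod length vs)" "ws ! (?n - 1) = vs ! i"
  proof -
    have "0 < length vs" "length vs - 1 < length vs" using vs(2) by linarith+
    moreover have "Suc i + (length vs - 1) = i + length vs" using vs(2) by linarith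
    ultimately show "ws ! 0 = vs ! (Suc i mod length vs)" "ws ! (?n - 1) = vs ! i"
      unfolding n unfolding ws_def using i by (simp_all add: nth_rotate del: rotate_Suc)
  qed
  then have e: "{ws ! (?n - 1), ws ! 0} \<notin> F" using i by simp
  have cyc: "distinct ws" "\<And>j. Suc j < ?n \<Longrightarrow> {ws ! j, ws ! Suc j} \<in> ?F"
    "{ws ! (?n - 1), ws ! 0} \<in> ?F"
    using ws(1) ws(3) by (auto simp: is_cycle_iff)
  have euv: "{ws ! (?n - 1), ws ! 0} = {u, v}" using cyc(3) e by blast
  have inj: "a = b" if "ws ! a = ws ! b" "a < ?n" "b < ?n" for a b
    using that cyc(1) nth_eq_iff_index_eq by blast
  have path: "induced_path F ws"
  proof (rule induced_path_of_chordless_cycle[OF ws _ e])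
    show "{ws ! j, ws ! Suc j} \<in> F" if "Suc j < ?n" for j
    proof -
      have "ws ! j \<noteq> ws ! (?n - 1)" using inj[of j "?n - 1"] that by fastforce
      moreover have "\<not> (ws ! j = ws ! 0 \<and> ws ! Suc j = ws ! (?n - 1))"
        using inj[of j 0] inj[of "Suc j" "?n - 1"] that ws(3) by linarith
      ultimately have "{ws ! j, ws ! Suc j} \<noteq> {u, v}"
        unfolding euv[symmetric] doubleton_eq_iff by blast
      then show ?thesis using cyc(2)[OF that] by blast
    qed
  qed auto
  let ?B = "nbrs F u \<inter> nbrs F v"
  have B: "ws ! j \<notin> ?B" if "j < ?n" for j
  proof
    assume "ws ! j \<in> ?B"
    then have *: "{u, ws ! j} \<in> F" "{v, ws ! j} \<in> F" by (auto simp: nbrs_def)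
    then have **: "{ws ! 0, ws ! j} \<in> F" "{ws ! j, ws ! (?n - 1)} \<in> F"
      using euv by (auto simp: doubleton_eq_iff insert_commute)
    have np: "{ws ! a, ws ! b} \<notin> F" if "Suc a < b" "b < ?n" for a b
      using path that unfolding induced_path_def by blast
    \<comment> \<open>With at least four vertices, every position is at distance two or more from
      one of the ends.\<close>
    consider "j > 1" | "j < ?n - 2" using ws(3) by linarith
    then show False
    proof cases
      case 1 then show False using **(1) np[of 0 j] that by simp
    next
      case 2
      then have "Suc j < ?n - 1" "?n - 1 < ?n" by linarith+
      then show False using **(2) np by blast
    qed
  qed
  have r: "reach F ?B (ws ! 0) (ws ! (?n - 1))"
    by (rule reach_nth) (use path B ws(3) in \<open>auto simp: induced_path_def\<close>)
  \<comment> \<open>The equation of unordered pairs does not tell which end is u, so reachability is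
    needed in both directions.\<close>
  have "ws ! 0 \<notin> ?B" using B ws(3) by (metis gr_implies_not0 not_gr_zero)
  then have "reach F ?B (ws ! (?n - 1)) (ws ! 0)" using r reach_sym by metis
  then show False using r add euv unfolding addable_def by (auto simp: doubleton_eq_iff)
qed

text \<open>The segment between the ends of a chord closes a cycle of F'. Unless that is a triangle,
  it has a chord, which spans a shorter segment: hence induction on \<open>j - i\<close>.\<close>

lemma two_apart_on_cycle:
  assumes ch: "chordal F'" and d: "distinct ps"
    and p: "\<And>i. Suc i < length ps \<Longrightarrow> {ps ! i, ps ! Suc i} \<in> F'"
    and ij: "Suc i < j" "j < length ps" "{ps ! i, ps ! j} \<in> F'"
  shows "\<exists>k. Suc (Suc k) < length ps \<and> {ps ! k, ps ! Suc (Suc k)} \<in> F'"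
  using ij
proof (induction "j - i" arbitrary: i j rule: less_induct)
  case less
  show ?case
  proof (cases "j = Suc (Suc i)")
    case True then show ?thesis using less by blast
  next
    case False
    define vs where "vs = take (Suc (j - i)) (drop i ps)"
    have lv: "length vs = Suc (j - i)" using less unfolding vs_def by simp
    have l3: "length vs > 3" using lv False less.prems by linarith
    have nth: "vs ! a = ps ! (i + a)" if "a \<le> j - i" for a
      using that less.prems unfolding vs_def by simp
    have "is_cycle F' vs"
      apply (subst is_cycle_iff)
      subgoal using l3 by simp
      subgoal using d p lv nth less.prems unfolding vs_def[symmetric]
        by (auto simp: vs_def[symmetric] insert_commute) (simp add: vs_def)
      done
    then obtain a b where ab: "Suc a < b" "b < length vs" "a \<noteq> 0 \<or> Suc b \<noteq> length vs" "{vs ! a, vs ! b} \<in> F'"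
      using ch l3 has_chord_iff[OF l3] unfolding chordal_def by blast
    show ?thesis
      by (rule less.hyps[of "i + b" "i + a"]) (use ab lv nth less.prems in auto)
  qed
qed

text \<open>Replacing a non-addable edge by a shorter chord of the obstructing induced path strictly
  enlarges its common neighbourhood, by the fan lemma.\<close>

lemma common_nbrs_increase:
  assumes ch: "chordal F" "chordal F'" and sub: "F \<subseteq> F'" and fin: "simple_graph F"
    and uv: "{u, v} \<in> F'" "{u, v} \<notin> F" and na: "\<not> addable F u v" and ne: "u \<noteq> v"
  shows "\<exists>a b. {a, b} \<in> F' - F \<and> card (nbrs F u \<inter> nbrs F v) < card (nbrs F a \<inter> nbrs F b)"
proof -
  let ?B = "nbrs F u \<inter> nbrs F v"
  obtain ps where ps: "induced_path F ps" "ps ! 0 = u" "ps ! (length ps - 1) = v"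
    "\<forall>i. 0 < i \<longrightarrow> i < length ps \<longrightarrow> ps ! i \<notin> ?B"
    using na reach_induced_path unfolding addable_def by metis
  let ?n = "length ps"
  have pn: "{ps ! i, ps ! Suc i} \<in> F" if "Suc i < ?n" for i
    using that ps(1) unfolding induced_path_def by blast
  have pi: "{ps ! i, ps ! j} \<notin> F" if "Suc i < j" "j < ?n" for i j
    using that ps(1) unfolding induced_path_def by blast
  have d: "distinct ps" using ps(1) unfolding induced_path_def by blast
  have "?n \<noteq> 0" using ps(1) unfolding induced_path_def by simp
  moreover have "?n \<noteq> 1" using ps(2,3) ne by auto
  moreover have "?n \<noteq> 2"
  proof
    assume "?n = 2"
    then show False using pn[of 0] ps(2,3) uv(2) by simp
  qed
  \<comment> \<open>The middle of a path on three vertices would be a common neighbour of u and v,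
    and the path avoids these.\<close>
  moreover have "?n \<noteq> 3"
  proof
    assume "?n = 3"
    then have "ps ! 1 \<in> ?B" using pn[of 0] pn[of 1] ps(2,3)
      by (simp add: nbrs_def insert_commute numeral_2_eq_2)
    moreover have "ps ! 1 \<notin> ?B" using ps(4) \<open>?n = 3\<close> by (metis one_less_numeral_iff semiring_norm(77) zero_less_one)
    ultimately show False by blast
  qed
  ultimately have n4: "?n \<ge> 4" by linarith
  have n1: "Suc 0 < ?n - 1" "?n - 1 < ?n" using n4 by linarith+
  have "{ps ! 0, ps ! (?n - 1)} \<in> F'" using ps(2,3) uv(1) by simp
  then obtain k where k: "Suc (Suc k) < ?n" "{ps ! k, ps ! Suc (Suc k)} \<in> F'"
    using two_apart_on_cycle[OF ch(2) d _ n1] pn sub by blast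
  let ?a = "ps ! k" and ?b = "ps ! Suc (Suc k)" and ?c = "ps ! Suc k"
  have fanB: "{w, ps ! i} \<in> F" if "w \<in> ?B" "i < ?n" for w i
  proof -
    have "w \<notin> set ps"
    proof
      assume "w \<in> set ps"
      then obtain i where "i < ?n" "w = ps ! i" by (metis in_set_conv_nth)
      then show False using ps(4) that(1) ps(2) simple_graph_irrefl[OF fin, of u u] by (cases i) (auto simp: nbrs_def)
    qed
    then show ?thesis using fan[OF ch(1) ps(1), of w i] that ps(2,3)
      by (auto simp: nbrs_def insert_commute)
  qed
  have "?B \<subseteq> nbrs F ?a \<inter> nbrs F ?b"
    using fanB[of _ k] fanB[of _ "Suc (Suc k)"] k by (auto simp: nbrs_def insert_commute)
  moreover have "?c \<in> nbrs F ?a \<inter> nbrs F ?b"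
    using pn[of k] pn[of "Suc k"] k(1) by (auto simp: nbrs_def insert_commute)
  moreover have "?c \<notin> ?B" using ps(4) k(1) by simp
  ultimately have "?B \<subset> nbrs F ?a \<inter> nbrs F ?b" by blast
  moreover have "finite (nbrs F ?a \<inter> nbrs F ?b)"
    by (rule finite_subset[OF _ simple_graph_finite_vertices[OF fin]]) (auto simp: nbrs_def)
  ultimately have "card ?B < card (nbrs F ?a \<inter> nbrs F ?b)" by (simp add: psubset_card_mono)
  moreover have "{?a, ?b} \<in> F' - F" using k pi[of k "Suc (Suc k)"] by simp
  ultimately show ?thesis by blast
qed

text \<open>This is the sandwich monotonicity of chordal graphs. Both orders of the ends are covered
  because \<open>addable\<close> searches from its first argument, while the edge table fixes the
  orientation of each edge.\<close>

lemma addable_edge_exists: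
  assumes "chordal F" "chordal F'" "F \<subset> F'" "simple_graph F'"
  shows "\<exists>u v. {u, v} \<in> F' - F \<and> (\<forall>a b. {a, b} = {u, v} \<longrightarrow> addable F a b)"
proof -
  have sF: "simple_graph F" using assms simple_graph_mono by blast
  define c where "c = (\<lambda>(u, v). card (nbrs F u \<inter> nbrs F v))"
  let ?S = "{(u, v). {u, v} \<in> F' - F}"
  have "finite ?S"
    by (rule finite_subset[of _ "\<Union>F' \<times> \<Union>F'"])
      (use simple_graph_finite_vertices[OF assms(4)] in auto)
  moreover have "?S \<noteq> {}"
  proof -
    obtain e where e: "e \<in> F' - F" using assms(3) by blast
    then have "card e = 2" using assms(4) unfolding simple_graph_def by blast
    then show ?thesis using e by (auto simp: card_2_iff)
  qed
  ultimately have "Max (c ` ?S) \<in> c ` ?S" and max: "\<forall>q \<in> ?S. c q \<le> Max (c ` ?S)"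
    by (intro Max_in; simp) (use \<open>finite ?S\<close> in simp)
  then obtain p where "p \<in> ?S" "Max (c ` ?S) = c p" by (elim imageE)
  then have p: "p \<in> ?S" "\<forall>q \<in> ?S. c q \<le> c p" using max by simp_all
  obtain u v where uv: "p = (u, v)" by force
  have "addable F a b" if ab: "{a, b} = {u, v}" for a b
  proof (rule ccontr)
    assume "\<not> addable F a b"
    moreover have uvF: "{u, v} \<in> F' - F" using p(1) uv by simp
    moreover have "a \<noteq> b" using simple_graph_irrefl[OF assms(4), of a b] ab uvF by auto
    ultimately obtain a' b' where "{a', b'} \<in> F' - F" "c (a, b) < c (a', b')"
      using common_nbrs_increase[OF assms(1,2) _ sF, of a b] assms(3) ab p uv unfolding c_def by auto
    moreover have "c (a, b) = c p" using ab uv unfolding c_def by (auto simp: doubleton_eq_iff Int_commute)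
    ultimately show False using p(2) by fastforce
  qed
  then show ?thesis using p uv by blast
qed

text \<open>Made to fit \<open>canonical_order\<close>: if vx comes next in such an order, then
  every earlier edge vy has xy before it, so pruning at v spares all earlier edges.\<close>

definition attach :: "'a set set \<Rightarrow> 'a \<Rightarrow> 'a \<Rightarrow> 'a set set" where
  "attach F v x = {e \<in> F. v \<notin> e} \<union> {{v, y} | y. y \<in> nbrs F v \<inter> nbrs F x} \<union> {{v, x}}"

lemma attach_away: "v \<notin> e \<Longrightarrow> e \<in> attach F v x \<longleftrightarrow> e \<in> F"
  unfolding attach_def by auto

lemma attach_at: "v \<noteq> x \<Longrightarrow> {v, y} \<in> attach F v x \<longleftrightarrow> y = x \<or> y \<in> nbrs F v \<inter> nbrs F x"
  unfolding attach_def by (auto simp: doubleton_eq_iff)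

text \<open>A chordless cycle has to pass through v; the rest of it is an induced path of F whose
  ends are x or common neighbours of v and x. If x is on the path, it is an end and is adjacent to
  the other end, a contradiction. Otherwise \<open>fan\<close>, centred at v and at x, makes the
  second vertex a common neighbour too; its edge to v has been kept and is a chord.\<close>

lemma chordal_attach:
  assumes ch: "chordal F" and vx: "v \<noteq> x"
  shows "chordal (attach F v x)"
proof (rule ccontr)
  let ?F = "attach F v x"
  assume "\<not> chordal ?F"
  then obtain vs where vs: "is_cycle ?F vs" "length vs > 3" "\<not> has_chord ?F vs"
    unfolding chordal_def by blast
  show False
  proof (cases "v \<in> set vs")
    case False
    then have *: "{vs ! i, vs ! j} \<in> ?F \<longleftrightarrow> {vs ! i, vs ! j} \<in> F" if "i < length vs" "j < length vs" for i j
      using attach_away[of v "{vs ! i, vs ! j}"] that nth_mem[of i vs] nth_mem[of j vs] False by blast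
    have "is_cycle F vs" unfolding is_cycle_def
    proof (intro conjI allI impI)
      fix i assume i: "i < length vs"
      then have "Suc i mod length vs < length vs" by (intro mod_less_divisor) linarith
      then show "{vs ! i, vs ! (Suc i mod length vs)} \<in> F"
        using vs(1) i *[OF i] unfolding is_cycle_def by blast
    qed (use vs(1) in \<open>auto simp: is_cycle_def\<close>)
    then have "has_chord F vs" using ch vs(2) unfolding chordal_def by blast
    then show False using vs(3) * unfolding has_chord_def by blast
  next
    case True
    then obtain i where i: "i < length vs" "vs ! i = v" by (auto simp: in_set_conv_nth)
    define ws where "ws = rotate i vs"
    have ws: "is_cycle ?F ws" "\<not> has_chord ?F ws" "length ws > 3"
      using is_cycle_rotate[OF vs(1)] has_chord_rotate[of ?F i vs] vs unfolding ws_def by auto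
    have w0: "ws ! 0 = v" using i vs(2) unfolding ws_def by (subst nth_rotate) auto
    obtain ps where wps: "ws = v # ps" using w0 ws(3) by (cases ws) auto
    let ?n = "length ps"
    have n3: "?n \<ge> 3" using ws(3) wps by simp
    then have ne: "ps \<noteq> []" by auto
    have cyc: "v \<notin> set ps" "distinct ps" "\<And>j. Suc j < Suc ?n \<Longrightarrow> {ws ! j, ps ! j} \<in> ?F"
      "{ps ! (?n - 1), v} \<in> ?F"
    proof -
      have "?n - 1 < ?n" "ws ! ?n = ps ! (?n - 1)" using n3 wps by (auto simp: nth_Cons')
      then show "v \<notin> set ps" "distinct ps" "\<And>j. Suc j < Suc ?n \<Longrightarrow> {ws ! j, ps ! j} \<in> ?F"
        "{ps ! (?n - 1), v} \<in> ?F"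
        using ws(1) n3 wps w0 by (auto simp: is_cycle_iff)
    qed
    have nch: "{ws ! a, ws ! b} \<notin> ?F" if "Suc a < b" "b < Suc ?n" "a \<noteq> 0 \<or> b \<noteq> ?n" for a b
      using chordless_cycle[OF ws, of a b] that wps by auto
    have away: "{ps ! a, ps ! b} \<in> ?F \<longleftrightarrow> {ps ! a, ps ! b} \<in> F" if "a < ?n" "b < ?n" for a b
      using attach_away[of v "{ps ! a, ps ! b}"] cyc(1) that by (metis insertE nth_mem singletonD)
    have path: "induced_path F ps"
      unfolding induced_path_def
    proof (intro conjI allI impI)
      show "ps \<noteq> []" using n3 by auto
      show "{ps ! a, ps ! Suc a} \<in> F" if "Suc a < ?n" for a
        using cyc(3)[of "Suc a"] that away[of a "Suc a"] wps by simp
      show "{ps ! a, ps ! b} \<notin> F" if "Suc a < b" "b < ?n" for a b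
        using nch[of "Suc a" "Suc b"] away[of a b] that wps by simp
    qed (rule cyc(2))
    have inner: "{v, ps ! b} \<notin> ?F" if "0 < b" "b < ?n - 1" for b
      using nch[of 0 "Suc b"] that wps by simp
    have ends: "ps ! 0 = x \<or> ps ! 0 \<in> nbrs F v \<inter> nbrs F x"
      "ps ! (?n - 1) = x \<or> ps ! (?n - 1) \<in> nbrs F v \<inter> nbrs F x"
      using cyc(3)[of 0] cyc(4) attach_at[OF vx] n3 w0 ne
      by (auto simp: insert_commute)
    have long: "{ps ! 0, ps ! (?n - 1)} \<notin> F" using path n3 unfolding induced_path_def by auto
    have dif: "ps ! 0 \<noteq> ps ! (?n - 1)" 
      using nth_eq_iff_index_eq[OF cyc(2), of 0 "?n - 1"] n3 by linarith
    show False
    proof (cases "x \<in> set ps")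
      case True
      then obtain b where b: "b < ?n" "ps ! b = x" by (auto simp: in_set_conv_nth)
      have "{v, ps ! b} \<in> ?F" using b attach_at[OF vx, of x] by simp
      then have "b = 0 \<or> b = ?n - 1" using inner[of b] b by linarith
      then show False using ends dif long b by (auto simp: nbrs_def insert_commute)
    next
      case False
      then have e: "ps ! 0 \<in> nbrs F v \<inter> nbrs F x" "ps ! (?n - 1) \<in> nbrs F v \<inter> nbrs F x"
        using ends ne nth_mem[of 0 ps] nth_mem[of "?n - 1" ps] by auto
      have "{v, ps ! 1} \<in> F" "{x, ps ! 1} \<in> F"
        using fan[OF ch path cyc(1), of 1] fan[OF ch path False, of 1] e n3 by (auto simp: nbrs_def)
      then have "{v, ps ! 1} \<in> ?F" using attach_at[OF vx, of "ps ! 1" F] by (simp add: nbrs_def)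
      moreover have "1 < ?n - 1" using n3 by linarith
      ultimately show False using inner[of 1] by simp
    qed
  qed
qed

text \<open>A cycle that loses its only chords must contain v. Its two neighbours of v are adjacent
  since v is simplicial; their edge does not contain v, so it survives as a chord.\<close>

lemma chordal_remove:
  assumes ch: "chordal F" and simp: "\<And>y z. {v, y} \<in> F \<Longrightarrow> {v, z} \<in> F \<Longrightarrow> y \<noteq> z \<Longrightarrow> {y, z} \<in> F"
    and vx: "v \<noteq> x"
  shows "chordal (F - {{v, x}})"
proof (rule ccontr)
  let ?F = "F - {{v, x}}"
  assume "\<not> chordal ?F"
  then obtain vs where vs: "is_cycle ?F vs" "length vs > 3" "\<not> has_chord ?F vs"
    unfolding chordal_def by blast
  have "is_cycle F vs" using vs(1) unfolding is_cycle_def by blast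
  then have "has_chord F vs" using ch vs(2) unfolding chordal_def by blast
  then have "v \<in> set vs" using vs(3) unfolding has_chord_def
    by (metis Diff_iff doubleton_eq_iff nth_mem singletonD)
  then obtain i where i: "i < length vs" "vs ! i = v" by (auto simp: in_set_conv_nth)
  define ws where "ws = rotate i vs"
  have ws: "is_cycle ?F ws" "\<not> has_chord ?F ws" "length ws > 3"
    using is_cycle_rotate[OF vs(1)] has_chord_rotate[of ?F i vs] vs unfolding ws_def by auto
  let ?n = "length ws"
  have w0: "ws ! 0 = v" using i vs(2) unfolding ws_def by (subst nth_rotate) auto
  have cyc: "distinct ws" "\<And>j. Suc j < ?n \<Longrightarrow> {ws ! j, ws ! Suc j} \<in> ?F"
    "{ws ! (?n - 1), ws ! 0} \<in> ?F"
    using ws(1) ws(3) by (auto simp: is_cycle_iff)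
  have "ws ! 1 \<noteq> ws ! (?n - 1)" "ws ! 1 \<noteq> v" "ws ! (?n - 1) \<noteq> v"
    unfolding w0[symmetric] using ws(3)
    by (subst nth_eq_iff_index_eq[OF cyc(1)]; linarith)+
  then have "{ws ! 1, ws ! (?n - 1)} \<in> ?F"
    using simp[of "ws ! 1" "ws ! (?n - 1)"] cyc(2)[of 0] cyc(3) ws(3) w0
    by (auto simp: insert_commute doubleton_eq_iff)
  moreover have "Suc 1 < ?n - 1" "?n - 1 < ?n" using ws(3) by linarith+
  ultimately show False using chordless_cycle[OF ws, of 1 "?n - 1"] by linarith
qed

subsection \<open>Simplicial vertices\<close>

definition component :: "'a set set \<Rightarrow> 'a \<Rightarrow> 'a \<Rightarrow> 'a set" where
  "component F x c = {d. reach F (insert x (nbrs F x)) c d}"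

text \<open>Among all pairs of distinct non-adjacent vertices x, c take one that minimizes the component
  of c in the graph without the closed neighbourhood of x: then c is simplicial.\<close>

lemma simplicial_exists:
  assumes ch: "chordal F" and sF: "simple_graph F" and ne: "F \<noteq> {}"
  shows "\<exists>v \<in> \<Union>F. \<forall>y z. {v, y} \<in> F \<longrightarrow> {v, z} \<in> F \<longrightarrow> y \<noteq> z \<longrightarrow> {y, z} \<in> F"
proof (cases "\<exists>x \<in> \<Union>F. \<exists>c \<in> \<Union>F. x \<noteq> c \<and> {x, c} \<notin> F")
  \<comment> \<open>The graph is complete here, and every vertex is simplicial.\<close>
  case False
  obtain e where e: "e \<in> F" using ne by blast
  then have "e \<noteq> {}" using sF unfolding simple_graph_def by auto
  then obtain v where "v \<in> \<Union>F" using e by blast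
  moreover have "{y, z} \<in> F" if "{v, y} \<in> F" "{v, z} \<in> F" "y \<noteq> z" for y z
    using False that by blast
  ultimately show ?thesis by blast
next
  case True
  define P where "P = (\<lambda>(x, c). x \<in> \<Union>F \<and> c \<in> \<Union>F \<and> x \<noteq> c \<and> {x, c} \<notin> F)"
  define m where "m = (\<lambda>(x, c). card (component F x c))"
  obtain p where p: "P p" "\<And>q. P q \<Longrightarrow> m p \<le> m q"
    using True exists_least_iff[of "\<lambda>n. \<exists>p. P p \<and> m p = n"] unfolding P_def
    by (metis (mono_tags, lifting) case_prodI linorder_not_less)
  obtain x c where xc: "p = (x, c)" by force
  have x: "x \<in> \<Union>F" "c \<in> \<Union>F" "x \<noteq> c" "{x, c} \<notin> F" using p(1) xc unfolding P_def by auto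
  let ?N = "\<lambda>x. insert x (nbrs F x)"
  let ?C = "component F x c"
  have comp_sub: "component F y d \<subseteq> \<Union>F" if "d \<in> \<Union>F" for y d
  proof
    fix z assume "z \<in> component F y d"
    then have "reach F (?N y) d z" unfolding component_def by simp
    then show "z \<in> \<Union>F" by (induction rule: reach_induct) (use that in auto)
  qed
  have C_avoids: "d \<notin> ?N x" if "d \<in> ?C" for d
    using that unfolding component_def mem_Collect_eq
    by (induction rule: reach_induct) (use x in \<open>auto simp: nbrs_def\<close>)
  have C_closed: "y \<in> ?C" if "d \<in> ?C" "{d, y} \<in> F" "y \<notin> ?N x" for d y
    using that reach_step unfolding component_def by fast
  have cC: "c \<in> ?C" unfolding component_def by simp
  have minimal: "\<not> component F y d \<subset> ?C" if "y \<in> \<Union>F" "d \<in> \<Union>F" "y \<noteq> d" "{y, d} \<notin> F" for y d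
  proof
    assume "component F y d \<subset> ?C"
    moreover have "finite ?C" using comp_sub[OF x(2)] simple_graph_finite_vertices[OF sF] finite_subset by blast
    ultimately have "m (y, d) < m p" unfolding m_def xc by (simp add: psubset_card_mono)
    moreover have "P (y, d)" using that unfolding P_def by simp
    ultimately show False using p(2) by (meson linorder_not_less)
  qed
  have CV: "?C \<subseteq> \<Union>F" using comp_sub[OF x(2)] .
  \<comment> \<open>The boundary of the component: every edge leaving \<open>?C\<close> ends in
    it.\<close>
  define S where "S = {s \<in> nbrs F x. \<exists>d \<in> ?C. {s, d} \<in> F}"
  \<comment> \<open>If s and t were not adjacent, an induced path would join them through the
    component. As x is adjacent to both ends, \<open>fan\<close> makes it adjacent to the second
    vertex, but the component avoids the neighbours of x.\<close>
  have S_clique: "{s, t} \<in> F" if st: "s \<in> S" "t \<in> S" "s \<noteq> t" for s t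
  proof (rule ccontr)
    assume nst: "{s, t} \<notin> F"
    obtain d where d: "d \<in> ?C" "{s, d} \<in> F" using st(1) unfolding S_def by blast
    obtain d' where d': "d' \<in> ?C" "{t, d'} \<in> F" using st(2) unfolding S_def by blast
    \<comment> \<open>Everything but t and the component is forbidden, so the path stays in the
      component until it reaches t.\<close>
    let ?B = "- insert t ?C"
    have "reach F (?N x) d c"
      using d(1) C_avoids[OF cC] reach_sym[of F "?N x" c d] unfolding component_def by simp
    moreover have "reach F (?N x) c d'" using d'(1) unfolding component_def by simp
    ultimately have "reach F (?N x) d d'" by (rule reach_trans)
    then have "reach F ?B d d' \<and> d' \<in> ?C"
    proof (induction rule: reach_induct)
      case refl then show ?case using d(1) by simp
    next
      case (step v w)
      then have "w \<in> ?C" using C_closed[of v w] by simp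
      then show ?case using step reach_step[of F ?B d v w] by blast
    qed
    moreover have "reach F ?B s d" using reach_step[of F ?B s s d] d by simp
    ultimately have "reach F ?B s d'" using reach_trans[of F ?B s d d'] by simp
    then have "reach F ?B s t" using reach_step[of F ?B s d' t] d'(2) by (simp add: insert_commute)
    then obtain ps where ps: "induced_path F ps" "ps ! 0 = s" "ps ! (length ps - 1) = t"
      "\<forall>i. 0 < i \<longrightarrow> i < length ps \<longrightarrow> ps ! i \<notin> ?B"
      using reach_induced_path[of F ?B s t] by auto
    let ?n = "length ps"
    have "?n \<noteq> 0" using ps(1) unfolding induced_path_def by simp
    moreover have "?n \<noteq> 1" using ps(2,3) st(3) by auto
    moreover have "?n \<noteq> 2"
    proof
      assume "?n = 2"
      then show False using ps nst unfolding induced_path_def by (auto dest: spec[of _ 0])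
    qed
    ultimately have n3: "?n \<ge> 3" by linarith
    have "ps ! 1 \<noteq> t" using ps(1,3) n3 nth_eq_iff_index_eq[of ps 1 "?n - 1"]
      unfolding induced_path_def by auto
    then have p1: "ps ! 1 \<in> ?C" using ps(4) n3 by (metis ComplI insertE One_nat_def less_eq_Suc_le numeral_3_eq_3 Suc_le_lessD Suc_leD zero_less_one)
    have "x \<notin> set ps"
    proof
      assume "x \<in> set ps"
      then obtain i where i: "i < ?n" "ps ! i = x" by (auto simp: in_set_conv_nth)
      have "x \<noteq> s" "x \<noteq> t" using st simple_graph_irrefl[OF sF] unfolding S_def nbrs_def by blast+
      then have "x \<in> ?C" using i ps(2,4) by (cases i) auto
      then show False using C_avoids by blast
    qed
    then have "{x, ps ! 1} \<in> F"
      using fan[OF ch ps(1), of x 1] ps(2,3) st n3 unfolding S_def nbrs_def by simp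
    then show False using C_avoids[OF p1] by (simp add: nbrs_def)
  qed
  \<comment> \<open>If s misses d, the component of d without the closed neighbourhood of s stays
    inside \<open>?C\<close> and lacks the neighbour of s there, contradicting minimality.\<close>
  have S_C: "{s, d} \<in> F" if sd: "s \<in> S" "d \<in> ?C" for s d
  proof (rule ccontr)
    assume n: "{s, d} \<notin> F"
    have sx: "{x, s} \<in> F" using sd(1) unfolding S_def nbrs_def by simp
    have snd: "s \<noteq> d" using C_avoids[OF sd(2)] sx unfolding nbrs_def by auto
    have "component F s d \<subseteq> ?C"
    proof
      fix z assume "z \<in> component F s d"
      then have "reach F (?N s) d z" unfolding component_def by simp
      then show "z \<in> ?C"
      proof (induction rule: reach_induct)
        case (step v w)
        have "w \<notin> ?N x"
        proof
          assume w: "w \<in> ?N x"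
          have "w \<noteq> x" using step(3) sx by (auto simp: nbrs_def insert_commute)
          then have "w \<in> S" using w step unfolding S_def by (auto simp: insert_commute)
          then show False using S_clique[OF sd(1)] step(3,4) by (auto simp: nbrs_def)
        qed
        then show ?case using C_closed step by blast
      qed (rule sd(2))
    qed
    moreover obtain d' where d': "d' \<in> ?C" "{s, d'} \<in> F" using sd(1) unfolding S_def by blast
    moreover have "d' \<notin> component F s d"
    proof
      assume "d' \<in> component F s d"
      then have "reach F (?N s) d d'" unfolding component_def by simp
      then have "d' \<notin> ?N s"
        by (induction rule: reach_induct) (use n snd in \<open>auto simp: nbrs_def\<close>)
      then show False using d' by (simp add: nbrs_def)
    qed
    ultimately have "component F s d \<subset> ?C" by blast
    then show False using minimal[of s d] snd n sx CV sd(2) by blast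
  qed
  \<comment> \<open>Likewise, the component of d' without the closed neighbourhood of d stays inside
    \<open>?C\<close> and lacks d.\<close>
  have C_clique: "{d, d'} \<in> F" if dd: "d \<in> ?C" "d' \<in> ?C" "d \<noteq> d'" for d d'
  proof (rule ccontr)
    assume n: "{d, d'} \<notin> F"
    have sub: "z \<in> ?C \<and> z \<noteq> d" if "z \<in> component F d d'" for z
    proof -
      have "reach F (?N d) d' z" using that unfolding component_def by simp
      then show ?thesis
      proof (induction rule: reach_induct)
        case (step v w)
        have "w \<notin> ?N x"
        proof
          assume w: "w \<in> ?N x"
          have "w \<noteq> x" using C_avoids[of v] step by (auto simp: nbrs_def insert_commute)
          then have "w \<in> S" using w step unfolding S_def by (auto simp: insert_commute)
          then show False using S_C[of w d] dd(1) step by (auto simp: nbrs_def insert_commute)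
        qed
        then show ?case using C_closed step by blast
      qed (use dd in auto)
    qed
    then have "component F d d' \<subset> ?C" using dd by blast
    then show False using minimal[of d d'] n dd CV by blast
  qed
  have nb: "y \<in> ?C \<or> y \<in> S" if "{c, y} \<in> F" for y
  proof (cases "y \<in> ?N x")
    case True
    moreover have "y \<noteq> x" using that x(4) by (auto simp: insert_commute)
    ultimately show ?thesis using that cC unfolding S_def by (auto simp: insert_commute)
  qed (use C_closed cC that in blast)
  have "{y, z} \<in> F" if "{c, y} \<in> F" "{c, z} \<in> F" "y \<noteq> z" for y z
    using nb[OF that(1)] nb[OF that(2)] S_clique[of y z] C_clique[of y z] S_C[of y z] S_C[of z y] that(3)
    by (auto simp: insert_commute)
  then show ?thesis using x(2) by blast
qed

subsection \<open>Canonical orders and proximity\<close>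

abbreviation edge :: "'a \<times> 'a \<Rightarrow> 'a set" where
  "edge p \<equiv> {fst p, snd p}"

text \<open>The orientation of the pairs carries information: the first component is the vertex at
  which \<open>attach\<close> prunes.\<close>

definition canonical_order :: "'a set set \<Rightarrow> ('a \<times> 'a) list \<Rightarrow> bool" where
  "canonical_order F es \<longleftrightarrow> edge ` set es = F \<and>
     (\<forall>i<length es. \<forall>y. {fst (es ! i), y} \<in> edge ` set (take i es) \<longrightarrow>
        {snd (es ! i), y} \<in> edge ` set (take i es))"

text \<open>Built from the back: at a simplicial vertex v, any edge vx may come last, since every
  other edge vy comes with xy. By \<open>chordal_remove\<close> the induction can continue with
  single edges instead of whole vertices.\<close>

lemma canonical_order_exists:
  assumes "chordal F" "simple_graph F"
  shows "\<exists>es. canonical_order F es"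
  using assms
proof (induction "card F" arbitrary: F)
  case 0
  then have "F = {}" unfolding simple_graph_def by simp
  then show ?case by (intro exI[of _ "[]"]) (simp add: canonical_order_def)
next
  case (Suc k)
  have fin: "finite F" using Suc.prems unfolding simple_graph_def by blast
  have "F \<noteq> {}" using Suc.hyps(2) by auto
  then obtain v where v: "v \<in> \<Union>F" "\<And>y z. {v, y} \<in> F \<Longrightarrow> {v, z} \<in> F \<Longrightarrow> y \<noteq> z \<Longrightarrow> {y, z} \<in> F"
    using simplicial_exists Suc.prems by meson
  obtain e where e: "e \<in> F" "v \<in> e" using v(1) by blast
  then have "card e = 2" using Suc.prems unfolding simple_graph_def by blast
  then obtain x where x: "e = {v, x}" "v \<noteq> x" using e(2) by (auto simp: card_2_iff)
  let ?F = "F - {{v, x}}"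
  have "chordal ?F" using chordal_remove[OF Suc.prems(1) v(2) x(2)] .
  moreover have "simple_graph ?F" using simple_graph_mono Suc.prems by blast
  moreover have "k = card ?F" using Suc.hyps(2) e x fin by simp
  ultimately obtain es where es: "canonical_order ?F es" using Suc.hyps(1) by blast
  have "canonical_order F (es @ [(v, x)])"
    unfolding canonical_order_def
  proof (intro conjI allI impI)
    show "edge ` set (es @ [(v, x)]) = F" using es e x unfolding canonical_order_def by auto
  next
    fix i y assume i: "i < length (es @ [(v, x)])"
      and y: "{fst ((es @ [(v, x)]) ! i), y} \<in> edge ` set (take i (es @ [(v, x)]))"
    show "{snd ((es @ [(v, x)]) ! i), y} \<in> edge ` set (take i (es @ [(v, x)]))"
    proof (cases "i < length es")
      case True
      then show ?thesis using es y unfolding canonical_order_def by (simp add: nth_append)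
    next
      case False
      then have i: "i = length es" using i by simp
      then have "{v, y} \<in> ?F" using y es unfolding canonical_order_def by simp
      then have "{x, y} \<in> F" "{x, y} \<noteq> {v, x}"
        using v(2)[of x y] e x simple_graph_irrefl[OF Suc.prems(2), of v y]
        by (auto simp: doubleton_eq_iff)
      then show ?thesis using i es unfolding canonical_order_def by simp
    qed
  qed
  then show ?case by blast
qed

text \<open>The choice of the order depends on \<open>S'\<close> alone, so the proximities of
  different solutions to \<open>S'\<close> are prefixes of the same list and can be
  compared.\<close>

definition proximity :: "'a set set \<Rightarrow> 'a set set \<Rightarrow> 'a set set" where
  "proximity S S' = edge ` set (takeWhile (\<lambda>p. edge p \<in> S) (SOME es. canonical_order S' es))"

text \<open>All extensions \<open>T\<close> of the attachment are covered, so the result is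
  independent of how the attachment is completed.\<close>

lemma proximity_increases:
  assumes S': "chordal S'" "simple_graph S'" and ns: "\<not> S' \<subseteq> S"
  shows "\<exists>v x. {v, x} \<in> S' \<and> (\<forall>T. attach S v x \<subseteq> T \<longrightarrow> card (proximity S S') < card (proximity T S'))"
proof -
  define es where "es = (SOME es. canonical_order S' es)"
  have es: "canonical_order S' es" unfolding es_def
    using someI_ex[OF canonical_order_exists[OF S']] .
  \<comment> \<open>The index of the first edge of \<open>S'\<close> that S lacks; this edge
    provides v and x.\<close>
  define k where "k = length (takeWhile (\<lambda>p. edge p \<in> S) es)"
  have tk: "takeWhile (\<lambda>p. edge p \<in> S) es = take k es" unfolding k_def by (rule takeWhile_eq_take)
  have kl: "k < length es"
  proof (rule ccontr)
    assume "\<not> k < length es"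
    then have "takeWhile (\<lambda>p. edge p \<in> S) es = es" using tk by simp
    then have "\<forall>p \<in> set es. edge p \<in> S" by (metis set_takeWhileD)
    then have "edge ` set es \<subseteq> S" by blast
    then show False using ns es unfolding canonical_order_def by blast
  qed
  obtain v x where vx: "es ! k = (v, x)" by force
  have vxS: "{v, x} \<notin> S" using nth_length_takeWhile[of "\<lambda>p. edge p \<in> S" es] kl vx unfolding k_def by simp
  have vxS': "{v, x} \<in> S'" using es vx nth_mem[OF kl] unfolding canonical_order_def
    by (metis (mono_tags, lifting) fst_conv image_eqI snd_conv)
  have vnx: "v \<noteq> x" using simple_graph_irrefl[OF S'(2) vxS'] .
  let ?P = "edge ` set (take k es)"
  have PS: "?P \<subseteq> S" using tk by (auto dest: set_takeWhileD simp flip: tk)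
  have closed: "{x, y} \<in> ?P" if "{v, y} \<in> ?P" for y
  proof -
    have "{fst (es ! k), y} \<in> ?P \<Longrightarrow> {snd (es ! k), y} \<in> ?P"
      using es kl unfolding canonical_order_def by blast
    then show ?thesis using vx that by simp
  qed
  have Patt: "?P \<subseteq> attach S v x"
  proof
    fix e assume e: "e \<in> ?P"
    show "e \<in> attach S v x"
    proof (cases "v \<in> e")
      case False then show ?thesis using e PS attach_away[of v e S x] by blast
    next
      case True
      then obtain y where y: "e = {v, y}" using e by auto
      then have "{v, y} \<in> S" "{x, y} \<in> S" using e closed[of y] PS by blast+
      then show ?thesis using y attach_at[OF vnx, of y S] by (simp add: nbrs_def)
    qed
  qed
  have "card (proximity S S') < card (proximity T S')" if T: "attach S v x \<subseteq> T" for T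
  proof -
    have vxT: "{v, x} \<in> T" using T attach_at[OF vnx, of x S] by blast
    have all: "\<forall>p \<in> set (take (Suc k) es). edge p \<in> T"
      using vxT Patt T kl vx by (auto simp: take_Suc_conv_app_nth)
    have "takeWhile (\<lambda>p. edge p \<in> T) (take (Suc k) es @ drop (Suc k) es) =
      take (Suc k) es @ takeWhile (\<lambda>p. edge p \<in> T) (drop (Suc k) es)"
      using all by (intro takeWhile_append2) blast
    then have "set (take (Suc k) es) \<subseteq> set (takeWhile (\<lambda>p. edge p \<in> T) es)"
      unfolding append_take_drop_id by simp
    moreover have "set (take (Suc k) es) = insert (v, x) (set (take k es))"
      using kl vx by (simp add: take_Suc_conv_app_nth)
    ultimately have "insert {v, x} ?P \<subseteq> proximity T S'" unfolding proximity_def es_def[symmetric]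
      by (metis (no_types, lifting) fst_conv image_insert image_mono snd_conv)
    moreover have "proximity S S' = ?P" unfolding proximity_def es_def[symmetric] tk ..
    moreover have "{v, x} \<notin> ?P" using PS vxS by blast
    moreover have "finite (proximity T S')" unfolding proximity_def by simp
    moreover have "card (insert {v, x} ?P) = Suc (card ?P)" using calculation by simp
    ultimately show ?thesis using card_mono[of "proximity T S'" "insert {v, x} ?P"] by simp
  qed
  then show ?thesis using vxS' by blast
qed

lemma proximity_subset: "chordal S' \<Longrightarrow> simple_graph S' \<Longrightarrow> proximity S S' \<subseteq> S'"
proof -
  assume "chordal S'" "simple_graph S'"
  then have "canonical_order S' (SOME es. canonical_order S' es)" (is "canonical_order S' ?es")
    using someI_ex[OF canonical_order_exists] by blast
  then have "edge ` set ?es = S'" unfolding canonical_order_def ..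
  then show ?thesis unfolding proximity_def by (blast dest: set_takeWhileD)
qed

subsection \<open>Greedy completion\<close>

definition try_edge :: "'a \<times> 'a \<Rightarrow> 'a set set \<Rightarrow> 'a set set" where
  "try_edge p F = (if edge p \<notin> F \<and> addable F (fst p) (snd p) then insert (edge p) F else F)"

definition complete :: "('a \<times> 'a) list \<Rightarrow> 'a set set \<Rightarrow> 'a set set" where
  "complete es F = (fold try_edge es ^^ length es) F"

lemma try_edge_mono: "F \<subseteq> try_edge p F" unfolding try_edge_def by auto

lemma fold_try_edge_mono: "F \<subseteq> fold try_edge es F"
  by (induction es arbitrary: F) (use try_edge_mono in force)+

lemma fold_try_edge_inv:
  assumes "F \<subseteq> E" "chordal F" "edge ` set es \<subseteq> E" "simple_graph E"
  shows "fold try_edge es F \<subseteq> E \<and> chordal (fold try_edge es F)"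
  using assms
proof (induction es arbitrary: F)
  case (Cons p es)
  have "fst p \<noteq> snd p" using simple_graph_irrefl[OF Cons.prems(4)] Cons.prems(3) by auto
  then have "try_edge p F \<subseteq> E \<and> chordal (try_edge p F)"
    using Cons.prems chordal_insert[of F "fst p" "snd p"] unfolding try_edge_def by auto
  then show ?case using Cons by simp
qed simp

text \<open>A pass only enlarges the set, so if it ends where it started, all sets in between are
  equal as well.\<close>

lemma fold_try_edge_fixed:
  assumes "fold try_edge es F = F" "p \<in> set es" shows "try_edge p F = F"
proof -
  obtain as bs where ab: "es = as @ p # bs" using assms(2) by (meson split_list)
  have "F \<subseteq> fold try_edge as F" by (rule fold_try_edge_mono)
  moreover have "fold try_edge as F \<subseteq> try_edge p (fold try_edge as F)" by (rule try_edge_mono)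
  moreover have "try_edge p (fold try_edge as F) \<subseteq> F"
    using fold_try_edge_mono[of "try_edge p (fold try_edge as F)" bs] assms(1) ab by simp
  ultimately have "fold try_edge as F = F" "try_edge p (fold try_edge as F) = F" by blast+
  then show ?thesis by simp
qed

lemma funpow_try_edge:
  "F \<subseteq> E \<Longrightarrow> chordal F \<Longrightarrow> edge ` set es \<subseteq> E \<Longrightarrow> simple_graph E \<Longrightarrow>
     F \<subseteq> (fold try_edge es ^^ k) F \<and> (fold try_edge es ^^ k) F \<subseteq> E \<and> chordal ((fold try_edge es ^^ k) F)"
proof (induction k)
  case (Suc k)
  then show ?case
    using fold_try_edge_inv[of "(fold try_edge es ^^ k) F" E es]
      fold_try_edge_mono[of "(fold try_edge es ^^ k) F" es] by simp blast
qed simp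

text \<open>A pass that changes the set adds at least one edge. So after as many passes as there are
  edges, either some pass changed nothing or all of E is present.\<close>

lemma complete_fixed:
  assumes "F \<subseteq> E" "chordal F" "edge ` set es = E" "simple_graph E"
  shows "fold try_edge es (complete es F) = complete es F"
proof -
  let ?f = "fold try_edge es"
  have inv: "(?f ^^ k) F \<subseteq> E" for k using funpow_try_edge[of F E es k] assms by simp
  have fE: "finite E" using assms(4) unfolding simple_graph_def by blast
  have "?f ((?f ^^ k) F) = (?f ^^ k) F \<or> card ((?f ^^ k) F) \<ge> k" for k
  proof (induction k)
    case (Suc k)
    show ?case
    proof (cases "?f ((?f ^^ k) F) = (?f ^^ k) F")
      case False
      then have "card ((?f ^^ k) F) < card ((?f ^^ Suc k) F)"
        using fold_try_edge_mono[of "(?f ^^ k) F" es] inv[of "Suc k"] fE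
        by (intro psubset_card_mono) (auto intro: finite_subset)
      then show ?thesis using False Suc by auto
    qed simp
  qed simp
  then consider "?f (complete es F) = complete es F" | "card (complete es F) \<ge> length es"
    unfolding complete_def by blast
  then show ?thesis
  proof cases
    case 2
    moreover have "card E \<le> length es" 
      using card_image_le[of "set es" edge] card_length[of es] assms(3) by simp
    ultimately have cE: "complete es F = E" using card_seteq[OF fE inv[of "length es"]]
      unfolding complete_def by linarith
    moreover have "?f E \<subseteq> E" using inv[of "Suc (length es)"] cE unfolding complete_def by simp
    then show ?thesis unfolding cE using fold_try_edge_mono[of E es] by (rule subset_antisym)
  qed
qed

text \<open>Stability under single edges excludes every larger chordal set, because
  \<open>addable_edge_exists\<close> would supply an edge that the stable pass accepts.\<close>

lemma complete_maximal:
  assumes "F \<subseteq> E" "chordal F" "edge ` set es = E" "simple_graph E"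
  shows "complete es F \<in> maximal_chordal_subgraphs E" "F \<subseteq> complete es F"
proof -
  let ?T = "complete es F"
  have T: "F \<subseteq> ?T" "?T \<subseteq> E" "chordal ?T"
    using funpow_try_edge[of F E es "length es"] assms unfolding complete_def by auto
  then show "F \<subseteq> ?T" by simp
  have "\<not> chordal F'" if F': "?T \<subset> F'" "F' \<subseteq> E" for F'
  proof
    assume "chordal F'"
    then obtain u v where uv: "{u, v} \<in> F' - ?T" "\<forall>a b. {a, b} = {u, v} \<longrightarrow> addable ?T a b"
      using addable_edge_exists[OF T(3) _ F'(1)] simple_graph_mono[OF assms(4) F'(2)] by blast
    then obtain p where p: "p \<in> set es" "edge p = {u, v}" using F'(2) assms(3) by force
    then have "try_edge p ?T \<noteq> ?T" using uv unfolding try_edge_def by auto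
    then show False using fold_try_edge_fixed[OF complete_fixed[OF assms]] p(1) by blast
  qed
  then show "?T \<in> maximal_chordal_subgraphs E" using T unfolding maximal_chordal_subgraphs_def by blast
qed

subsection \<open>Neighbouring solutions\<close>

definition neighbour_list :: "('a \<times> 'a) list \<Rightarrow> 'a set set \<Rightarrow> 'a set set list" where
  "neighbour_list es S = concat (map (\<lambda>(u, v). [complete es (attach S u v), complete es (attach S v u)]) es)"

lemma maximal_chordalD:
  assumes "S \<in> maximal_chordal_subgraphs E" shows "S \<subseteq> E" "chordal S"
  using assms unfolding maximal_chordal_subgraphs_def by auto

lemma chordal_empty: "chordal {}"
  unfolding chordal_def is_cycle_def by (auto intro!: exI[of _ 0])

lemma attach_subset: "S \<subseteq> E \<Longrightarrow> {v, x} \<in> E \<Longrightarrow> attach S v x \<subseteq> E"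
  unfolding attach_def nbrs_def by auto

lemma complete_attach:
  assumes "S \<in> maximal_chordal_subgraphs E" "edge ` set es = E" "simple_graph E" "{v, x} \<in> E"
  shows "complete es (attach S v x) \<in> maximal_chordal_subgraphs E"
    "attach S v x \<subseteq> complete es (attach S v x)"
proof -
  have "attach S v x \<subseteq> E" using maximal_chordalD[OF assms(1)] attach_subset assms(4) by metis
  moreover have "chordal (attach S v x)"
    by (rule chordal_attach[OF maximal_chordalD(2)[OF assms(1)] simple_graph_irrefl[OF assms(3,4)]])
  ultimately show "complete es (attach S v x) \<in> maximal_chordal_subgraphs E"
    "attach S v x \<subseteq> complete es (attach S v x)"
    using complete_maximal assms by blast+
qed

lemma set_neighbour_list:
  "set (neighbour_list es S) = {complete es (attach S v x) | v x. (v, x) \<in> set es \<or> (x, v) \<in> set es}"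
  unfolding neighbour_list_def by auto

lemma neighbour_list_maximal:
  assumes "S \<in> maximal_chordal_subgraphs E" "edge ` set es = E" "simple_graph E"
  shows "set (neighbour_list es S) \<subseteq> maximal_chordal_subgraphs E"
proof -
  have "{v, x} \<in> E" if "(v, x) \<in> set es \<or> (x, v) \<in> set es" for v x
    using that assms(2) by (force simp: insert_commute)
  then show ?thesis unfolding set_neighbour_list using complete_attach(1)[OF assms] by blast
qed

lemma neighbour_list_proximity:
  assumes S: "S \<in> maximal_chordal_subgraphs E" and S': "S' \<in> maximal_chordal_subgraphs E"
    and ne: "S \<noteq> S'" and es: "edge ` set es = E" and sE: "simple_graph E"
  shows "\<exists>T \<in> set (neighbour_list es S). card (proximity S S') < card (proximity T S')"
proof -
  have "\<not> S' \<subseteq> S" using S S' ne unfolding maximal_chordal_subgraphs_def by blast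
  then obtain v x where vx: "{v, x} \<in> S'"
    "\<And>T. attach S v x \<subseteq> T \<Longrightarrow> card (proximity S S') < card (proximity T S')"
    using proximity_increases[of S' S] maximal_chordalD[OF S] maximal_chordalD[OF S']
      simple_graph_mono[OF sE] by metis
  have E: "{v, x} \<in> E" using vx(1) maximal_chordalD[OF S'] by blast
  then obtain p where "p \<in> set es" "edge p = {v, x}" using es by (metis (mono_tags, lifting) imageE)
  then have "(v, x) \<in> set es \<or> (x, v) \<in> set es" by (cases p) (auto simp: doubleton_eq_iff)
  then have "complete es (attach S v x) \<in> set (neighbour_list es S)"
    unfolding set_neighbour_list by blast
  then show ?thesis using vx(2) complete_attach(2)[OF S es sE E] by blast
qed

text \<open>For a fixed target \<open>S'\<close>, some neighbour of any other solution is strictly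
  closer, and the proximity is bounded by the size of \<open>S'\<close>. So from any member of L the
  target is reached inside L.\<close>

lemma closed_under_neighbours:
  assumes es: "edge ` set es = E" and sE: "simple_graph E"
    and L: "L \<subseteq> maximal_chordal_subgraphs E" "L \<noteq> {}"
    and cl: "\<And>S. S \<in> L \<Longrightarrow> set (neighbour_list es S) \<subseteq> L"
  shows "L = maximal_chordal_subgraphs E"
proof
  show "maximal_chordal_subgraphs E \<subseteq> L"
  proof
    fix S' assume S': "S' \<in> maximal_chordal_subgraphs E"
    have S'E: "S' \<subseteq> E" "chordal S'" "simple_graph S'"
      using maximal_chordalD[OF S'] simple_graph_mono[OF sE] by auto
    have "S' \<in> L" if "S \<in> L" for S
      using that
    proof (induction "card S' - card (proximity S S')" arbitrary: S rule: less_induct)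
      case less
      show ?case
      proof (cases "S = S'")
        case False
        obtain T where T: "T \<in> set (neighbour_list es S)" "card (proximity S S') < card (proximity T S')"
          using neighbour_list_proximity[OF _ S' False es sE] less.prems L by blast
        have "card (proximity T S') \<le> card S'"
          using proximity_subset[OF S'E(2,3)] S'E(3) card_mono unfolding simple_graph_def by blast
        then show ?thesis using less.hyps[of T] T cl[OF less.prems] by auto
      qed (use less.prems in simp)
    qed
    then show "S' \<in> L" using L(2) by blast
  qed
qed (rule L(1))

section \<open>A language with arrays and its compilation\<close>

subsection \<open>Syntax and semantics\<close>

text \<open>All loops are counted, so programs are total: their meaning is a function, and a time
  bound can be computed by recursion over the syntax.\<close>

datatype aexp = Const nat | Reg nat | Arr nat aexp | Succ aexp

datatype atest = Less aexp aexp | Equal aexp aexp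

datatype acom =
    Nop
  | Assign nat aexp
  | Write nat aexp aexp
  | Output aexp
  | Finish
  | Then acom acom (infixr ";;" 60)
  | Cond atest acom acom
  | For nat nat acom

record astate =
  reg :: "nat \<Rightarrow> nat"
  arr :: "nat \<Rightarrow> nat \<Rightarrow> nat"
  out :: "event list"

primrec ev :: "aexp \<Rightarrow> astate \<Rightarrow> nat" where
  "ev (Const n) s = n"
| "ev (Reg r) s = reg s r"
| "ev (Arr k e) s = arr s k (ev e s)"
| "ev (Succ e) s = Suc (ev e s)"

primrec sat :: "atest \<Rightarrow> astate \<Rightarrow> bool" where
  "sat (Less e f) s \<longleftrightarrow> ev e s < ev f s"
| "sat (Equal e f) s \<longleftrightarrow> ev e s = ev f s"

abbreviation set_reg :: "nat \<Rightarrow> nat \<Rightarrow> astate \<Rightarrow> astate" where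
  "set_reg r n s \<equiv> s\<lparr>reg := (reg s)(r := n)\<rparr>"

text \<open>A \<open>For\<close> loop reads its bound once. The machine rereads it in every round,
  which agrees because \<open>wf\<close> forbids assignments to bounds. The final
  \<open>set_reg\<close> is the value of the counter when the test of the machine fails.\<close>

primrec den :: "acom \<Rightarrow> astate \<Rightarrow> astate" where
  "den Nop s = s"
| "den (Assign r e) s = set_reg r (ev e s) s"
| "den (Write k e f) s = s\<lparr>arr := (arr s)(k := (arr s k)(ev e s := ev f s))\<rparr>"
| "den (Output e) s = s\<lparr>out := out s @ [Put (ev e s)]\<rparr>"
| "den Finish s = s\<lparr>out := out s @ [Emit]\<rparr>"
| "den (c ;; d) s = den d (den c s)"
| "den (Cond b c d) s = (if sat b s then den c s else den d s)"
| "den (For r l c) s =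
     set_reg r (reg s l) (fold (\<lambda>i s. den c (set_reg r i s)) [0..<reg s l] s)"

primrec assigned :: "acom \<Rightarrow> nat set" where
  "assigned Nop = {}"
| "assigned (Assign r e) = {r}"
| "assigned (Write k e f) = {}"
| "assigned (Output e) = {}"
| "assigned Finish = {}"
| "assigned (c ;; d) = assigned c \<union> assigned d"
| "assigned (Cond b c d) = assigned c \<union> assigned d"
| "assigned (For r l c) = insert r (assigned c)"

primrec modified :: "acom \<Rightarrow> nat set" where
  "modified Nop = {}"
| "modified (Assign r e) = {}"
| "modified (Write k e f) = {k}"
| "modified (Output e) = {}"
| "modified Finish = {}"
| "modified (c ;; d) = modified c \<union> modified d"
| "modified (Cond b c d) = modified c \<union> modified d"
| "modified (For r l c) = modified c"

primrec quiet :: "acom \<Rightarrow> bool" where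
  "quiet Nop = True"
| "quiet (Assign r e) = True"
| "quiet (Write k e f) = True"
| "quiet (Output e) = False"
| "quiet Finish = False"
| "quiet (c ;; d) = (quiet c \<and> quiet d)"
| "quiet (Cond b c d) = (quiet c \<and> quiet d)"
| "quiet (For r l c) = quiet c"

section \<open>Loop invariants and frame conditions\<close>

lemma set_reg_triv: "set_reg r (reg s r) s = s"
  by (simp del: fun_upd_apply add: fun_upd_triv)

lemma fold_invariant:
  assumes "I 0 s" "\<And>i s. i < n \<Longrightarrow> I i s \<Longrightarrow> I (Suc i) (f i s)"
  shows "I n (fold f [0..<n] s)"
  using assms
proof (induction n)
  case (Suc n)
  then show ?case by simp
qed simp

lemma den_for:
  assumes "I 0 s" "\<And>i s. i < n \<Longrightarrow> I i s \<Longrightarrow> I (Suc i) (den c (set_reg r i s))"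
    "reg s l = n" "\<And>s. I n s \<Longrightarrow> Q (set_reg r n s)"
  shows "Q (den (For r l c) s)"
  using fold_invariant[of I s n "\<lambda>i s. den c (set_reg r i s)"] assms by simp

lemma den_for_invariant:
  assumes "I 0 s" "\<And>i s. i < n \<Longrightarrow> I i s \<Longrightarrow> I (Suc i) (den c (set_reg r i s))"
    "reg s l = n" "\<And>s. I n s \<Longrightarrow> I n (set_reg r n s)"
  shows "I n (den (For r l c) s)"
  using den_for[of I s n c r l "I n"] assms by blast

lemma reg_den: "r \<notin> assigned c \<Longrightarrow> reg (den c s) r = reg s r"
proof (induction c arbitrary: s)
  case (For q l c)
  have "reg (fold (\<lambda>i s. den c (set_reg q i s)) xs s) r = reg s r" for xs
    by (induction xs arbitrary: s) (use For in auto)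
  then show ?case using For by simp
qed auto

lemma arr_den: "k \<notin> modified c \<Longrightarrow> arr (den c s) k = arr s k"
proof (induction c arbitrary: s)
  case (For q l c)
  have "arr (fold (\<lambda>i s. den c (set_reg q i s)) xs s) k = arr s k" for xs
    by (induction xs arbitrary: s) (use For in auto)
  then show ?case using For by simp
qed auto

lemma out_den: "quiet c \<Longrightarrow> out (den c s) = out s"
proof (induction c arbitrary: s)
  case (For q l c)
  have "out (fold (\<lambda>i s. den c (set_reg q i s)) xs s) = out s" for xs
    by (induction xs arbitrary: s) (use For in auto)
  then show ?case using For by simp
qed auto

text \<open>Transfers a condition on the numbers written by the end of a program to all of its
  intermediate states.\<close>

lemma out_grows: "set (out s) \<subseteq> set (out (den c s))"
proof (induction c arbitrary: s)
  case (Then c d)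
  then show ?case by simp blast
next
  case (For q l c)
  have "set (out s) \<subseteq> set (out (fold (\<lambda>i s. den c (set_reg q i s)) xs s))" for xs
  proof (induction xs arbitrary: s)
    case (Cons x xs)
    have "set (out s) \<subseteq> set (out (den c (set_reg q x s)))" using For[of "set_reg q x s"] by simp
    then show ?case using Cons[of "den c (set_reg q x s)"] by (auto simp del: fun_upd_apply)
  qed simp
  then show ?case by simp
qed auto

subsection \<open>Compilation\<close>

text \<open>All numbers are stored multiplied by 16, so that word i of array k can live at address
  D + k + 16 * i: arrays of unbounded size interleave, and addresses are formed without
  arithmetic. Array 15 holds the unscaled numbers that may be output. Register 8 + k of the
  machine holds D + k, registers below 8 are temporary, and register 24 + r stands for r.\<close>

primrec incs :: "nat \<Rightarrow> nat \<Rightarrow> com" where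
  "incs r 0 = SKIP"
| "incs r (Suc n) = SEQ (INC r) (incs r n)"

primrec compile_exp :: "nat \<Rightarrow> aexp \<Rightarrow> com" where
  "compile_exp t (Const n) = IMM t (16 * n)"
| "compile_exp t (Reg r) = COPY t (24 + r)"
| "compile_exp t (Arr k e) = SEQ (compile_exp t e) (LOAD t (8 + k) t)"
| "compile_exp t (Succ e) = SEQ (compile_exp t e) (incs t 16)"

primrec compile_test :: "atest \<Rightarrow> com \<Rightarrow> com \<Rightarrow> com" where
  "compile_test (Less e f) c d =
     SEQ (compile_exp 0 e) (SEQ (compile_exp 1 f) (IF (LESS 0 1) c d))"
| "compile_test (Equal e f) c d =
     SEQ (compile_exp 0 e) (SEQ (compile_exp 1 f) (IF (EQUAL 0 1) c d))"

text \<open>Register 23 is 8 + 15, the base of array 15, from which \<open>Output\<close> fetches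
  the unscaled number. Being scaled, loop counters advance by 16.\<close>

primrec compile :: "acom \<Rightarrow> com" where
  "compile Nop = SKIP"
| "compile (Assign r e) = SEQ (compile_exp 0 e) (COPY (24 + r) 0)"
| "compile (Write k e f) =
     SEQ (compile_exp 0 e) (SEQ (compile_exp 1 f) (STORE 1 (8 + k) 0))"
| "compile (Output e) = SEQ (compile_exp 0 e) (SEQ (LOAD 0 23 0) (PUT 0))"
| "compile Finish = EMIT"
| "compile (c ;; d) = SEQ (compile c) (compile d)"
| "compile (Cond b c d) = compile_test b (compile c) (compile d)"
| "compile (For r l c) = SEQ (IMM (24 + r) 0)
     (WHILE (LESS (24 + r) (24 + l)) (SEQ (compile c) (incs (24 + r) 16)))"

section \<open>Well-formed programs and their running times\<close>

primrec wf_exp :: "aexp \<Rightarrow> bool" where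
  "wf_exp (Const n) = True"
| "wf_exp (Reg r) = True"
| "wf_exp (Arr k e) = (k < 15 \<and> wf_exp e)"
| "wf_exp (Succ e) = wf_exp e"

primrec wf_test :: "atest \<Rightarrow> bool" where
  "wf_test (Less e f) = (wf_exp e \<and> wf_exp f)"
| "wf_test (Equal e f) = (wf_exp e \<and> wf_exp f)"

text \<open>L is a set of registers that bound the loops and are never assigned.\<close>

primrec wf :: "nat set \<Rightarrow> acom \<Rightarrow> bool" where
  "wf L Nop = True"
| "wf L (Assign r e) = (r \<notin> L \<and> wf_exp e)"
| "wf L (Write k e f) = (k < 15 \<and> wf_exp e \<and> wf_exp f)"
| "wf L (Output e) = wf_exp e"
| "wf L Finish = True"
| "wf L (c ;; d) = (wf L c \<and> wf L d)"
| "wf L (Cond b c d) = (wf_test b \<and> wf L c \<and> wf L d)"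
| "wf L (For r l c) = (l \<in> L \<and> r \<notin> L \<and> r \<notin> assigned c \<and> wf L c)"

primrec exp_time :: "aexp \<Rightarrow> nat" where
  "exp_time (Const n) = 1"
| "exp_time (Reg r) = 1"
| "exp_time (Arr k e) = exp_time e + 1"
| "exp_time (Succ e) = exp_time e + 17"

primrec test_time :: "atest \<Rightarrow> nat" where
  "test_time (Less e f) = exp_time e + exp_time f + 1"
| "test_time (Equal e f) = exp_time e + exp_time f + 1"

text \<open>A round of a loop costs 18 beyond its body: one test and 17 for \<open>incs\<close>,
  which ends in \<open>SKIP\<close>. The 2 pays for resetting the counter and for the failing test.
  A conditional is charged for both branches, so this is an upper bound.\<close>

primrec time :: "acom \<Rightarrow> (nat \<Rightarrow> nat) \<Rightarrow> nat" where
  "time Nop X = 1"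
| "time (Assign r e) X = exp_time e + 1"
| "time (Write k e f) X = exp_time e + exp_time f + 1"
| "time (Output e) X = exp_time e + 2"
| "time Finish X = 1"
| "time (c ;; d) X = time c X + time d X"
| "time (Cond b c d) X = test_time b + time c X + time d X"
| "time (For r l c) X = 2 + X l * (time c X + 18)"

text \<open>\<open>V\<close> collects the numbers that may be written out. Registers hold multiples
  of 16 and the machine cannot divide, so array 15 has to know these numbers in advance.\<close>

definition represents :: "nat \<Rightarrow> nat set \<Rightarrow> state \<Rightarrow> astate \<Rightarrow> bool" where
  "represents D V = (\<lambda>(X, M) s. (\<forall>r. X (24 + r) = 16 * reg s r) \<and> (\<forall>k<16. X (8 + k) = D + k) \<and>
     (\<forall>k<15. \<forall>i. M (D + k + 16 * i) = 16 * arr s k i) \<and> (\<forall>v\<in>V. M (D + 15 + 16 * v) = v))"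

abbreviation ticks :: "nat \<Rightarrow> event list" where
  "ticks n \<equiv> replicate n Tick"

section \<open>Correctness of the compiled code\<close>

lemma exec_incs: "exec (incs r n) (X, M) (ticks (Suc n)) (X(r := X r + n), M)"
proof (induction n arbitrary: X)
  case 0 show ?case using exec.Skip by simp
next
  case (Suc n)
  have "exec (incs r (Suc n)) (X, M) ([Tick] @ ticks (Suc n)) ((X(r := X r + 1))(r := (X(r := X r + 1)) r + n), M)"
    unfolding incs.simps by (rule exec.Seq[OF exec.Inc Suc])
  then show ?case by (simp del: fun_upd_apply add: fun_upd_same)
qed

lemma represents_temp:
  assumes "represents D V (X, M) s" "t < 8" shows "represents D V (X(t := n), M) s"
  using assms unfolding represents_def by auto

lemma exec_compile_exp:
  assumes "represents D V (X, M) s" "t < 8" "wf_exp e"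
  shows "exec (compile_exp t e) (X, M) (ticks (exp_time e)) (X(t := 16 * ev e s), M)"
  using assms(3)
proof (induction e)
  case (Const n)
  show ?case using exec.Imm[of t "16 * n" X M] by (simp del: fun_upd_apply)
next
  case (Reg r)
  have "X (24 + r) = 16 * reg s r" using assms(1) unfolding represents_def by blast
  then show ?case using exec.Copy[of t "24 + r" X M] by (simp del: fun_upd_apply)
next
  case (Arr k e)
  let ?X = "X(t := 16 * ev e s)"
  have "?X (8 + k) = D + k" "M (D + k + 16 * ev e s) = 16 * arr s k (ev e s)"
    using assms Arr.prems unfolding represents_def by auto
  then have "exec (LOAD t (8 + k) t) (?X, M) [Tick] (X(t := 16 * arr s k (ev e s)), M)"
    using exec.Load[of t "8 + k" t ?X M] by simp
  then have "exec (compile_exp t (Arr k e)) (X, M) (ticks (exp_time e) @ [Tick]) (X(t := 16 * arr s k (ev e s)), M)"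
    unfolding compile_exp.simps by (rule exec.Seq[rotated]) (use Arr in \<open>simp_all del: fun_upd_apply\<close>)
  then show ?case by (simp add: replicate_append_same del: fun_upd_apply)
next
  case (Succ e)
  have "exec (compile_exp t (Succ e)) (X, M) (ticks (exp_time e) @ ticks 17) (X(t := 16 * ev e s + 16), M)"
    unfolding compile_exp.simps
    by (rule exec.Seq) (use Succ exec_incs[of t 16 "X(t := 16 * ev e s)" M] in
        \<open>simp_all del: fun_upd_apply incs.simps add: fun_upd_same\<close>)
  then show ?case by (simp add: replicate_add add.commute del: fun_upd_apply)
qed

lemma exec_compile_exp2:
  assumes "represents D V (X, M) s" "wf_exp e" "wf_exp f"
    "exec c (X(0 := 16 * ev e s, 1 := 16 * ev f s), M) t s'"
  shows "exec (SEQ (compile_exp 0 e) (SEQ (compile_exp 1 f) c)) (X, M)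
    (ticks (exp_time e) @ ticks (exp_time f) @ t) s'"
  by (rule exec.Seq[OF exec_compile_exp[OF assms(1) _ assms(2)]], simp,
      rule exec.Seq[OF exec_compile_exp[OF represents_temp[OF assms(1)] _ assms(3)]])
    (use assms(4) in auto)

lemma wf_assigned: "wf L c \<Longrightarrow> assigned c \<inter> L = {}"
  by (induction c) auto

lemma filter_ticks [simp]: "filter (\<lambda>e. e \<noteq> Tick) (ticks n) = []"
  by (induction n) auto

lemma time_cong: "wf L c \<Longrightarrow> (\<And>l. l \<in> L \<Longrightarrow> X l = Y l) \<Longrightarrow> time c X = time c Y"
  by (induction c) auto

lemma represents_set_reg:
  "represents D V (X, M) s \<Longrightarrow> represents D V (X(24 + r := 16 * n), M) (set_reg r n s)"
  unfolding represents_def by auto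

text \<open>Stated for a loop entered with the counter at j, which allows induction on the remaining
  rounds. The assumption on the body is the induction hypothesis of
  \<open>exec_compile\<close>.\<close>

lemma exec_loop:
  assumes body: "\<And>X M s. represents D V (X, M) s \<Longrightarrow> (\<And>v. Put v \<in> set (out (den c s)) \<Longrightarrow> v \<in> V) \<Longrightarrow>
      \<exists>t X' M'. exec (compile c) (X, M) t (X', M') \<and> represents D V (X', M') (den c s) \<and>
        out (den c s) = out s @ filter (\<lambda>e. e \<noteq> Tick) t \<and> length t \<le> time c (reg s)"
    and wf: "wf L (For r l c)"
    and rep: "represents D V (X, M) s" and j: "reg s r = j" "j \<le> reg s l"
    and V: "\<And>v. Put v \<in> set (out (fold (\<lambda>i s. den c (set_reg r i s)) [j..<reg s l] s)) \<Longrightarrow> v \<in> V"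
  shows "\<exists>t X' M'. exec (WHILE (LESS (24 + r) (24 + l)) (SEQ (compile c) (incs (24 + r) 16))) (X, M) t (X', M') \<and>
     represents D V (X', M') (set_reg r (reg s l) (fold (\<lambda>i s. den c (set_reg r i s)) [j..<reg s l] s)) \<and>
     out (fold (\<lambda>i s. den c (set_reg r i s)) [j..<reg s l] s) = out s @ filter (\<lambda>e. e \<noteq> Tick) t \<and>
     length t \<le> 1 + (reg s l - j) * (time c (reg s) + 18)"
  using rep j V
proof (induction "reg s l - j" arbitrary: X M s j)
  case 0
  then have "j = reg s l" by simp
  moreover have "\<not> holds (LESS (24 + r) (24 + l)) (X, M)"
    using 0 unfolding represents_def by simp
  moreover have "(reg s)(r := reg s l) = reg s" using 0 calculation by (metis fun_upd_triv)
  then have "set_reg r (reg s l) s = s" by simp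
  ultimately show ?case
    using exec.WhileFalse[of "LESS (24 + r) (24 + l)" "(X, M)"] 0
    by - (rule exI[of _ "[Tick]"], rule exI[of _ X], rule exI[of _ M], simp del: fun_upd_apply)
next
  case (Suc n)
  let ?g = "\<lambda>i s. den c (set_reg r i s)"
  define N where "N = reg s l"
  have jN: "j < N" using Suc.hyps(2) N_def by simp
  have rc: "r \<notin> assigned c" "r \<noteq> l" "wf L c" "l \<in> L" using wf by auto
  have lc: "l \<notin> assigned c" using wf_assigned[OF rc(3)] rc(4) by blast
  define s1 where "s1 = den c s"
  define s2 where "s2 = set_reg r (Suc j) s1"
  have sj: "set_reg r j s = s" unfolding Suc.prems(2)[symmetric] by (rule set_reg_triv)
  have fold1: "fold ?g [j..<N] s = fold ?g [Suc j..<N] s1"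
    using jN sj unfolding s1_def by (simp add: upt_conv_Cons)
  have s1l: "reg s1 l = N" "reg s1 r = j" unfolding s1_def
    using reg_den[OF lc] reg_den[OF rc(1)] Suc.prems(2) N_def by auto
  have s2l: "reg s2 l = N" "reg s2 r = Suc j" "out s2 = out s1" unfolding s2_def using s1l rc(2) by auto
  \<comment> \<open>The machine increments the counter after the body, while the fold sets it before
    the body. The two states differ in register r only, and r is overwritten in either case.\<close>
  have fold2: "set_reg r N (fold ?g [Suc j..<N] s1) = set_reg r N (fold ?g [Suc j..<N] s2) \<and>
     out (fold ?g [Suc j..<N] s1) = out (fold ?g [Suc j..<N] s2)"
  proof (cases "Suc j < N")
    case True then show ?thesis unfolding s2_def by (simp add: upt_conv_Cons)
  next
    case False then show ?thesis unfolding s2_def by simp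
  qed
  have ogrow: "set (out s) \<subseteq> set (out (fold ?g xs s))" for xs s
  proof (induction xs arbitrary: s)
    case (Cons x xs)
    have "set (out s) \<subseteq> set (out (den c (set_reg r x s)))" using out_grows[of "set_reg r x s" c] by simp
    then show ?case using Cons[of "den c (set_reg r x s)"] by (auto simp del: fun_upd_apply)
  qed simp
  have V1: "v \<in> V" if "Put v \<in> set (out s1)" for v
  proof -
    have "Put v \<in> set (out (fold ?g [Suc j..<N] s1))" using that ogrow by blast
    then show ?thesis unfolding fold1[symmetric] unfolding N_def by (rule Suc.prems(4))
  qed
  obtain t1 X1 M1 where b: "exec (compile c) (X, M) t1 (X1, M1)" "represents D V (X1, M1) s1"
    "out s1 = out s @ filter (\<lambda>e. e \<noteq> Tick) t1" "length t1 \<le> time c (reg s)"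
    using body[OF Suc.prems(1)] V1 unfolding s1_def by blast
  let ?X2 = "X1(24 + r := X1 (24 + r) + 16)"
  have "X1 (24 + r) = 16 * j" using b(2) s1l unfolding represents_def by auto
  then have rep2: "represents D V (?X2, M1) s2"
    using represents_set_reg[OF b(2), of r "Suc j"] unfolding s2_def by (simp add: add.commute)
  have e1: "exec (SEQ (compile c) (incs (24 + r) 16)) (X, M) (t1 @ ticks 17) (?X2, M1)"
    by (rule exec.Seq[OF b(1)]) (use exec_incs[of "24 + r" 16 X1 M1] in simp)
  have "n = reg s2 l - Suc j" using Suc.hyps(2) s2l N_def by simp
  moreover have "v \<in> V" if "Put v \<in> set (out (fold ?g [Suc j..<reg s2 l] s2))" for v
  proof -
    have "Put v \<in> set (out (fold ?g [Suc j..<N] s1))" using that fold2 unfolding s2l by simp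
    then show ?thesis unfolding fold1[symmetric] unfolding N_def by (rule Suc.prems(4))
  qed
  ultimately obtain t2 X' M' where w:
    "exec (WHILE (LESS (24 + r) (24 + l)) (SEQ (compile c) (incs (24 + r) 16))) (?X2, M1) t2 (X', M')"
    "represents D V (X', M') (set_reg r N (fold ?g [Suc j..<N] s2))"
    "out (fold ?g [Suc j..<N] s2) = out s2 @ filter (\<lambda>e. e \<noteq> Tick) t2"
    "length t2 \<le> 1 + (N - Suc j) * (time c (reg s2) + 18)"
    using Suc.hyps(1)[of s2 "Suc j" ?X2 M1] rep2 jN unfolding s2l by (auto simp del: fun_upd_apply)
  \<comment> \<open>The time depends only on registers that bound loops, and the body leaves these
    alone.\<close>
  have tc: "time c (reg s2) = time c (reg s)"
  proof (rule time_cong[OF rc(3)])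
    fix q assume q: "q \<in> L"
    then have "q \<notin> assigned c" "q \<noteq> r" using wf_assigned[OF rc(3)] wf by auto
    then show "reg s2 q = reg s q" unfolding s2_def s1_def using reg_den by simp
  qed
  have "holds (LESS (24 + r) (24 + l)) (X, M)"
    using Suc.prems jN N_def unfolding represents_def by simp
  then have ex: "exec (WHILE (LESS (24 + r) (24 + l)) (SEQ (compile c) (incs (24 + r) 16))) (X, M)
    (Tick # (t1 @ ticks 17) @ t2) (X', M')"
    using exec.WhileTrue e1 w(1) by blast
  have "N - j = Suc (N - Suc j)" using jN by simp
  then have "length (Tick # (t1 @ ticks 17) @ t2) \<le> 1 + (N - j) * (time c (reg s) + 18)"
    using w(4) b(4) tc by simp
  moreover have "out (fold ?g [j..<N] s) = out s @ filter (\<lambda>e. e \<noteq> Tick) (Tick # (t1 @ ticks 17) @ t2)"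
    using fold1 fold2 w(3) s2l(3) b(3) by simp
  moreover have "represents D V (X', M') (set_reg r N (fold ?g [j..<N] s))"
    using w(2) fold1 fold2 by simp
  ultimately show ?case using ex unfolding N_def[symmetric] by (intro exI conjI)
qed

lemma exec_compile:
  assumes "wf L c" "represents D V (X, M) s" "\<And>v. Put v \<in> set (out (den c s)) \<Longrightarrow> v \<in> V"
  shows "\<exists>t X' M'. exec (compile c) (X, M) t (X', M') \<and> represents D V (X', M') (den c s) \<and>
     out (den c s) = out s @ filter (\<lambda>e. e \<noteq> Tick) t \<and> length t \<le> time c (reg s)"
  using assms
proof (induction c arbitrary: X M s)
  case Nop
  then show ?case using exec.Skip[of "(X, M)"] by - (rule exI[of _ "[Tick]"], rule exI[of _ X], rule exI[of _ M], simp)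
next
  case (Assign r e)
  let ?X = "X(0 := 16 * ev e s)"
  have "exec (compile (Assign r e)) (X, M) (ticks (exp_time e) @ [Tick]) (?X(24 + r := ?X 0), M)"
    unfolding compile.simps
    by (rule exec.Seq[OF exec_compile_exp[OF Assign(2)] exec.Copy]) (use Assign in auto)
  moreover have "represents D V (?X(24 + r := ?X 0), M) (den (Assign r e) s)"
    using represents_set_reg[OF represents_temp[OF Assign(2), of 0 "16 * ev e s"], of r "ev e s"] by simp
  ultimately show ?case by (intro exI[of _ "ticks (exp_time e) @ [Tick]"]) auto
next
  case (Write k e f)
  let ?X = "X(0 := 16 * ev e s, 1 := 16 * ev f s)"
  have b: "?X (8 + k) = D + k" using Write unfolding represents_def by simp
  have "exec (compile (Write k e f)) (X, M) (ticks (exp_time e) @ ticks (exp_time f) @ [Tick])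
      (?X, M(?X (8 + k) + ?X 0 := ?X 1))"
    unfolding compile.simps
    by (rule exec_compile_exp2[OF Write(2) _ _ exec.Store]) (use Write in simp_all)
  moreover have "represents D V (?X, M(?X (8 + k) + ?X 0 := ?X 1)) (den (Write k e f) s)"
  proof -
    \<comment> \<open>Residues modulo 16 keep the interleaved arrays apart.\<close>
    have inj: "D + k' + 16 * i' = D + k + 16 * i \<longleftrightarrow> k' = k \<and> i' = i" if "k' < 16" "k < 15" for k' k i' i
      using that by presburger
    have k: "k < 15" using Write.prems(1) by simp
    have rep: "represents D V (?X, M) s"
      by (intro represents_temp Write.prems(2)) auto
    have st: "?X (8 + k) + ?X 0 = D + k + 16 * ev e s" "?X 1 = 16 * ev f s"
      unfolding b by simp_all
    have "(M(D + k + 16 * ev e s := 16 * ev f s)) (D + k' + 16 * i) = 16 * arr (den (Write k e f) s) k' i"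
      if "k' < 15" for k' i
      using rep that k inj[of k' k i "ev e s"] unfolding represents_def by simp
    moreover have "(M(D + k + 16 * ev e s := 16 * ev f s)) (D + 15 + 16 * v) = v" if "v \<in> V" for v
      using rep that inj[of 15 k v "ev e s", OF _ k] k unfolding represents_def by simp
    ultimately show ?thesis using rep unfolding st represents_def by simp
  qed
  ultimately show ?case by (intro exI[of _ "ticks (exp_time e) @ ticks (exp_time f) @ [Tick]"]) auto
next
  case (Output e)
  let ?X = "X(0 := 16 * ev e s)"
  have "ev e s \<in> V" using Output(3) by simp
  then have l: "?X 23 = D + 15" "M (D + 15 + 16 * ev e s) = ev e s"
  proof -
    have "X (8 + 15) = D + 15" using Output(2) unfolding represents_def by (auto dest: spec[of _ 15])
    then show "?X 23 = D + 15" by simp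
    show "M (D + 15 + 16 * ev e s) = ev e s" using Output(2) \<open>ev e s \<in> V\<close> unfolding represents_def by blast
  qed
  have "exec (compile (Output e)) (X, M) (ticks (exp_time e) @ [Tick] @ [Put (ev e s)]) (X(0 := ev e s), M)"
    unfolding compile.simps
    apply (rule exec.Seq[OF exec_compile_exp[OF Output(2)]])
    using Output apply (simp_all)[2]
    using exec.Seq[OF exec.Load[of 0 23 0 ?X M] exec.Put[of 0]] l by simp
  moreover have "represents D V (X(0 := ev e s), M) (den (Output e) s)"
    using represents_temp[OF Output(2), of 0 "ev e s"] unfolding represents_def by simp
  ultimately show ?case by (intro exI[of _ "ticks (exp_time e) @ [Tick] @ [Put (ev e s)]"]) auto
next
  case Finish
  have "represents D V (X, M) (den Finish s)" using Finish unfolding represents_def by simp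
  then show ?case using exec.Emit[of "(X, M)"] by - (rule exI[of _ "[Emit]"], rule exI[of _ X], rule exI[of _ M], simp)
next
  case (Then c d)
  have "v \<in> V" if "Put v \<in> set (out (den c s))" for v
    using Then.prems(3)[of v] that out_grows[of "den c s" d] by auto
  then obtain t1 X1 M1 where 1: "exec (compile c) (X, M) t1 (X1, M1)" "represents D V (X1, M1) (den c s)"
    "out (den c s) = out s @ filter (\<lambda>e. e \<noteq> Tick) t1" "length t1 \<le> time c (reg s)"
    using Then.IH(1)[OF _ Then.prems(2)] Then.prems(1) by auto
  obtain t2 X2 M2 where 2: "exec (compile d) (X1, M1) t2 (X2, M2)" "represents D V (X2, M2) (den d (den c s))"
    "out (den d (den c s)) = out (den c s) @ filter (\<lambda>e. e \<noteq> Tick) t2" "length t2 \<le> time d (reg (den c s))"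
    using Then.IH(2)[OF _ 1(2)] Then.prems(1,3) by auto
  have "time d (reg (den c s)) = time d (reg s)"
    by (rule time_cong[of L]) (use Then.prems(1) wf_assigned[of L c] reg_den in auto)
  then show ?case using 1 2 exec.Seq[OF 1(1) 2(1)]
    by - (rule exI[of _ "t1 @ t2"], rule exI[of _ X2], rule exI[of _ M2], auto)
next
  case (Cond b c d)
  obtain e f where b: "b = Less e f \<or> b = Equal e f" by (cases b) auto
  define Y where "Y = X(0 := 16 * ev e s, 1 := 16 * ev f s)"
  let ?b = "case b of Less _ _ \<Rightarrow> LESS 0 1 | Equal _ _ \<Rightarrow> EQUAL 0 1"
  have wfe: "wf_exp e" "wf_exp f" using Cond.prems(1) b by auto
  have rep: "represents D V (Y, M) s"
    unfolding Y_def by (intro represents_temp Cond.prems(2)) auto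
  have h: "holds ?b (Y, M) \<longleftrightarrow> sat b s" using b unfolding Y_def by auto
  have "\<exists>t X' M'. exec (IF ?b (compile c) (compile d)) (Y, M) t (X', M') \<and>
    represents D V (X', M') (den (Cond b c d) s) \<and>
    out (den (Cond b c d) s) = out s @ filter (\<lambda>e. e \<noteq> Tick) t \<and> length t \<le> 1 + time c (reg s) + time d (reg s)"
  proof (cases "sat b s")
    case True
    then obtain t X' M' where "exec (compile c) (Y, M) t (X', M')" "represents D V (X', M') (den c s)"
      "out (den c s) = out s @ filter (\<lambda>e. e \<noteq> Tick) t" "length t \<le> time c (reg s)"
      using Cond.IH(1)[OF _ rep] Cond.prems by auto
    then show ?thesis using True h exec.IfTrue[of ?b "(Y, M)"]
      by - (rule exI[of _ "Tick # t"], rule exI[of _ X'], rule exI[of _ M'], auto)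
  next
    case False
    then obtain t X' M' where "exec (compile d) (Y, M) t (X', M')" "represents D V (X', M') (den d s)"
      "out (den d s) = out s @ filter (\<lambda>e. e \<noteq> Tick) t" "length t \<le> time d (reg s)"
      using Cond.IH(2)[OF _ rep] Cond.prems by auto
    then show ?thesis using False h exec.IfFalse[of ?b "(Y, M)"]
      by - (rule exI[of _ "Tick # t"], rule exI[of _ X'], rule exI[of _ M'], auto)
  qed
  then obtain t X' M' where t: "exec (IF ?b (compile c) (compile d)) (Y, M) t (X', M')"
    "represents D V (X', M') (den (Cond b c d) s)"
    "out (den (Cond b c d) s) = out s @ filter (\<lambda>e. e \<noteq> Tick) t" "length t \<le> 1 + time c (reg s) + time d (reg s)"
    by blast
  have "compile (Cond b c d) = SEQ (compile_exp 0 e) (SEQ (compile_exp 1 f) (IF ?b (compile c) (compile d)))"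
    using b by auto
  then have "exec (compile (Cond b c d)) (X, M) (ticks (exp_time e) @ ticks (exp_time f) @ t) (X', M')"
    using exec_compile_exp2[OF Cond.prems(2) wfe t(1)[unfolded Y_def]] by simp
  moreover have "test_time b = exp_time e + exp_time f + 1" using b by auto
  ultimately show ?case using t
    by - (rule exI[of _ "ticks (exp_time e) @ ticks (exp_time f) @ t"], rule exI[of _ X'], rule exI[of _ M'], auto)
next
  case (For r l c)
  let ?s = "set_reg r 0 s" and ?g = "\<lambda>i s. den c (set_reg r i s)"
  let ?X = "X(24 + r := 0)"
  have rep: "represents D V (?X, M) ?s" using represents_set_reg[OF For.prems(2), of r 0] by simp
  have rl: "r \<noteq> l" "wf L c" using For.prems(1) by auto
  \<comment> \<open>The machine resets the counter even if there are no rounds, the fold only in its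
    first round.\<close>
  have f: "fold ?g [0..<reg s l] ?s = fold ?g [0..<reg s l] s \<or> reg s l = 0"
    by (cases "reg s l") (auto simp: upt_conv_Cons simp del: upt_Suc)
  have f1: "set_reg r (reg s l) (fold ?g [0..<reg s l] ?s) = den (For r l c) s"
    "out (fold ?g [0..<reg s l] ?s) = out (den (For r l c) s)" using f by auto
  obtain t X' M' where t: "exec (WHILE (LESS (24 + r) (24 + l)) (SEQ (compile c) (incs (24 + r) 16))) (?X, M) t (X', M')"
    "represents D V (X', M') (den (For r l c) s)"
    "out (den (For r l c) s) = out s @ filter (\<lambda>e. e \<noteq> Tick) t"
    "length t \<le> 1 + reg s l * (time c (reg ?s) + 18)"
    using exec_loop[OF For.IH[OF rl(2)] For.prems(1) rep, of 0] For.prems(3) f1 rl(1) by auto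
  have "time c (reg ?s) = time c (reg s)" by (rule time_cong[OF rl(2)]) (use For.prems(1) in auto)
  moreover have "exec (compile (For r l c)) (X, M) ([Tick] @ t) (X', M')"
    unfolding compile.simps by (rule exec.Seq[OF exec.Imm t(1)])
  ultimately show ?case using t
    by - (rule exI[of _ "[Tick] @ t"], rule exI[of _ X'], rule exI[of _ M'], auto)
qed

subsection \<open>Polynomial time bounds\<close>

primrec degree :: "nat \<Rightarrow> acom \<Rightarrow> nat" where
  "degree q Nop = 0"
| "degree q (Assign r e) = 0"
| "degree q (Write k e f) = 0"
| "degree q (Output e) = 0"
| "degree q Finish = 0"
| "degree q (c ;; d) = max (degree q c) (degree q d)"
| "degree q (Cond b c d) = max (degree q c) (degree q d)"
| "degree q (For r l c) = degree q c + (if l = q then 1 else 0)"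

primrec coeff :: "acom \<Rightarrow> nat" where
  "coeff Nop = 1"
| "coeff (Assign r e) = exp_time e + 1"
| "coeff (Write k e f) = exp_time e + exp_time f + 1"
| "coeff (Output e) = exp_time e + 2"
| "coeff Finish = 1"
| "coeff (c ;; d) = coeff c + coeff d"
| "coeff (Cond b c d) = test_time b + coeff c + coeff d"
| "coeff (For r l c) = 20 + coeff c"

lemma le_mult_one: "(k::nat) \<le> a \<Longrightarrow> 1 \<le> b \<Longrightarrow> k \<le> a * b"
  using mult_le_mono[of k a 1 b] by simp

text \<open>As P and Q are at least 1, each summand is at most the monomial with the maximal
  exponents. The two maxima are taken separately, so a sequence of a loop nest of order
  \<open>m^3 n\<close> and one of order \<open>m n^2\<close> is charged
  \<open>m^3 n^2\<close>.\<close>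

lemma time_bound:
  assumes "wf {p, q} c" "p \<noteq> q" "X p \<le> P" "X q \<le> Q" "1 \<le> P" "1 \<le> Q"
  shows "time c X \<le> coeff c * (P ^ degree p c * Q ^ degree q c)"
  using assms(1)
proof (induction c)
  case (Then c d)
  have "P ^ degree p x * Q ^ degree q x \<le> P ^ degree p (c ;; d) * Q ^ degree q (c ;; d)" if "x = c \<or> x = d" for x
    using that assms(5,6) by (intro mult_le_mono power_increasing) auto
  then have "coeff c * (P ^ degree p c * Q ^ degree q c) + coeff d * (P ^ degree p d * Q ^ degree q d) \<le>
    coeff c * (P ^ degree p (c ;; d) * Q ^ degree q (c ;; d)) + coeff d * (P ^ degree p (c ;; d) * Q ^ degree q (c ;; d))"
    by (intro add_mono mult_le_mono2) auto
  then show ?case using Then by (simp add: algebra_simps)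
next
  case (Cond b c d)
  let ?Z = "P ^ degree p (Cond b c d) * Q ^ degree q (Cond b c d)"
  have "P ^ degree p x * Q ^ degree q x \<le> ?Z" if "x = c \<or> x = d" for x
    using that assms(5,6) by (intro mult_le_mono power_increasing) auto
  then have "coeff c * (P ^ degree p c * Q ^ degree q c) + coeff d * (P ^ degree p d * Q ^ degree q d) \<le>
    coeff c * ?Z + coeff d * ?Z"
    by (intro add_mono mult_le_mono2) auto
  moreover have "1 \<le> ?Z" using assms(5,6) by simp
  then have "test_time b \<le> test_time b * ?Z" by simp
  ultimately have "time (Cond b c d) X \<le> test_time b * ?Z + (coeff c * ?Z + coeff d * ?Z)"
    using Cond.IH Cond.prems unfolding time.simps wf.simps by linarith
  then show ?case by (simp add: algebra_simps)
next
  case (For r l c)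
  let ?Z = "P ^ degree p c * Q ^ degree q c"
  have Z: "1 \<le> ?Z" using assms(5,6) by simp
  define Y where "Y = (if l = p then P else Q)"
  have l: "l = p \<or> l = q" using For.prems by auto
  have Y: "X l \<le> Y" "1 \<le> Y" using l assms unfolding Y_def by auto
  have YZ: "P ^ degree p (For r l c) * Q ^ degree q (For r l c) = Y * ?Z"
    using l assms(2) unfolding Y_def by auto
  have t: "time c X \<le> coeff c * ?Z" using For by simp
  have "X l * (time c X + 18) \<le> Y * (coeff c * ?Z + 18 * ?Z)"
    by (rule mult_le_mono[OF Y(1)]) (use t Z in linarith)
  moreover have "1 * 1 \<le> Y * ?Z" using Y(2) Z by (rule mult_le_mono)
  ultimately have "time (For r l c) X \<le> 2 * (Y * ?Z) + Y * (coeff c * ?Z + 18 * ?Z)"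
    unfolding time.simps by linarith
  also have "\<dots> = coeff (For r l c) * (Y * ?Z)" by (simp add: algebra_simps)
  finally show ?case unfolding YZ .
qed (auto intro!: le_mult_one simp: assms)

subsection \<open>Traces\<close>

definition silent :: "event list \<Rightarrow> bool" where
  "silent t \<longleftrightarrow> set t \<subseteq> {Tick}"

abbreviation visible :: "event list \<Rightarrow> event list" where
  "visible t \<equiv> filter (\<lambda>e. e \<noteq> Tick) t"

lemma visible_silent: "silent t \<Longrightarrow> visible t = []"
  unfolding silent_def by (auto simp: filter_empty_conv)

lemma segments_nonempty [simp]: "segments t \<noteq> []"
  by (cases t) auto

lemma written_visible: "map written (segments (visible t)) = map written (segments t)"
proof (induction t)
  case (Cons e t)
  obtain a as where s: "segments t = a # as" by (cases "segments t") auto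
  obtain b bs where v: "segments (visible t) = b # bs" by (cases "segments (visible t)") auto
  show ?case using Cons s v by (cases e) auto
qed simp

lemma outputs_visible: "outputs (visible t) = outputs t"
  unfolding outputs_def map_butlast written_visible ..

section \<open>Traces that write given words, and their delay\<close>

definition output_events :: "nat list list \<Rightarrow> event list" where
  "output_events ws = concat (map (\<lambda>w. map Put w @ [Emit]) ws)"

lemma segments_put: "segments (map Put w @ Emit # t) = (map Put w @ [Emit]) # segments t"
  by (induction w) auto

lemma outputs_output_events: "outputs (output_events ws) = ws"
proof -
  have w: "written (map Put w @ [Emit]) = w" for w by (induction w) auto
  have "segments (output_events ws) = map (\<lambda>w. map Put w @ [Emit]) ws @ [[]]"
    unfolding output_events_def by (induction ws) (auto simp: segments_put)
  then show ?thesis unfolding outputs_def by (simp add: w comp_def)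
qed

lemma segments_append:
  "segments (t @ u) = butlast (segments t) @ (last (segments t) @ hd (segments u)) # tl (segments u)"
proof (induction t)
  case (Cons e t)
  obtain a as where s: "segments t = a # as" by (cases "segments t") auto
  show ?case using Cons s by (cases as) auto
qed simp

lemma segment_length: "s \<in> set (segments t) \<Longrightarrow> length s \<le> length t"
proof (induction t arbitrary: s)
  case (Cons e t)
  obtain a as where a: "segments t = a # as" by (cases "segments t") auto
  show ?case using Cons.prems Cons.IH[of s] Cons.IH[of a] a by (auto split: if_splits)
qed simp

lemma segments_two: "Emit \<in> set t \<Longrightarrow> tl (segments t) \<noteq> []"
proof (induction t)
  case (Cons e t)
  then show ?case by (cases e) auto
qed simp

text \<open>Every block of \<open>ts\<close> contains an \<open>Emit\<close>, so a segment meets at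
  most two consecutive blocks: hence the factor 2. The induction also needs that the first segment
  lies within a single block.\<close>

lemma delay_bound:
  assumes t: "length t0 \<le> B" and ts: "\<And>t. t \<in> set ts \<Longrightarrow> length t \<le> B \<and> Emit \<in> set t"
    and w: "length w \<le> B"
  shows "delay (t0 @ concat ts @ w) \<le> 2 * B"
proof -
  have *: "(\<forall>s \<in> set (segments (concat ts @ w)). length s \<le> 2 * B) \<and> length (hd (segments (concat ts @ w))) \<le> B"
    using ts
  proof (induction ts)
    case Nil
    have "length s \<le> B" if "s \<in> set (segments w)" for s
      using segment_length[OF that] w by simp
    then show ?case by fastforce
  next
    case (Cons t ts)
    let ?u = "concat ts @ w"
    have t: "length t \<le> B" "Emit \<in> set t" using Cons.prems by auto
    have u: "\<forall>s \<in> set (segments ?u). length s \<le> 2 * B" "length (hd (segments ?u)) \<le> B"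
      using Cons by auto
    obtain a as where a: "segments t = a # as" "as \<noteq> []" using segments_two[OF t(2)]
      by (cases "segments t") auto
    have sl: "length s \<le> B" if "s \<in> set (segments t)" for s
      using segment_length[OF that] t(1) by simp
    have ll: "length (last (segments t)) \<le> B" using sl by simp
    have "\<forall>s \<in> set (segments (t @ ?u)). length s \<le> 2 * B"
      unfolding segments_append[of t]
    proof
      fix s assume "s \<in> set (butlast (segments t) @ (last (segments t) @ hd (segments ?u)) # tl (segments ?u))"
      then consider "s \<in> set (segments t)" | "s = last (segments t) @ hd (segments ?u)" | "s \<in> set (segments ?u)"
        by (auto dest: in_set_butlastD list.set_sel(2)[OF segments_nonempty])
      then show "length s \<le> 2 * B"
      proof cases
        case 1 then show ?thesis using sl by fastforce
      qed (use ll u in auto)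
    qed
    moreover have "length (hd (segments (t @ ?u))) \<le> B"
      unfolding segments_append[of t] using a sl by simp
    ultimately show ?case by simp
  qed
  have "length s \<le> 2 * B" if "s \<in> set (segments (t0 @ concat ts @ w))" for s
  proof -
    have "s \<in> set (segments t0) \<or> s = last (segments t0) @ hd (segments (concat ts @ w)) \<or> s \<in> set (segments (concat ts @ w))"
      using that unfolding segments_append[of t0]
      by (auto dest: in_set_butlastD list.set_sel(2)[OF segments_nonempty])
    moreover have "length r \<le> B" if "r \<in> set (segments t0)" for r
      using segment_length[OF that] t by simp
    moreover have "length (last (segments t0)) \<le> B" using calculation(2) by simp
    ultimately show ?thesis using * by (fastforce simp: mult_2)
  qed
  then show ?thesis unfolding delay_def by (subst Max_le_iff) auto
qed

subsection \<open>Reading the input\<close>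

definition runs :: "com \<Rightarrow> state \<Rightarrow> nat \<Rightarrow> state \<Rightarrow> bool" where
  "runs c s n s' \<longleftrightarrow> (\<exists>t. exec c s t s' \<and> silent t \<and> length t \<le> n)"

lemma runs_mono: "runs c s n s' \<Longrightarrow> n \<le> m \<Longrightarrow> runs c s m s'"
  unfolding runs_def by (meson le_trans)

lemma runs_seq: "runs c s n s' \<Longrightarrow> runs d s' m s'' \<Longrightarrow> runs (SEQ c d) s (n + m) s''"
  unfolding runs_def silent_def
  by (elim exE conjE, rule exI, rule conjI, rule exec.Seq) auto

lemma runs_step: "exec c s [Tick] s' \<Longrightarrow> runs c s 1 s'"
  unfolding runs_def silent_def by (intro exI[of _ "[Tick]"]) simp

lemmas runs_atomic = exec.Skip[THEN runs_step] exec.Imm[THEN runs_step] exec.Copy[THEN runs_step]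
  exec.Inc[THEN runs_step] exec.Load[THEN runs_step] exec.Store[THEN runs_step]

lemma runs_incs: "runs (incs r n) (X, M) (Suc n) (X(r := X r + n), M)"
  unfolding runs_def silent_def using exec_incs[of r n X M] by (intro exI[of _ "ticks (Suc n)"]) auto

lemma runs_while:
  assumes "I 0 s" "\<And>s. I n s \<Longrightarrow> \<not> holds b s"
    "\<And>i s. i < n \<Longrightarrow> I i s \<Longrightarrow> holds b s \<and> (\<exists>s'. runs c s k s' \<and> I (Suc i) s')"
  shows "\<exists>s'. runs (WHILE b c) s (1 + n * (k + 1)) s' \<and> I n s'"
proof -
  have "\<exists>s'. runs (WHILE b c) s (1 + d * (k + 1)) s' \<and> I n s'" if "I i s" "i + d = n" for i d s
    using that
  proof (induction d arbitrary: i s)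
    case 0
    then have "runs (WHILE b c) s 1 s" using assms(2) by (intro runs_step exec.WhileFalse) simp
    then show ?case using 0 by (intro exI[of _ s]) simp
  next
    case (Suc d)
    obtain s1 where s1: "holds b s" "runs c s k s1" "I (Suc i) s1" using assms(3)[of i s] Suc.prems by auto
    obtain s2 where s2: "runs (WHILE b c) s1 (1 + d * (k + 1)) s2" "I n s2"
      using Suc.IH[OF s1(3)] Suc.prems by auto
    obtain t1 where t1: "exec c s t1 s1" "silent t1" "length t1 \<le> k" using s1(2) unfolding runs_def by blast
    obtain t2 where t2: "exec (WHILE b c) s1 t2 s2" "silent t2" "length t2 \<le> 1 + d * (k + 1)"
      using s2(1) unfolding runs_def by blast
    have "exec (WHILE b c) s (Tick # t1 @ t2) s2" using exec.WhileTrue[OF s1(1) t1(1) t2(1)] .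
    moreover have "silent (Tick # t1 @ t2)" using t1(2) t2(2) unfolding silent_def by auto
    moreover have "length (Tick # t1 @ t2) \<le> 1 + Suc d * (k + 1)" using t1(3) t2(3) by simp
    ultimately have "runs (WHILE b c) s (1 + Suc d * (k + 1)) s2" unfolding runs_def by blast
    then show ?case using s2(2) by blast
  qed
  then show ?thesis using assms(1) by (metis add_0)
qed

text \<open>In the representation, array 0 will hold the input, array 15 the identity on the numbers that
  occur in it, and register 0 the length of the first word.\<close>

definition add_lengths :: com where
  "add_lengths = SEQ (COPY 2 0) (SEQ (IMM 3 0) (WHILE (LESS 3 1) (SEQ (INC 2) (INC 3))))"

primrec set_bases :: "nat \<Rightarrow> com" where
  "set_bases 0 = COPY 8 2"
| "set_bases (Suc k) = SEQ (set_bases k) (SEQ (COPY (9 + k) (8 + k)) (INC (9 + k)))"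

text \<open>Scaling by 16 is done by counting, in time linear in the number. Register 3 holds the
  position and register 4 its multiple by 16; register 6 is the zero index of the load before it
  becomes the counter.\<close>

definition scale_word :: com where
  "scale_word = SEQ (IMM 6 0) (SEQ (LOAD 5 3 6) (SEQ (IMM 7 0) (SEQ
     (WHILE (LESS 6 5) (SEQ (INC 6) (incs 7 16)))
     (SEQ (STORE 7 8 4) (SEQ (STORE 5 23 7) (SEQ (INC 3) (incs 4 16)))))))"

text \<open>The arrays start at D, the length of the whole input, so writing to them never damages
  input still to be read. The last loop scales the length of the first word into register 24, which
  stands for register 0.\<close>

definition read_input :: com where
  "read_input = SEQ add_lengths (SEQ (set_bases 15) (SEQ (IMM 3 0) (SEQ (IMM 4 0) (SEQ
     (WHILE (LESS 3 2) scale_word)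
     (SEQ (IMM 3 0) (WHILE (LESS 3 0) (SEQ (INC 3) (incs 24 16))))))))"

definition input_state :: "nat list list \<Rightarrow> astate" where
  "input_state ws = \<lparr>reg = (\<lambda>_. 0)(0 := length (hd ws)),
     arr = (\<lambda>_ _. 0)(0 := \<lambda>i. if i < length (concat ws) then concat ws ! i else 0), out = []\<rparr>"

lemma runs_add_lengths:
  assumes "X 1 = b"
  shows "\<exists>X'. runs add_lengths (X, M) (3 + b * 3) (X', M) \<and> X' 2 = X 0 + b \<and> (\<forall>r. r \<noteq> 2 \<and> r \<noteq> 3 \<longrightarrow> X' r = X r)"
proof -
  let ?I = "\<lambda>i (Y, N). N = M \<and> Y 2 = X 0 + i \<and> Y 3 = i \<and> (\<forall>r. r \<noteq> 2 \<and> r \<noteq> 3 \<longrightarrow> Y r = X r)"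
  have "\<exists>s'. runs (WHILE (LESS 3 1) (SEQ (INC 2) (INC 3))) (X(2 := X 0, 3 := 0), M) (1 + b * (2 + 1)) s' \<and> ?I b s'"
  proof (rule runs_while)
    fix i s assume i: "i < b" and "?I i s"
    then obtain Y where Y: "s = (Y, M)" "Y 2 = X 0 + i" "Y 3 = i" "\<forall>r. r \<noteq> 2 \<and> r \<noteq> 3 \<longrightarrow> Y r = X r"
      by (cases s) auto
    have "runs (SEQ (INC 2) (INC 3)) (Y, M) (1 + 1) (Y(2 := Y 2 + 1, 3 := (Y(2 := Y 2 + 1)) 3 + 1), M)"
      by (rule runs_seq runs_atomic)+
    then show "holds (LESS 3 1) s \<and> (\<exists>s'. runs (SEQ (INC 2) (INC 3)) s 2 s' \<and> ?I (Suc i) s')"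
      using Y i assms by (intro conjI exI[of _ "(Y(2 := Y 2 + 1, 3 := (Y(2 := Y 2 + 1)) 3 + 1), M)"]) (simp_all add: numeral_2_eq_2 del: One_nat_def)
  qed (use assms in auto)
  then obtain s' where s': "runs (WHILE (LESS 3 1) (SEQ (INC 2) (INC 3))) (X(2 := X 0, 3 := 0), M) (1 + b * (2 + 1)) s'" "?I b s'"
    by blast
  have "runs add_lengths (X, M) (1 + (1 + (1 + b * (2 + 1)))) s'"
    unfolding add_lengths_def by (rule runs_seq runs_atomic s'(1))+
  then have "runs add_lengths (X, M) (3 + b * 3) s'" by (rule runs_mono) simp
  moreover obtain Y N where "s' = (Y, N)" by force
  ultimately show ?thesis using s'(2) by (intro exI[of _ Y]) auto
qed

lemma runs_set_bases:
  "\<exists>X'. runs (set_bases k) (X, M) (1 + 2 * k) (X', M) \<and> (\<forall>i\<le>k. X' (8 + i) = X 2 + i) \<and>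
     (\<forall>r. r < 8 \<or> 8 + k < r \<longrightarrow> X' r = X r)"
proof (induction k)
  case 0
  have "runs (set_bases 0) (X, M) (1 + 2 * 0) (X(8 := X 2), M)" using runs_atomic(3)[of 8 2 X M] by simp
  then show ?case by - (rule exI[of _ "X(8 := X 2)"], intro conjI allI impI, assumption, auto)
next
  case (Suc k)
  then obtain Y where Y: "runs (set_bases k) (X, M) (1 + 2 * k) (Y, M)" "\<forall>i\<le>k. Y (8 + i) = X 2 + i"
    "\<forall>r. r < 8 \<or> 8 + k < r \<longrightarrow> Y r = X r" by blast
  let ?Y = "Y(9 + k := Y (8 + k))" let ?Z = "?Y(9 + k := ?Y (9 + k) + 1)"
  have "runs (set_bases (Suc k)) (X, M) (1 + 2 * k + (1 + 1)) (?Z, M)"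
    unfolding set_bases.simps by (rule runs_seq Y(1) runs_atomic)+
  moreover have "?Z (8 + i) = X 2 + i" if "i \<le> Suc k" for i
    using that Y(2) by (cases "i = Suc k") auto
  moreover have "?Z r = X r" if "r < 8 \<or> 8 + Suc k < r" for r using that Y(3) by auto
  ultimately show ?case by - (rule exI[of _ ?Z], intro conjI allI impI, simp_all del: set_bases.simps fun_upd_apply)
qed

lemma runs_scale_loop:
  assumes "X 6 = 0" "X 7 = 0" "X 5 = v"
  shows "\<exists>X'. runs (WHILE (LESS 6 5) (SEQ (INC 6) (incs 7 16))) (X, M) (1 + v * 19) (X', M) \<and> X' 7 = 16 * v \<and>
    (\<forall>r. r \<noteq> 6 \<and> r \<noteq> 7 \<longrightarrow> X' r = X r)"
proof -
  let ?I = "\<lambda>i (Y, N). N = M \<and> Y 6 = i \<and> Y 7 = 16 * i \<and> (\<forall>r. r \<noteq> 6 \<and> r \<noteq> 7 \<longrightarrow> Y r = X r)"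
  have "\<exists>s'. runs (WHILE (LESS 6 5) (SEQ (INC 6) (incs 7 16))) (X, M) (1 + v * (18 + 1)) s' \<and> ?I v s'"
  proof (rule runs_while)
    fix i s assume i: "i < v" and "?I i s"
    then obtain Y where Y: "s = (Y, M)" "Y 6 = i" "Y 7 = 16 * i" "\<forall>r. r \<noteq> 6 \<and> r \<noteq> 7 \<longrightarrow> Y r = X r"
      by (cases s) auto
    have "runs (SEQ (INC 6) (incs 7 16)) (Y, M) (1 + Suc 16) (Y(6 := Y 6 + 1, 7 := (Y(6 := Y 6 + 1)) 7 + 16), M)"
      by (rule runs_seq runs_atomic runs_incs)+
    then show "holds (LESS 6 5) s \<and> (\<exists>s'. runs (SEQ (INC 6) (incs 7 16)) s 18 s' \<and> ?I (Suc i) s')"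
      using Y i assms
      by (intro conjI exI[of _ "(Y(6 := Y 6 + 1, 7 := (Y(6 := Y 6 + 1)) 7 + 16), M)"]) (simp_all del: incs.simps)
  qed (use assms in auto)
  then show ?thesis by auto
qed

lemma runs_scale_word:
  assumes "X 3 = p" "X 4 = 16 * p" "X 8 = D" "X 23 = D + 15" "M p = v"
  shows "\<exists>X'. runs scale_word (X, M) (25 + v * 19) (X', M(D + 16 * p := 16 * v, D + 15 + 16 * v := v)) \<and>
    X' 3 = Suc p \<and> X' 4 = 16 * Suc p \<and> (\<forall>r. r < 3 \<or> 7 < r \<longrightarrow> X' r = X r)"
proof -
  let ?X1 = "X(6 := 0)" let ?X2 = "?X1(5 := M (?X1 3 + ?X1 6))" let ?X3 = "?X2(7 := 0)"
  obtain Y where Y: "runs (WHILE (LESS 6 5) (SEQ (INC 6) (incs 7 16))) (?X3, M) (1 + v * 19) (Y, M)"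
    "Y 7 = 16 * v" "\<forall>r. r \<noteq> 6 \<and> r \<noteq> 7 \<longrightarrow> Y r = ?X3 r"
    using runs_scale_loop[of ?X3 v M] assms by auto
  let ?M1 = "M(Y 8 + Y 4 := Y 7)" let ?M2 = "?M1(Y 23 + Y 7 := Y 5)"
  let ?Y1 = "Y(3 := Y 3 + 1)" let ?Y2 = "?Y1(4 := ?Y1 4 + 16)"
  have "runs scale_word (X, M) (1 + (1 + (1 + ((1 + v * 19) + (1 + (1 + (1 + Suc 16))))))) (?Y2, ?M2)"
    unfolding scale_word_def by (rule runs_seq runs_atomic Y(1) runs_incs)+
  moreover have "Y 8 + Y 4 = D + 16 * p" "Y 23 + Y 7 = D + 15 + 16 * v" "Y 5 = v"
    using Y(2,3) assms by auto
  ultimately have "runs scale_word (X, M) (25 + v * 19) (?Y2, M(D + 16 * p := 16 * v, D + 15 + 16 * v := v))"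
    unfolding Y(2) by (auto elim!: runs_mono simp del: fun_upd_apply)
  then show ?thesis using Y(3) assms by (intro exI[of _ ?Y2]) auto
qed

lemma runs_read_input:
  assumes ws: "ws \<noteq> []" "length ws \<le> 2" and W: "\<And>v. v \<in> set (concat ws) \<Longrightarrow> v \<le> W"
  shows "\<exists>s. runs read_input (init ws) (60 + length (concat ws) * (70 + 19 * W)) s \<and>
    represents (length (concat ws)) (set (concat ws)) s (input_state ws)"
proof -
  let ?w = "concat ws"
  define D where "D = length ?w"
  obtain X0 M0 where i0: "init ws = (X0, M0)" by force
  have M0: "M0 a = (if a < D then ?w ! a else 0)" for a using i0 unfolding init_def D_def by auto
  have X0: "X0 i = (if i < length ws then length (ws ! i) else 0)" for i using i0 unfolding init_def by auto
  have D: "X0 0 + X0 1 = D"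
  proof (cases ws)
    case (Cons w ws')
    then show ?thesis using ws X0 unfolding D_def by (cases ws') auto
  qed (use ws in simp)
  have X0h: "X0 0 = length (hd ws)" using X0[of 0] ws(1) by (simp add: hd_conv_nth)
  have X0z: "X0 r = 0" if "r \<ge> 2" for r using X0[of r] ws(2) that by simp
  obtain X1 where X1: "runs add_lengths (X0, M0) (3 + X0 1 * 3) (X1, M0)" "X1 2 = D"
    "\<forall>r. r \<noteq> 2 \<and> r \<noteq> 3 \<longrightarrow> X1 r = X0 r"
    using runs_add_lengths[of X0 "X0 1" M0] D by auto
  obtain X2 where X2: "runs (set_bases 15) (X1, M0) (1 + 2 * 15) (X2, M0)" "\<forall>i\<le>15. X2 (8 + i) = D + i"
    "\<forall>r. r < 8 \<or> 8 + 15 < r \<longrightarrow> X2 r = X1 r" using runs_set_bases[of 15 X1 M0] X1(2) by auto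
  let ?X3 = "X2(3 := 0)" let ?X4 = "?X3(4 := 0)"
  \<comment> \<open>The unscaled input below D survives because all writes go to addresses from D
    on.\<close>
  define I where "I = (\<lambda>i (Y, N). Y 0 = X0 0 \<and> Y 2 = D \<and> Y 3 = i \<and> Y 4 = 16 * i \<and> (\<forall>k\<le>15. Y (8 + k) = D + k) \<and>
    (\<forall>r. Y (24 + r) = 0) \<and> (\<forall>a<D. N a = ?w ! a) \<and>
    (\<forall>k<15. \<forall>j. N (D + k + 16 * j) = (if k = 0 \<and> j < i then 16 * ?w ! j else 0)) \<and>
    (\<forall>j<i. N (D + 15 + 16 * ?w ! j) = ?w ! j))"
  have "\<exists>s'. runs (WHILE (LESS 3 2) scale_word) (?X4, M0) (1 + D * ((25 + W * 19) + 1)) s' \<and> I D s'"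
  proof (rule runs_while)
    have "?X4 0 = X0 0" "?X4 2 = D" using X1(2,3) X2(3) by simp_all
    moreover have "?X4 (8 + k) = D + k" if "k \<le> 15" for k using that X2(2) by simp
    moreover have "?X4 (24 + q) = 0" for q using X2(3) X1(3) X0z[of "24 + q"] by simp
    ultimately show "I 0 (?X4, M0)" using M0 unfolding I_def by simp
  next
    fix i s assume i: "i < D" and "I i s"
    then obtain Y N where s: "s = (Y, N)" and Y: "Y 0 = X0 0" "Y 2 = D" "Y 3 = i" "Y 4 = 16 * i"
      "\<forall>k\<le>15. Y (8 + k) = D + k" "\<forall>r. Y (24 + r) = 0" "\<forall>a<D. N a = ?w ! a"
      "\<forall>k<15. \<forall>j. N (D + k + 16 * j) = (if k = 0 \<and> j < i then 16 * ?w ! j else 0)"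
      "\<forall>j<i. N (D + 15 + 16 * ?w ! j) = ?w ! j"
      by (cases s) (simp add: I_def)
    let ?v = "?w ! i"
    let ?N = "N(D + 16 * i := 16 * ?v, D + 15 + 16 * ?v := ?v)"
    have v: "?v \<le> W" using W i unfolding D_def by (metis nth_mem)
    have "Y 8 = D" "Y 23 = D + 15" using Y(5)[rule_format, of 0] Y(5)[rule_format, of 15] by auto
    then obtain Z where Z: "runs scale_word (Y, N) (25 + ?v * 19) (Z, ?N)" "Z 3 = Suc i" "Z 4 = 16 * Suc i"
      "\<forall>r. r < 3 \<or> 7 < r \<longrightarrow> Z r = Y r"
      using runs_scale_word[of Y i D N ?v] Y i by auto
    have "runs scale_word s (25 + W * 19) (Z, ?N)" unfolding s by (rule runs_mono[OF Z(1)]) (use v in simp)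
    moreover have "?N a = ?w ! a" if "a < D" for a using that Y(7) by simp
    moreover have "?N (D + k + 16 * j) = (if k = 0 \<and> j < Suc i then 16 * ?w ! j else 0)" if "k < 15" for k j
    proof -
      have "D + k + 16 * j \<noteq> D + 15 + 16 * ?v" using that by presburger
      moreover have "D + k + 16 * j = D + 16 * i \<longleftrightarrow> k = 0 \<and> j = i" using that by presburger
      ultimately show ?thesis using Y(8) that by (auto simp: less_Suc_eq)
    qed
    moreover have "?N (D + 15 + 16 * ?w ! j) = ?w ! j" if "j < Suc i" for j
    proof -
      have "D + 15 + 16 * ?w ! j \<noteq> D + 16 * i" by presburger
      then show ?thesis using Y(9) that by (cases "j = i") auto
    qed
    ultimately show "holds (LESS 3 2) s \<and> (\<exists>s'. runs scale_word s (25 + W * 19) s' \<and> I (Suc i) s')"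
      using Z Y i unfolding I_def s by (intro conjI exI[of _ "(Z, ?N)"]) (simp_all del: fun_upd_apply)
  qed (auto simp: I_def)
  then obtain X5 M5 where 5: "runs (WHILE (LESS 3 2) scale_word) (?X4, M0) (1 + D * ((25 + W * 19) + 1)) (X5, M5)"
    "I D (X5, M5)" by auto
  have X5: "X5 0 = X0 0" "\<forall>k\<le>15. X5 (8 + k) = D + k" "\<forall>r. X5 (24 + r) = 0"
    "\<forall>k<15. \<forall>j. M5 (D + k + 16 * j) = (if k = 0 \<and> j < D then 16 * ?w ! j else 0)"
    "\<forall>j<D. M5 (D + 15 + 16 * ?w ! j) = ?w ! j"
    using 5(2) unfolding I_def by simp_all
  let ?X6 = "X5(3 := 0)"
  define J where "J = (\<lambda>i (Y, N). N = M5 \<and> Y 3 = i \<and> Y 24 = 16 * i \<and> (\<forall>r. r \<noteq> 3 \<and> r \<noteq> 24 \<longrightarrow> Y r = X5 r))"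
  have "\<exists>s'. runs (WHILE (LESS 3 0) (SEQ (INC 3) (incs 24 16))) (?X6, M5) (1 + X0 0 * (18 + 1)) s' \<and> J (X0 0) s'"
  proof (rule runs_while)
    show "J 0 (?X6, M5)" using X5(3)[rule_format, of 0] unfolding J_def by simp
  next
    fix i s assume i: "i < X0 0" and "J i s"
    then obtain Y where Y: "s = (Y, M5)" "Y 3 = i" "Y 24 = 16 * i" "\<forall>r. r \<noteq> 3 \<and> r \<noteq> 24 \<longrightarrow> Y r = X5 r"
      by (cases s) (simp add: J_def)
    have "runs (SEQ (INC 3) (incs 24 16)) (Y, M5) (1 + Suc 16) (Y(3 := Y 3 + 1, 24 := (Y(3 := Y 3 + 1)) 24 + 16), M5)"
      by (rule runs_seq runs_atomic runs_incs)+
    then show "holds (LESS 3 0) s \<and> (\<exists>s'. runs (SEQ (INC 3) (incs 24 16)) s 18 s' \<and> J (Suc i) s')"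
      using Y i X5(1) unfolding J_def
      by (intro conjI exI[of _ "(Y(3 := Y 3 + 1, 24 := (Y(3 := Y 3 + 1)) 24 + 16), M5)"]) (simp_all del: incs.simps)
  qed (use X5(1) in \<open>auto simp: J_def\<close>)
  then obtain X7 where 7: "runs (WHILE (LESS 3 0) (SEQ (INC 3) (incs 24 16))) (?X6, M5) (1 + X0 0 * (18 + 1)) (X7, M5)"
    "X7 24 = 16 * X0 0" "\<forall>r. r \<noteq> 3 \<and> r \<noteq> 24 \<longrightarrow> X7 r = X5 r" unfolding J_def by auto
  have "runs read_input (X0, M0) (3 + X0 1 * 3 + (1 + 2 * 15 + (1 + (1 + (1 + D * ((25 + W * 19) + 1) + (1 + (1 + X0 0 * (18 + 1)))))))) (X7, M5)"
    unfolding read_input_def by (rule runs_seq X1(1) X2(1) runs_atomic 5(1) 7(1))+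
  moreover have "3 + X0 1 * 3 + (1 + 2 * 15 + (1 + (1 + (1 + D * ((25 + W * 19) + 1) + (1 + (1 + X0 0 * (18 + 1))))))) \<le> 60 + D * (70 + 19 * W)"
    using D by (simp add: algebra_simps)
  ultimately have "runs read_input (init ws) (60 + D * (70 + 19 * W)) (X7, M5)" unfolding i0 by (rule runs_mono)
  moreover have "represents D (set ?w) (X7, M5) (input_state ws)"
    unfolding represents_def prod.case
  proof (intro conjI allI impI ballI)
    show "X7 (24 + r) = 16 * reg (input_state ws) r" for r
      using 7(2,3) X5(3) X0h unfolding input_state_def by (cases "r = 0") simp_all
    show "X7 (8 + k) = D + k" if "k < 16" for k using 7(3) X5(2) that by simp
    show "M5 (D + k + 16 * i) = 16 * arr (input_state ws) k i" if "k < 15" for k i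
      using X5(4) that unfolding input_state_def D_def by simp
    show "M5 (D + 15 + 16 * v) = v" if "v \<in> set ?w" for v
      using that X5(5) unfolding D_def in_set_conv_nth by auto
  qed
  ultimately show ?thesis unfolding D_def by blast
qed

section \<open>The listing algorithm\<close>

subsection \<open>Edge tables\<close>

text \<open>Register 1 holds the number of vertices and register 2 the number of edges; arrays 1 and 2 hold
  the endpoints of the edges. Sets of edges are given by arrays that are nonzero at the indices
  of their elements: array 3 is the set under construction, array 4 the solution whose
  neighbours are being computed. Array 5 marks visited vertices, arrays 6 and 7 neighbourhoods.
  Arrays 8 and 9 hold the children of a binary trie of the solutions found so far, array 10 marks
  those of its nodes that stand for solutions, and array 11 is the queue of these solutions.\<close>

definition table_state :: "nat \<Rightarrow> (nat \<times> nat) list \<Rightarrow> astate \<Rightarrow> bool" where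
  "table_state n es s \<longleftrightarrow> reg s 1 = n \<and> reg s 2 = length es \<and>
     (\<forall>i<length es. arr s 1 i = fst (es ! i) \<and> arr s 2 i = snd (es ! i))"

definition edge_set :: "(nat \<times> nat) list \<Rightarrow> (nat \<Rightarrow> nat) \<Rightarrow> nat set set" where
  "edge_set es f = {edge (es ! i) | i. i < length es \<and> f i \<noteq> 0}"

lemma table_stateD:
  assumes "table_state n es s"
  shows "reg s 1 = n" "reg s (Suc 0) = n" "reg s 2 = length es"
    "i < length es \<Longrightarrow> arr s 1 i = fst (es ! i)" "i < length es \<Longrightarrow> arr s (Suc 0) i = fst (es ! i)"
    "i < length es \<Longrightarrow> arr s 2 i = snd (es ! i)"
  using assms unfolding table_state_def by auto

lemma table_state_cong:
  assumes "table_state n es s" "reg s' 1 = reg s 1" "reg s' 2 = reg s 2" "arr s' 1 = arr s 1" "arr s' 2 = arr s 2"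
  shows "table_state n es s'"
  using assms unfolding table_state_def by simp

lemma table_state_den:
  "table_state n es s \<Longrightarrow> {1, 2} \<inter> assigned c = {} \<Longrightarrow> {1, 2} \<inter> modified c = {} \<Longrightarrow> table_state n es (den c s)"
  by (erule table_state_cong) (auto intro: reg_den arr_den)

lemma table_state_set_reg: "table_state n es s \<Longrightarrow> 2 < r \<Longrightarrow> table_state n es (set_reg r v s)"
  by (erule table_state_cong) auto

lemma ex_less_Suc: "(\<exists>j<Suc i. P j) \<longleftrightarrow> (\<exists>j<i. P j) \<or> P i"
  using less_Suc_eq by auto

locale edge_table =
  fixes n :: nat and es :: "(nat \<times> nat) list"
  assumes range: "p \<in> set es \<Longrightarrow> fst p < n \<and> snd p < n"
    and irrefl: "p \<in> set es \<Longrightarrow> fst p \<noteq> snd p"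
    and distinct_edges: "distinct (map edge es)"
begin

lemma range_nth: "i < length es \<Longrightarrow> fst (es ! i) < n" "i < length es \<Longrightarrow> snd (es ! i) < n"
  using range nth_mem by blast+

lemma irrefl_nth: "i < length es \<Longrightarrow> fst (es ! i) \<noteq> snd (es ! i)"
  using irrefl nth_mem by blast

lemma edge_inj: "i < length es \<Longrightarrow> j < length es \<Longrightarrow> edge (es ! i) = edge (es ! j) \<longleftrightarrow> i = j"
  using nth_eq_iff_index_eq[OF distinct_edges] by simp

lemma edge_in_edge_set: "i < length es \<Longrightarrow> edge (es ! i) \<in> edge_set es f \<longleftrightarrow> f i \<noteq> 0"
  unfolding edge_set_def using edge_inj by blast

lemma edge_set_upd1: "i < length es \<Longrightarrow> edge_set es (f(i := Suc 0)) = insert (edge (es ! i)) (edge_set es f)"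
  unfolding edge_set_def by auto

lemma edge_set_eqI:
  assumes "A \<subseteq> edge ` set es" "\<And>i. i < length es \<Longrightarrow> f i \<noteq> 0 \<longleftrightarrow> edge (es ! i) \<in> A"
  shows "edge_set es f = A"
proof
  show "A \<subseteq> edge_set es f"
  proof
    fix e assume e: "e \<in> A"
    then obtain i where i: "i < length es" "e = edge (es ! i)" using assms(1) by (force simp: in_set_conv_nth)
    then show "e \<in> edge_set es f" using e assms(2) edge_in_edge_set by simp
  qed
qed (use assms(2) in \<open>auto simp: edge_set_def\<close>)

lemma edge_set_subset: "edge_set es f \<subseteq> edge ` set es"
  unfolding edge_set_def by auto

lemma edge_in_range: "{a, b} \<in> edge_set es f \<Longrightarrow> a < n \<and> b < n"
  using range_nth unfolding edge_set_def by (auto simp: doubleton_eq_iff)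

lemma simple_edges: "simple_graph (edge ` set es)"
  unfolding simple_graph_def using irrefl by auto

end

subsection \<open>Neighbourhoods\<close>

definition clear :: "nat \<Rightarrow> acom" where
  "clear d = For 5 1 (Write d (Reg 5) (Const 0))"

definition mark_neighbours :: "nat \<Rightarrow> nat \<Rightarrow> nat \<Rightarrow> acom" where
  "mark_neighbours k r d = clear d ;; For 5 2
     (Cond (Equal (Arr k (Reg 5)) (Const 0)) Nop
       (Cond (Equal (Arr 1 (Reg 5)) (Reg r)) (Write d (Arr 2 (Reg 5)) (Const 1)) Nop ;;
        Cond (Equal (Arr 2 (Reg 5)) (Reg r)) (Write d (Arr 1 (Reg 5)) (Const 1)) Nop))"

lemma clear_zero: "y < reg s 1 \<Longrightarrow> arr (den (clear d) s) d y = 0"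
proof -
  assume y: "y < reg s 1"
  have "\<forall>y<reg s 1. arr (den (clear d) s) d y = 0"
    unfolding clear_def
    by (rule den_for[where I = "\<lambda>i t. \<forall>y<i. arr t d y = 0" and n = "reg s 1"]) (auto simp: less_Suc_eq)
  then show ?thesis using y by blast
qed

context edge_table
begin

lemma mark_neighbours:
  assumes t: "table_state n es s" and d: "d \<noteq> 1" "d \<noteq> 2" "d \<noteq> k" and r: "r \<noteq> 5"
  shows "\<forall>y<n. arr (den (mark_neighbours k r d) s) d y \<noteq> 0 \<longleftrightarrow> y \<in> nbrs (edge_set es (arr s k)) (reg s r)"
proof -
  define v f where "v = reg s r" and "f = arr s k"
  define s1 where "s1 = den (clear d) s"
  define I where "I = (\<lambda>i t. table_state n es t \<and> reg t r = v \<and> arr t k = f \<and>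
    (\<forall>y<n. arr t d y \<noteq> 0 \<longleftrightarrow> (\<exists>j<i. f j \<noteq> 0 \<and> {v, y} = edge (es ! j))))"
  have s1: "table_state n es s1" "reg s1 r = v" "arr s1 k = f" "\<forall>y<n. arr s1 d y = 0"
    unfolding s1_def v_def f_def
    using t d r clear_zero[of _ s d] table_stateD(1)[OF t]
    by (auto simp: clear_def reg_den arr_den simp del: den.simps intro!: table_state_den)
  have body: "I (Suc i) (den (Cond (Equal (Arr k (Reg 5)) (Const 0)) Nop
       (Cond (Equal (Arr 1 (Reg 5)) (Reg r)) (Write d (Arr 2 (Reg 5)) (Const 1)) Nop ;;
        Cond (Equal (Arr 2 (Reg 5)) (Reg r)) (Write d (Arr 1 (Reg 5)) (Const 1)) Nop)) (set_reg 5 i t))"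
    if i: "i < length es" and I: "I i t" for i t
  proof -
    have T: "table_state n es t" "reg t r = v" "arr t k = f"
      "\<And>y. y < n \<Longrightarrow> arr t d y \<noteq> 0 \<longleftrightarrow> (\<exists>j<i. f j \<noteq> 0 \<and> {v, y} = edge (es ! j))"
      using I unfolding I_def by auto
    define a b where "a = fst (es ! i)" and "b = snd (es ! i)"
    have ab: "arr t 1 i = a" "arr t 2 i = b" "a \<noteq> b"
      using table_stateD(4,6)[OF T(1) i] irrefl_nth[OF i] unfolding a_def b_def by auto
    define t' where "t' = den (Cond (Equal (Arr k (Reg 5)) (Const 0)) Nop
       (Cond (Equal (Arr 1 (Reg 5)) (Reg r)) (Write d (Arr 2 (Reg 5)) (Const 1)) Nop ;;
        Cond (Equal (Arr 2 (Reg 5)) (Reg r)) (Write d (Arr 1 (Reg 5)) (Const 1)) Nop)) (set_reg 5 i t)"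
    have T': "reg t' = (reg t)(5 := i) \<and> (\<forall>q. q \<noteq> d \<longrightarrow> arr t' q = arr t q) \<and>
      (\<forall>y. arr t' d y = (if f i \<noteq> 0 \<and> (a = v \<and> y = b \<or> b = v \<and> y = a) then 1 else arr t d y))"
    proof (cases "f i = 0")
      case True then show ?thesis unfolding t'_def using T(3) by simp
    next
      case False
      then show ?thesis unfolding t'_def using T(2,3) ab d r
        by (cases "a = v"; cases "b = v") simp_all
    qed
    have "table_state n es t'" by (rule table_state_cong[OF T(1)]) (use T' d in simp_all)
    moreover have "reg t' r = v" "arr t' k = f" using T' T(2,3) d r by simp_all
    moreover have "arr t' d y \<noteq> 0 \<longleftrightarrow> (\<exists>j<Suc i. f j \<noteq> 0 \<and> {v, y} = edge (es ! j))" if "y < n" for y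
    proof -
      have "{v, y} = edge (es ! i) \<longleftrightarrow> a = v \<and> y = b \<or> b = v \<and> y = a"
        unfolding a_def b_def doubleton_eq_iff by blast
      moreover have "arr t' d y = (if f i \<noteq> 0 \<and> (a = v \<and> y = b \<or> b = v \<and> y = a) then 1 else arr t d y)"
        using T' by blast
      ultimately have "arr t' d y \<noteq> 0 \<longleftrightarrow> arr t d y \<noteq> 0 \<or> f i \<noteq> 0 \<and> {v, y} = edge (es ! i)"
        by (cases "f i \<noteq> 0 \<and> (a = v \<and> y = b \<or> b = v \<and> y = a)") auto
      then show ?thesis unfolding ex_less_Suc T(4)[OF that] .
    qed
    ultimately show ?thesis unfolding I_def t'_def[symmetric] by blast
  qed
  have "I 0 s1" using s1 unfolding I_def by auto
  then have "\<forall>y<n. arr (den (mark_neighbours k r d) s) d y \<noteq> 0 \<longleftrightarrow>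
    (\<exists>j<length es. f j \<noteq> 0 \<and> {v, y} = edge (es ! j))"
    unfolding mark_neighbours_def den.simps(6) s1_def[symmetric]
    by (rule den_for[where I = I and n = "length es"])
      (use body s1 table_stateD(3)[OF s1(1)] in \<open>auto simp: I_def\<close>)
  then show ?thesis unfolding nbrs_def edge_set_def v_def f_def by auto
qed

end

subsection \<open>Testing whether an edge can be added\<close>

text \<open>Arrays 6 and 7 mark the neighbourhoods of the two ends. A vertex marked in both is a
  common neighbour and must not be entered.\<close>

definition relax :: "nat \<Rightarrow> nat \<Rightarrow> acom" where
  "relax x y = Cond (Equal (Arr 5 (Arr x (Reg 5))) (Const 0)) Nop
     (Cond (Equal (Arr 6 (Arr y (Reg 5))) (Const 0)) (Write 5 (Arr y (Reg 5)) (Const 1))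
       (Cond (Equal (Arr 7 (Arr y (Reg 5))) (Const 0)) (Write 5 (Arr y (Reg 5)) (Const 1)) Nop))"

definition search_round :: acom where
  "search_round = For 5 2 (Cond (Equal (Arr 3 (Reg 5)) (Const 0)) Nop (relax 1 2 ;; relax 2 1))"

text \<open>In the manner of Bellman and Ford: n rounds over all edges reach every vertex on a path,
  without adjacency lists or a queue.\<close>

definition search :: acom where
  "search = mark_neighbours 3 8 6 ;; mark_neighbours 3 9 7 ;; clear 5 ;;
     Write 5 (Reg 8) (Const 1) ;; For 10 1 search_round"

context edge_table
begin

definition search_inv :: "(nat \<Rightarrow> nat) \<Rightarrow> nat set \<Rightarrow> nat \<Rightarrow> astate \<Rightarrow> bool" where
  "search_inv f B u s \<longleftrightarrow> table_state n es s \<and> arr s 3 = f \<and>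
     (\<forall>y<n. y \<in> B \<longleftrightarrow> arr s 6 y \<noteq> 0 \<and> arr s 7 y \<noteq> 0) \<and>
     (\<forall>y<n. arr s 5 y \<noteq> 0 \<longrightarrow> reach (edge_set es f) B u y)"

lemma relax:
  assumes I: "search_inv f B u s" and e: "reg s 5 = i" "i < length es" "f i \<noteq> 0"
    and xy: "x = 1 \<and> y = 2 \<and> a = fst (es ! i) \<and> b = snd (es ! i) \<or> x = 2 \<and> y = 1 \<and> a = snd (es ! i) \<and> b = fst (es ! i)"
  shows "search_inv f B u (den (relax x y) s)" "reg (den (relax x y) s) = reg s"
    "\<And>z. arr s 5 z \<noteq> 0 \<Longrightarrow> arr (den (relax x y) s) 5 z \<noteq> 0"
    "arr s 5 a \<noteq> 0 \<Longrightarrow> b \<notin> B \<Longrightarrow> arr (den (relax x y) s) 5 b \<noteq> 0"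
proof -
  have T: "table_state n es s" "arr s 3 = f" "\<And>y. y < n \<Longrightarrow> y \<in> B \<longleftrightarrow> arr s 6 y \<noteq> 0 \<and> arr s 7 y \<noteq> 0"
    "\<And>y. y < n \<Longrightarrow> arr s 5 y \<noteq> 0 \<Longrightarrow> reach (edge_set es f) B u y"
    using I unfolding search_inv_def by auto
  have ab: "arr s x i = a" "arr s y i = b" "x \<noteq> 5" "y \<noteq> 5" using xy table_stateD(4,6)[OF T(1) e(2)] by auto
  have abn: "a < n" "b < n" using xy range_nth[OF e(2)] by auto
  have abF: "{a, b} \<in> edge_set es f"
    using xy edge_in_edge_set[OF e(2), of f] e(3) by (auto simp: insert_commute)
  have D: "den (relax x y) s = (if arr s 5 a \<noteq> 0 \<and> b \<notin> B then s\<lparr>arr := (arr s)(5 := (arr s 5)(b := 1))\<rparr> else s)"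
    unfolding relax_def using ab e(1) T(3)[OF abn(2)] by auto
  show "search_inv f B u (den (relax x y) s)"
  proof (cases "arr s 5 a \<noteq> 0 \<and> b \<notin> B")
    case True
    have "reach (edge_set es f) B u b" using True reach_step[OF T(4)[OF abn(1)] abF] by blast
    then show ?thesis unfolding D using True T unfolding search_inv_def
      by (auto intro: table_state_cong)
  qed (use I D in auto)
  show "reg (den (relax x y) s) = reg s" "\<And>z. arr s 5 z \<noteq> 0 \<Longrightarrow> arr (den (relax x y) s) 5 z \<noteq> 0"
    "arr s 5 a \<noteq> 0 \<Longrightarrow> b \<notin> B \<Longrightarrow> arr (den (relax x y) s) 5 b \<noteq> 0"
    unfolding D by auto
qed

text \<open>Progress is measured from the marks at the beginning of the round. Marks set during the
  round may spread further, which is harmless since every mark is sound by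
  \<open>search_inv\<close>.\<close>

lemma search_round:
  assumes I: "search_inv f B u s"
  shows "search_inv f B u (den search_round s) \<and>
    (\<forall>z. arr s 5 z \<noteq> 0 \<longrightarrow> arr (den search_round s) 5 z \<noteq> 0) \<and>
    (\<forall>a b. {a, b} \<in> edge_set es f \<longrightarrow> arr s 5 a \<noteq> 0 \<longrightarrow> b \<notin> B \<longrightarrow> arr (den search_round s) 5 b \<noteq> 0)"
proof -
  define m where "m = arr s 5"
  define J where "J = (\<lambda>i t. search_inv f B u t \<and> (\<forall>z. m z \<noteq> 0 \<longrightarrow> arr t 5 z \<noteq> 0) \<and>
    (\<forall>j<i. f j \<noteq> 0 \<longrightarrow> (m (fst (es ! j)) \<noteq> 0 \<longrightarrow> snd (es ! j) \<notin> B \<longrightarrow> arr t 5 (snd (es ! j)) \<noteq> 0) \<and>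
       (m (snd (es ! j)) \<noteq> 0 \<longrightarrow> fst (es ! j) \<notin> B \<longrightarrow> arr t 5 (fst (es ! j)) \<noteq> 0)))"
  have body: "J (Suc i) (den (Cond (Equal (Arr 3 (Reg 5)) (Const 0)) Nop (relax 1 2 ;; relax 2 1)) (set_reg 5 i t))"
    if i: "i < length es" and J: "J i t" for i t
  proof -
    define t0 where "t0 = set_reg 5 i t"
    have t0: "search_inv f B u t0" "reg t0 5 = i" "arr t0 = arr t" "arr t 3 = f"
      using J unfolding J_def search_inv_def t0_def by (auto intro: table_state_set_reg)
    show ?thesis
    proof (cases "f i = 0")
      case True
      then show ?thesis using J t0 unfolding t0_def[symmetric] J_def by (auto simp: less_Suc_eq)
    next
      case False
      define t1 where "t1 = den (relax 1 2) t0"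
      define t2 where "t2 = den (relax 2 1) t1"
      have xy: "1 = (1::nat) \<and> 2 = (2::nat) \<and> fst (es ! i) = fst (es ! i) \<and> snd (es ! i) = snd (es ! i) \<or>
          1 = (2::nat) \<and> 2 = (1::nat) \<and> fst (es ! i) = snd (es ! i) \<and> snd (es ! i) = fst (es ! i)"
        "2 = (1::nat) \<and> 1 = (2::nat) \<and> snd (es ! i) = fst (es ! i) \<and> fst (es ! i) = snd (es ! i) \<or>
          2 = (2::nat) \<and> 1 = (1::nat) \<and> snd (es ! i) = snd (es ! i) \<and> fst (es ! i) = fst (es ! i)"
        by simp_all
      note r1 = relax[OF t0(1,2) i False xy(1), folded t1_def]
      have "reg t1 5 = i" using r1(2) t0(2) by simp
      note r2 = relax[OF r1(1) this i False xy(2), folded t2_def]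
      have D: "den (Cond (Equal (Arr 3 (Reg 5)) (Const 0)) Nop (relax 1 2 ;; relax 2 1)) t0 = t2"
        unfolding t1_def t2_def using t0 False by simp
      have mono: "arr t 5 z \<noteq> 0 \<Longrightarrow> arr t2 5 z \<noteq> 0" for z
        using r1(3) r2(3) t0(3) by metis
      have "m (fst (es ! i)) \<noteq> 0 \<longrightarrow> snd (es ! i) \<notin> B \<longrightarrow> arr t2 5 (snd (es ! i)) \<noteq> 0"
        using r1(4) r2(3) t0(3) J unfolding J_def by metis
      moreover have "m (snd (es ! i)) \<noteq> 0 \<longrightarrow> fst (es ! i) \<notin> B \<longrightarrow> arr t2 5 (fst (es ! i)) \<noteq> 0"
        using r1(3) r2(4) t0(3) J unfolding J_def by metis
      ultimately show ?thesis unfolding t0_def[symmetric] D using J mono r2(1)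
        unfolding J_def less_Suc_eq by blast
    qed
  qed
  have J0: "J 0 s" using I unfolding J_def m_def by simp
  have J1: "J (length es) (set_reg 5 (length es) t)" if "J (length es) t" for t
    using that unfolding J_def search_inv_def by (auto intro: table_state_set_reg)
  have m2: "reg s 2 = length es" using I unfolding search_inv_def by (auto dest: table_stateD(3))
  have J: "J (length es) (den search_round s)"
    unfolding search_round_def by (rule den_for_invariant[where I = J, OF J0 body m2 J1])
  have "arr (den search_round s) 5 b \<noteq> 0" if ab: "{a, b} \<in> edge_set es f" "m a \<noteq> 0" "b \<notin> B" for a b
  proof -
    obtain j where "j < length es" "f j \<noteq> 0" "{a, b} = edge (es ! j)" using ab(1) unfolding edge_set_def by blast
    then show ?thesis using J ab(2,3) unfolding J_def doubleton_eq_iff by blast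
  qed
  then show ?thesis using J unfolding J_def m_def by blast
qed

lemma search:
  assumes t: "table_state n es s" and uv: "reg s 8 = u" "reg s 9 = v" "u < n" "v < n"
  shows "arr (den search s) 5 v = 0 \<longleftrightarrow> addable (edge_set es (arr s 3)) u v"
proof -
  define f where "f = arr s 3"
  let ?F = "edge_set es f"
  let ?B = "nbrs ?F u \<inter> nbrs ?F v"
  define s1 where "s1 = den (mark_neighbours 3 8 6) s"
  define s2 where "s2 = den (mark_neighbours 3 9 7) s1"
  define s3 where "s3 = den (clear 5) s2"
  define s4 where "s4 = den (Write 5 (Reg 8) (Const 1)) s3"
  note frame = mark_neighbours_def clear_def reg_den arr_den
  have s1: "table_state n es s1" "reg s1 9 = v" "reg s1 8 = u" "arr s1 3 = f" unfolding s1_def f_def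
    using uv by (auto simp: frame simp del: den.simps intro!: table_state_den[OF t])
  have 6: "\<forall>y<n. arr s1 6 y \<noteq> 0 \<longleftrightarrow> y \<in> nbrs ?F u"
    using mark_neighbours[OF t, of 6 3 8] uv unfolding s1_def f_def by simp
  have s2: "table_state n es s2" "reg s2 8 = u" "arr s2 3 = f" "arr s2 6 = arr s1 6" unfolding s2_def
    using s1 by (auto simp: frame simp del: den.simps intro!: table_state_den[OF s1(1)])
  have 7: "\<forall>y<n. arr s2 7 y \<noteq> 0 \<longleftrightarrow> y \<in> nbrs ?F v"
    using mark_neighbours[OF s1(1), of 7 3 9] s1 unfolding s2_def by simp
  have s3: "table_state n es s3" "reg s3 8 = u" "arr s3 3 = f" "arr s3 6 = arr s1 6" "arr s3 7 = arr s2 7"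
    unfolding s3_def using s2 by (auto simp: frame simp del: den.simps intro!: table_state_den[OF s2(1)])
  have 5: "\<forall>y<n. arr s3 5 y = 0" using clear_zero[of _ s2 5] table_stateD(1)[OF s2(1)] unfolding s3_def by simp
  have s4: "search_inv f ?B u s4" "arr s4 5 u \<noteq> 0"
    unfolding s4_def search_inv_def using s3 5 6 7 by (auto intro: table_state_cong[OF s3(1)])
  have D: "den search s = den (For 10 1 search_round) s4"
    unfolding search_def s4_def s3_def s2_def s1_def by simp
  \<comment> \<open>Along a fixed path, i rounds mark at least the first i + 1 vertices. The
    invariant also contains soundness, which is extracted below with the trivial path
    \<open>[u]\<close>.\<close>
  have main: "search_inv f ?B u (den search s) \<and> (\<forall>k. k < length ps \<longrightarrow> k \<le> n \<longrightarrow> arr (den search s) 5 (ps ! k) \<noteq> 0)"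
    if ps: "ps ! 0 = u" "\<forall>k. Suc k < length ps \<longrightarrow> {ps ! k, ps ! Suc k} \<in> ?F"
      "\<forall>k. 0 < k \<longrightarrow> k < length ps \<longrightarrow> ps ! k \<notin> ?B" for ps
  proof -
    define I where "I = (\<lambda>i t. search_inv f ?B u t \<and> (\<forall>k. k < length ps \<longrightarrow> k \<le> i \<longrightarrow> arr t 5 (ps ! k) \<noteq> 0))"
    have I0: "I 0 s4" using s4 ps(1) unfolding I_def by simp
    have step: "I (Suc i) (den search_round (set_reg 10 i t))" if "I i t" for i t
    proof -
      have inv: "search_inv f ?B u (set_reg 10 i t)"
        using that unfolding I_def search_inv_def by (auto intro: table_state_set_reg)
      note r = search_round[OF inv]
      have "arr (den search_round (set_reg 10 i t)) 5 (ps ! k) \<noteq> 0" if k: "k < length ps" "k \<le> Suc i" for k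
      proof (cases "k \<le> i")
        case True
        then have "arr t 5 (ps ! k) \<noteq> 0" using \<open>I i t\<close> k unfolding I_def by blast
        then show ?thesis using r by simp
      next
        case False
        then have ki: "k = Suc i" using k by simp
        then have "arr t 5 (ps ! i) \<noteq> 0" using \<open>I i t\<close> k unfolding I_def by simp
        moreover have "{ps ! i, ps ! k} \<in> ?F" "ps ! k \<notin> ?B" using ps(2,3) k ki by auto
        ultimately show ?thesis using r by simp
      qed
      then show ?thesis using r unfolding I_def by blast
    qed
    have n1: "reg s4 1 = n" using s4(1) unfolding search_inv_def by (auto dest: table_stateD(1))
    have I1: "I n (set_reg 10 n t)" if "I n t" for t
      using that unfolding I_def search_inv_def by (auto intro: table_state_set_reg)
    have "I n (den search s)" unfolding D by (rule den_for_invariant[where I = I, OF I0 step n1 I1])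
    then show ?thesis unfolding I_def .
  qed
  have "arr (den search s) 5 v \<noteq> 0 \<longleftrightarrow> reach ?F ?B u v"
  proof
    assume "arr (den search s) 5 v \<noteq> 0"
    then show "reach ?F ?B u v" using main[of "[u]"] uv(4) unfolding search_inv_def by simp
  next
    assume ruv: "reach ?F ?B u v"
    obtain ps where ps: "induced_path ?F ps" "ps ! 0 = u" "ps ! (length ps - 1) = v"
      "\<forall>i. 0 < i \<longrightarrow> i < length ps \<longrightarrow> ps ! i \<notin> ?B"
      using reach_induced_path[OF ruv] by (elim exE conjE)
    have e: "\<forall>k. Suc k < length ps \<longrightarrow> {ps ! k, ps ! Suc k} \<in> ?F" and d: "distinct ps" "ps \<noteq> []"
      using ps(1) unfolding induced_path_def by auto
    have "ps ! k < n" if "k < length ps" for k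
    proof (cases k)
      case 0 then show ?thesis using ps(2) uv(3) by simp
    next
      case (Suc j)
      then have "{ps ! j, ps ! k} \<in> ?F" using e that by blast
      then show ?thesis using edge_in_range by blast
    qed
    \<comment> \<open>An induced path has distinct vertices, so n rounds suffice to reach its
      end.\<close>
    then have "set ps \<subseteq> {..<n}" by (auto simp: in_set_conv_nth)
    then have "card (set ps) \<le> n" using card_mono[of "{..<n}" "set ps"] by simp
    then have "length ps - 1 \<le> n" using distinct_card[OF d(1)] by simp
    moreover have "length ps - 1 < length ps" using d(2) by simp
    ultimately show "arr (den search s) 5 v \<noteq> 0" using main[OF ps(2) e ps(4)] ps(3) by blast
  qed
  then show ?thesis unfolding addable_def f_def by blast
qed

end

subsection \<open>Completion and attachment\<close>

definition try_prog :: acom where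
  "try_prog = Cond (Equal (Arr 3 (Reg 11)) (Const 0))
     (Assign 8 (Arr 1 (Reg 11)) ;; Assign 9 (Arr 2 (Reg 11)) ;; search ;;
      Cond (Equal (Arr 5 (Reg 9)) (Const 0)) (Write 3 (Reg 11) (Const 1)) Nop) Nop"

definition complete_prog :: acom where
  "complete_prog = For 12 2 (For 11 2 try_prog)"

text \<open>Registers 13, 14 and 15 hold v, x and the index of vx. The pruning would remove vx too,
  as x is not its own neighbour, so vx is written last.\<close>

definition attach_prog :: acom where
  "attach_prog = mark_neighbours 4 14 7 ;;
     For 5 2 (Write 3 (Reg 5) (Arr 4 (Reg 5)) ;;
       Cond (Equal (Arr 1 (Reg 5)) (Reg 13))
         (Cond (Equal (Arr 7 (Arr 2 (Reg 5))) (Const 0)) (Write 3 (Reg 5) (Const 0)) Nop) Nop ;;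
       Cond (Equal (Arr 2 (Reg 5)) (Reg 13))
         (Cond (Equal (Arr 7 (Arr 1 (Reg 5))) (Const 0)) (Write 3 (Reg 5) (Const 0)) Nop) Nop) ;;
     Write 3 (Reg 15) (Const 1)"

lemma assigned_search: "assigned search = {5, 10}"
  by (auto simp: search_def search_round_def relax_def mark_neighbours_def clear_def)

lemma modified_search: "modified search = {5, 6, 7}"
  by (auto simp: search_def search_round_def relax_def mark_neighbours_def clear_def)

lemma quiet_search: "quiet search"
  by (simp add: search_def search_round_def relax_def mark_neighbours_def clear_def)

lemma assigned_complete: "assigned complete_prog = {5, 8, 9, 10, 11, 12}"
  by (auto simp: complete_prog_def try_prog_def assigned_search)

lemma modified_complete: "modified complete_prog = {3, 5, 6, 7}"
  by (auto simp: complete_prog_def try_prog_def modified_search)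

lemma quiet_complete: "quiet complete_prog"
  by (simp add: complete_prog_def try_prog_def quiet_search)

lemma assigned_attach: "assigned attach_prog = {5}"
  by (auto simp: attach_prog_def mark_neighbours_def clear_def)

lemma modified_attach: "modified attach_prog = {3, 7}"
  by (auto simp: attach_prog_def mark_neighbours_def clear_def)

lemma quiet_attach: "quiet attach_prog"
  by (simp add: attach_prog_def mark_neighbours_def clear_def)

context edge_table
begin

lemma try_prog:
  assumes t: "table_state n es s" and i: "reg s 11 = i" "i < length es"
  shows "edge_set es (arr (den try_prog s) 3) = try_edge (es ! i) (edge_set es (arr s 3))"
    "table_state n es (den try_prog s)"
proof -
  show "table_state n es (den try_prog s)"
    by (rule table_state_den[OF t]) (auto simp: try_prog_def assigned_search modified_search)
  let ?F = "edge_set es (arr s 3)"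
  have e: "arr s 3 i = 0 \<longleftrightarrow> edge (es ! i) \<notin> ?F" using edge_in_edge_set[OF i(2)] by simp
  show "edge_set es (arr (den try_prog s) 3) = try_edge (es ! i) ?F"
  proof (cases "arr s 3 i = 0")
    case False
    then have "den try_prog s = s" unfolding try_prog_def using i by simp
    then show ?thesis using False e unfolding try_edge_def by simp
  next
    case True
    define s1 where "s1 = den (Assign 8 (Arr 1 (Reg 11)) ;; Assign 9 (Arr 2 (Reg 11))) s"
    define s2 where "s2 = den search s1"
    have s1: "reg s1 8 = fst (es ! i)" "reg s1 9 = snd (es ! i)" "reg s1 11 = i" "arr s1 = arr s"
      unfolding s1_def using i table_stateD(4,6)[OF t i(2)] by simp_all
    have t1: "table_state n es s1" unfolding s1_def by (rule table_state_den[OF t]) auto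
    have s2: "reg s2 9 = snd (es ! i)" "reg s2 11 = i" "arr s2 3 = arr s 3"
      unfolding s2_def using s1 by (simp_all add: reg_den arr_den assigned_search modified_search)
    have m: "arr s2 5 (snd (es ! i)) = 0 \<longleftrightarrow> addable ?F (fst (es ! i)) (snd (es ! i))"
      using search[OF t1 s1(1,2) range_nth[OF i(2)]] s1(4) unfolding s2_def by simp
    have D: "den try_prog s = den (Cond (Equal (Arr 5 (Reg 9)) (Const 0)) (Write 3 (Reg 11) (Const 1)) Nop) s2"
      unfolding try_prog_def s2_def s1_def using True i by simp
    have "arr (den try_prog s) 3 = (if addable ?F (fst (es ! i)) (snd (es ! i)) then (arr s 3)(i := Suc 0) else arr s 3)"
      unfolding D using s2 m by simp
    then show ?thesis using True e edge_set_upd1[OF i(2)] unfolding try_edge_def by simp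
  qed
qed

lemma complete_prog:
  assumes t: "table_state n es s"
  shows "edge_set es (arr (den complete_prog s) 3) = complete es (edge_set es (arr s 3))"
proof -
  let ?m = "length es"
  let ?F = "edge_set es (arr s 3)"
  have pass: "table_state n es (den (For 11 2 try_prog) s) \<and>
    edge_set es (arr (den (For 11 2 try_prog) s) 3) = fold try_edge es (edge_set es (arr s 3))"
    if t: "table_state n es s" for s
  proof -
    define I where "I = (\<lambda>i t. table_state n es t \<and> edge_set es (arr t 3) = fold try_edge (take i es) (edge_set es (arr s 3)))"
    have I0: "I 0 s" using t unfolding I_def by simp
    have step: "I (Suc i) (den try_prog (set_reg 11 i t))" if i: "i < ?m" and I: "I i t" for i t
    proof -
      have T: "table_state n es (set_reg 11 i t)" "reg (set_reg 11 i t) 11 = i" "arr (set_reg 11 i t) = arr t"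
        using I unfolding I_def by (simp_all add: table_state_set_reg)
      show ?thesis using try_prog[OF T(1,2) i] I i unfolding I_def T(3)
        by (simp add: take_Suc_conv_app_nth)
    qed
    have fin: "I ?m (set_reg 11 ?m t)" if "I ?m t" for t
      using that unfolding I_def by (simp add: table_state_set_reg)
    have "I ?m (den (For 11 2 try_prog) s)"
      by (rule den_for_invariant[where I = I, OF I0 step table_stateD(3)[OF t] fin])
    then show ?thesis unfolding I_def by simp
  qed
  define I where "I = (\<lambda>i t. table_state n es t \<and> edge_set es (arr t 3) = (fold try_edge es ^^ i) ?F)"
  have I0: "I 0 s" using t unfolding I_def by simp
  have step: "I (Suc i) (den (For 11 2 try_prog) (set_reg 12 i t))" if I: "I i t" for i t
  proof -
    have T: "table_state n es (set_reg 12 i t)" "arr (set_reg 12 i t) = arr t"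
      using I unfolding I_def by (simp_all add: table_state_set_reg)
    show ?thesis using pass[OF T(1)] I unfolding I_def T(2) by simp
  qed
  have fin: "I ?m (set_reg 12 ?m t)" if "I ?m t" for t
    using that unfolding I_def by (simp add: table_state_set_reg)
  have "I ?m (den complete_prog s)" unfolding complete_prog_def
    by (rule den_for_invariant[where I = I, OF I0 step table_stateD(3)[OF t] fin])
  then show ?thesis unfolding I_def complete_def by simp
qed

lemma attach_prog:
  assumes t: "table_state n es s" and q: "reg s 15 = q" "q < length es" "edge (es ! q) = {v, x}"
    and vx: "reg s 13 = v" "reg s 14 = x"
  shows "edge_set es (arr (den attach_prog s) 3) = attach (edge_set es (arr s 4)) v x"
proof -
  let ?m = "length es"
  define f where "f = arr s 4"
  let ?S = "edge_set es f"
  define s1 where "s1 = den (mark_neighbours 4 14 7) s"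
  note frame = mark_neighbours_def clear_def reg_den arr_den
  have s1: "table_state n es s1" "arr s1 4 = f" "reg s1 13 = v" "reg s1 15 = q"
    unfolding s1_def f_def using q vx
    by (auto simp: frame simp del: den.simps intro!: table_state_den[OF t])
  have N: "\<forall>y<n. arr s1 7 y \<noteq> 0 \<longleftrightarrow> y \<in> nbrs ?S x"
    using mark_neighbours[OF t, of 7 4 14] vx unfolding s1_def f_def by simp
  define keep where "keep = (\<lambda>j. f j \<noteq> 0 \<and> (fst (es ! j) = v \<longrightarrow> snd (es ! j) \<in> nbrs ?S x) \<and>
    (snd (es ! j) = v \<longrightarrow> fst (es ! j) \<in> nbrs ?S x))"
  define body where "body = Write 3 (Reg 5) (Arr 4 (Reg 5)) ;;
       Cond (Equal (Arr 1 (Reg 5)) (Reg 13))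
         (Cond (Equal (Arr 7 (Arr 2 (Reg 5))) (Const 0)) (Write 3 (Reg 5) (Const 0)) Nop) Nop ;;
       Cond (Equal (Arr 2 (Reg 5)) (Reg 13))
         (Cond (Equal (Arr 7 (Arr 1 (Reg 5))) (Const 0)) (Write 3 (Reg 5) (Const 0)) Nop) Nop"
  define I where "I = (\<lambda>i t. table_state n es t \<and> arr t 4 = f \<and> arr t 7 = arr s1 7 \<and> reg t 13 = v \<and> reg t 15 = q \<and>
    (\<forall>j<i. arr t 3 j \<noteq> 0 \<longleftrightarrow> keep j))"
  have I0: "I 0 s1" using s1 unfolding I_def by simp
  have step: "I (Suc i) (den body (set_reg 5 i t))" if i: "i < ?m" and I: "I i t" for i t
  proof -
    have T: "table_state n es t" "arr t 4 = f" "arr t 7 = arr s1 7" "reg t 13 = v" "reg t 15 = q"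
      "\<forall>j<i. arr t 3 j \<noteq> 0 \<longleftrightarrow> keep j" using I unfolding I_def by auto
    define a b where "a = fst (es ! i)" and "b = snd (es ! i)"
    have ab: "arr t 1 i = a" "arr t (Suc 0) i = a" "arr t 2 i = b"
      using table_stateD(4,5,6)[OF T(1) i] unfolding a_def b_def by auto
    have Nab: "arr t 7 a \<noteq> 0 \<longleftrightarrow> a \<in> nbrs ?S x" "arr t 7 b \<noteq> 0 \<longleftrightarrow> b \<in> nbrs ?S x"
      using N range_nth[OF i] T(3) unfolding a_def b_def by auto
    define t' where "t' = den body (set_reg 5 i t)"
    have "arr t' 3 = (arr t 3)(i := if (a = v \<and> arr t 7 b = 0) \<or> (b = v \<and> arr t 7 a = 0) then 0 else f i)"
      unfolding t'_def body_def using T(2,4) ab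
      by (cases "a = v"; cases "b = v"; cases "arr t 7 a = 0"; cases "arr t 7 b = 0") simp_all
    then have "arr t' 3 j \<noteq> 0 \<longleftrightarrow> keep j" if "j < Suc i" for j
      using T(6) that Nab unfolding keep_def a_def[symmetric] b_def[symmetric]
      by (cases "j = i") (auto simp: less_Suc_eq a_def b_def)
    moreover have "table_state n es t'" "arr t' 4 = f" "arr t' 7 = arr s1 7" "reg t' 13 = v" "reg t' 15 = q"
      using T unfolding t'_def body_def
      by (auto simp: reg_den arr_den simp del: den.simps intro!: table_state_den table_state_set_reg)
    ultimately show ?thesis unfolding I_def t'_def[symmetric] by blast
  qed
  have fin: "I ?m (set_reg 5 ?m t)" if "I ?m t" for t
    using that unfolding I_def by (simp add: table_state_set_reg)
  define s2 where "s2 = den (For 5 2 body) s1"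
  have I: "I ?m s2" unfolding s2_def
    by (rule den_for_invariant[where I = I, OF I0 step table_stateD(3)[OF s1(1)] fin])
  have "den attach_prog s = den (Write 3 (Reg 15) (Const 1)) s2"
    unfolding attach_prog_def s2_def body_def s1_def by (simp only: den.simps(6))
  then have D: "arr (den attach_prog s) 3 = (arr s2 3)(q := Suc 0)"
    using I unfolding I_def by simp
  have sub: "?S \<subseteq> edge ` set es" by (rule edge_set_subset)
  show ?thesis unfolding D f_def[symmetric]
  proof (rule edge_set_eqI)
    have "{v, x} \<in> edge ` set es" using imageI[OF nth_mem[OF q(2)], of edge] q(3) by simp
    then show "attach ?S v x \<subseteq> edge ` set es" by (rule attach_subset[OF sub])
  next
    fix j assume j: "j < ?m"
    have vx: "v \<noteq> x" using irrefl_nth[OF q(2)] q(3) by (auto simp: doubleton_eq_iff)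
    let ?a = "fst (es ! j)" and ?b = "snd (es ! j)"
    have S: "f j \<noteq> 0 \<longleftrightarrow> {?a, ?b} \<in> ?S" using edge_in_edge_set[OF j] by blast
    have e: "{?a, ?b} = {v, x} \<longleftrightarrow> j = q" using edge_inj[OF j q(2)] q(3) by simp
    show "((arr s2 3)(q := Suc 0)) j \<noteq> 0 \<longleftrightarrow> {?a, ?b} \<in> attach ?S v x"
    proof (cases "j = q")
      case True
      then show ?thesis using e unfolding attach_def by auto
    next
      case False
      then have "((arr s2 3)(q := Suc 0)) j \<noteq> 0 \<longleftrightarrow> keep j" using I j unfolding I_def by simp
      also have "\<dots> \<longleftrightarrow> {?a, ?b} \<in> attach ?S v x"
      proof (cases "v \<in> {?a, ?b}")
        case True
        then obtain y where y: "{?a, ?b} = {v, y}" "(?a = v \<and> ?b = y) \<or> (?b = v \<and> ?a = y)" by auto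
        have "y \<noteq> x" using y(1) e False by auto
        have "y \<noteq> v" using y(2) irrefl_nth[OF j] by auto
        have "keep j \<longleftrightarrow> {v, y} \<in> ?S \<and> y \<in> nbrs ?S x"
          unfolding keep_def using y(2) S y(1) \<open>y \<noteq> v\<close> by auto
        also have "\<dots> \<longleftrightarrow> {v, y} \<in> attach ?S v x" using attach_at[OF vx, of y ?S] \<open>y \<noteq> x\<close> unfolding nbrs_def by auto
        finally show ?thesis unfolding y(1) .
      next
        case False
        then show ?thesis using attach_away[of v "{?a, ?b}" ?S x] S unfolding keep_def by auto
      qed
      finally show ?thesis .
    qed
  qed
qed

end

subsection \<open>Enumerating the neighbours\<close>

text \<open>The consumer c receives each neighbour in array 3. Writing it out gives the neighbour
  function, inserting it into the store gives the search step.\<close>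

definition for_neighbours :: "acom \<Rightarrow> acom" where
  "for_neighbours c = For 15 2
     (Assign 13 (Arr 1 (Reg 15)) ;; Assign 14 (Arr 2 (Reg 15)) ;; attach_prog ;; complete_prog ;; c ;;
      Assign 13 (Arr 2 (Reg 15)) ;; Assign 14 (Arr 1 (Reg 15)) ;; attach_prog ;; complete_prog ;; c)"

text \<open>The invariants I of a consumer c may only depend on what the computation of a neighbour
  leaves alone.\<close>

context edge_table
begin

lemma for_neighbours:
  assumes t: "table_state n es s" and I: "I [] s"
    and c: "\<And>Ts s. table_state n es s \<Longrightarrow> I Ts s \<Longrightarrow> I (Ts @ [edge_set es (arr s 3)]) (den c s)"
    and fr: "\<And>Ts s s'. I Ts s \<Longrightarrow> (\<And>r. 15 < r \<Longrightarrow> reg s' r = reg s r) \<Longrightarrow>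
      (\<And>k. 7 < k \<Longrightarrow> arr s' k = arr s k) \<Longrightarrow> out s' = out s \<Longrightarrow> table_state n es s' \<Longrightarrow> I Ts s'"
    and ca: "assigned c \<inter> {1, 2, 15} = {}" "modified c \<inter> {1, 2, 4} = {}"
  shows "I (neighbour_list es (edge_set es (arr s 4))) (den (for_neighbours c) s)"
proof -
  let ?m = "length es"
  define f where "f = arr s 4"
  let ?S = "edge_set es f"
  define J where "J = (\<lambda>i t. table_state n es t \<and> arr t 4 = f \<and> I (concat (map (\<lambda>(u, v). [complete es (attach ?S u v), complete es (attach ?S v u)]) (take i es))) t)"
  \<comment> \<open>One orientation of one edge; the loop body does this twice, with v and x
    exchanged.\<close>
  have half: "table_state n es (den c (den complete_prog (den attach_prog s1))) \<and>
     arr (den c (den complete_prog (den attach_prog s1))) 4 = f \<and>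
     reg (den c (den complete_prog (den attach_prog s1))) 15 = i \<and>
     I (Ts @ [complete es (attach ?S v x)]) (den c (den complete_prog (den attach_prog s1)))"
    if s1: "table_state n es s1" "arr s1 4 = f" "I Ts s1" "reg s1 15 = i" "i < ?m"
      "reg s1 13 = v" "reg s1 14 = x" "edge (es ! i) = {v, x}" for s1 Ts i v x
  proof -
    define s2 where "s2 = den attach_prog s1"
    define s3 where "s3 = den complete_prog s2"
    have s2: "edge_set es (arr s2 3) = attach ?S v x"
      unfolding s2_def using attach_prog[OF s1(1,4,5) s1(8) s1(6,7)] s1(2) by simp
    have t2: "table_state n es s2" unfolding s2_def
      by (rule table_state_den[OF s1(1)]) (auto simp: assigned_attach modified_attach)
    have t3: "table_state n es s3" unfolding s3_def
      by (rule table_state_den[OF t2]) (auto simp: assigned_complete modified_complete)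
    have s3: "edge_set es (arr s3 3) = complete es (attach ?S v x)"
      unfolding s3_def using complete_prog[OF t2] s2 by simp
    have f3: "arr s3 4 = f" "reg s3 15 = i" unfolding s3_def s2_def using s1
      by (simp_all add: arr_den reg_den assigned_attach modified_attach assigned_complete modified_complete)
    have "I Ts s3"
    proof (rule fr[OF s1(3)])
      show "reg s3 r = reg s1 r" if "15 < r" for r unfolding s3_def s2_def using that
        by (simp add: reg_den assigned_attach assigned_complete)
      show "arr s3 k = arr s1 k" if "7 < k" for k unfolding s3_def s2_def using that
        by (simp add: arr_den modified_attach modified_complete)
      show "out s3 = out s1" unfolding s3_def s2_def by (simp add: out_den quiet_attach quiet_complete)
    qed (rule t3)
    then have "I (Ts @ [complete es (attach ?S v x)]) (den c s3)" using c[OF t3] s3 by metis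
    moreover have "table_state n es (den c s3)" by (rule table_state_den[OF t3]) (use ca in auto)
    moreover have "arr (den c s3) 4 = f" "reg (den c s3) 15 = i" using f3 ca by (subst arr_den reg_den; blast?)+
    ultimately show ?thesis unfolding s3_def s2_def by blast
  qed
  have J0: "J 0 s" using t I unfolding J_def f_def by simp
  have step: "J (Suc i) (den (Assign 13 (Arr 1 (Reg 15)) ;; Assign 14 (Arr 2 (Reg 15)) ;; attach_prog ;; complete_prog ;; c ;;
      Assign 13 (Arr 2 (Reg 15)) ;; Assign 14 (Arr 1 (Reg 15)) ;; attach_prog ;; complete_prog ;; c) (set_reg 15 i t))"
    if i: "i < ?m" and J: "J i t" for i t
  proof -
    define Ts where "Ts = concat (map (\<lambda>(u, v). [complete es (attach ?S u v), complete es (attach ?S v u)]) (take i es))"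
    have T: "table_state n es t" "arr t 4 = f" "I Ts t" using J unfolding J_def Ts_def by auto
    obtain a b where ab: "es ! i = (a, b)" by force
    define s1 where "s1 = den (Assign 13 (Arr 1 (Reg 15)) ;; Assign 14 (Arr 2 (Reg 15))) (set_reg 15 i t)"
    have s1: "reg s1 13 = a" "reg s1 14 = b" "reg s1 15 = i" "arr s1 4 = f"
      unfolding s1_def using T table_stateD(4,5,6)[OF T(1) i] ab by simp_all
    have t1: "table_state n es s1" unfolding s1_def
      by (intro table_state_den table_state_set_reg T(1)) auto
    have I1: "I Ts s1" by (rule fr[OF T(3) _ _ _ t1]) (simp_all add: s1_def)
    define s2 where "s2 = den c (den complete_prog (den attach_prog s1))"
    have s2: "table_state n es s2" "arr s2 4 = f" "reg s2 15 = i" "I (Ts @ [complete es (attach ?S a b)]) s2"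
      using half[OF t1 s1(4) I1 s1(3) i s1(1,2)] ab unfolding s2_def by auto
    define s3 where "s3 = den (Assign 13 (Arr 2 (Reg 15)) ;; Assign 14 (Arr 1 (Reg 15))) s2"
    have s3: "reg s3 13 = b" "reg s3 14 = a" "reg s3 15 = i" "arr s3 4 = f"
      unfolding s3_def using s2 table_stateD(4,5,6)[OF s2(1) i] ab by simp_all
    have t3: "table_state n es s3" unfolding s3_def
      by (intro table_state_den s2(1)) auto
    have I3: "I (Ts @ [complete es (attach ?S a b)]) s3"
      by (rule fr[OF s2(4) _ _ _ t3]) (simp_all add: s3_def)
    define s4 where "s4 = den c (den complete_prog (den attach_prog s3))"
    have s4: "table_state n es s4" "arr s4 4 = f" "reg s4 15 = i"
      "I ((Ts @ [complete es (attach ?S a b)]) @ [complete es (attach ?S b a)]) s4"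
      using half[OF t3 s3(4) I3 s3(3) i s3(1,2)] ab unfolding s4_def by (auto simp: insert_commute)
    have "J (Suc i) s4" unfolding J_def using s4 i ab
      by (simp add: take_Suc_conv_app_nth flip: Ts_def)
    then show ?thesis unfolding s4_def s3_def s2_def s1_def by simp
  qed
  have fin: "J ?m (set_reg 15 ?m t)" if "J ?m t" for t
  proof -
    have "table_state n es (set_reg 15 ?m t)" using that unfolding J_def by (simp add: table_state_set_reg)
    then show ?thesis using that unfolding J_def by (auto intro: fr)
  qed
  have "J ?m (den (for_neighbours c) s)" unfolding for_neighbours_def
    by (rule den_for_invariant[where I = J, OF J0 step table_stateD(3)[OF t] fin])
  then show ?thesis unfolding J_def f_def neighbour_list_def by simp
qed

end

subsection \<open>Output\<close>

definition output_prog :: "nat \<Rightarrow> acom" where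
  "output_prog k = For 5 2 (Cond (Equal (Arr k (Reg 5)) (Const 0)) Nop
     (Output (Arr 1 (Reg 5)) ;; Output (Arr 2 (Reg 5)))) ;; Finish"

definition edge_set_word :: "(nat \<times> nat) list \<Rightarrow> nat set set \<Rightarrow> nat list" where
  "edge_set_word es T = concat (map (\<lambda>(u, v). [u, v]) (filter (\<lambda>p. edge p \<in> T) es))"

context edge_table
begin

lemma output_prog:
  assumes t: "table_state n es s"
  shows "out (den (output_prog k) s) = out s @ map Put (edge_set_word es (edge_set es (arr s k))) @ [Emit]"
proof -
  let ?m = "length es"
  define f where "f = arr s k"
  let ?T = "edge_set es f"
  define I where "I = (\<lambda>i t. table_state n es t \<and> arr t k = f \<and> out t = out s @ map Put (edge_set_word (take i es) ?T))"
  have I0: "I 0 s" using t unfolding I_def f_def edge_set_word_def by simp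
  have step: "I (Suc i) (den (Cond (Equal (Arr k (Reg 5)) (Const 0)) Nop
     (Output (Arr 1 (Reg 5)) ;; Output (Arr 2 (Reg 5)))) (set_reg 5 i t))" if i: "i < ?m" and I: "I i t" for i t
  proof -
    have T: "table_state n es t" "arr t k = f" "out t = out s @ map Put (edge_set_word (take i es) ?T)"
      using I unfolding I_def by auto
    define t' where "t' = den (Cond (Equal (Arr k (Reg 5)) (Const 0)) Nop
     (Output (Arr 1 (Reg 5)) ;; Output (Arr 2 (Reg 5)))) (set_reg 5 i t)"
    have w: "edge_set_word (take (Suc i) es) ?T = edge_set_word (take i es) ?T @
      (if f i \<noteq> 0 then [fst (es ! i), snd (es ! i)] else [])"
      unfolding edge_set_word_def using i edge_in_edge_set[OF i, of f]
      by (simp add: take_Suc_conv_app_nth case_prod_unfold)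
    have "out t' = out s @ map Put (edge_set_word (take (Suc i) es) ?T)"
      unfolding t'_def w using T table_stateD(4,5,6)[OF T(1) i] by simp
    moreover have "table_state n es t'" unfolding t'_def
      by (intro table_state_den table_state_set_reg T(1)) auto
    moreover have "arr t' k = f" unfolding t'_def using T(2) by simp
    ultimately show ?thesis unfolding I_def t'_def[symmetric] by blast
  qed
  have fin: "I ?m (set_reg 5 ?m t)" if "I ?m t" for t
    using that unfolding I_def by (simp add: table_state_set_reg)
  have "I ?m (den (For 5 2 (Cond (Equal (Arr k (Reg 5)) (Const 0)) Nop
     (Output (Arr 1 (Reg 5)) ;; Output (Arr 2 (Reg 5))))) s)"
    by (rule den_for_invariant[where I = I, OF I0 step table_stateD(3)[OF t] fin])
  then show ?thesis unfolding output_prog_def I_def f_def by (simp del: den.simps(8))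
qed

lemma edges_word_edge_set:
  assumes "T \<subseteq> edge ` set es" shows "edges_word T (edge_set_word es T)"
proof -
  have e: "(\<lambda>(u, v). {u, v}) = (\<lambda>p :: nat \<times> nat. edge p)" by auto
  have "map edge (filter (\<lambda>p. edge p \<in> T) es) = filter (\<lambda>e. e \<in> T) (map edge es)"
    by (simp add: filter_map comp_def)
  then have "distinct (map edge (filter (\<lambda>p. edge p \<in> T) es))" using distinct_edges by simp
  moreover have "edge ` set (filter (\<lambda>p. edge p \<in> T) es) = T" using assms by auto
  ultimately show ?thesis unfolding edges_word_def edge_set_word_def e
    by (intro exI[of _ "filter (\<lambda>p. edge p \<in> T) es"]) (simp del: set_filter)
qed

end

subsection \<open>Tries\<close>

definition trie :: "nat \<Rightarrow> (bool \<Rightarrow> nat \<Rightarrow> nat) \<Rightarrow> (nat \<Rightarrow> nat) \<Rightarrow> (nat \<Rightarrow> bool list) \<Rightarrow> bool" where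
  "trie free T L key \<longleftrightarrow> 2 \<le> free \<and> key 1 = [] \<and>
     (\<forall>c. 1 \<le> c \<longrightarrow> c < free \<longrightarrow> foldl (\<lambda>c b. T b c) 1 (key c) = c) \<and>
     (\<forall>b c. c = 0 \<or> free \<le> c \<longrightarrow> T b c = 0) \<and>
     (\<forall>c. c = 0 \<or> free \<le> c \<longrightarrow> L c = 0) \<and>
     (\<forall>b c. 1 \<le> c \<longrightarrow> c < free \<longrightarrow> T b c \<noteq> 0 \<longrightarrow> T b c < free \<and> key (T b c) = key c @ [b])"

lemma trie_walk_mono:
  assumes "\<And>b c. T b c \<noteq> 0 \<Longrightarrow> T' b c = T b c" "\<And>b. T b 0 = 0"
    "foldl (\<lambda>c b. T b c) c bs \<noteq> 0"
  shows "foldl (\<lambda>c b. T' b c) c bs = foldl (\<lambda>c b. T b c) c bs"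
  using assms(3)
proof (induction bs rule: rev_induct)
  case (snoc b bs)
  then have "foldl (\<lambda>c b. T b c) c bs \<noteq> 0" using assms(2)[of b] by auto
  then show ?case using snoc assms(1) by simp
qed simp

lemma trie_key_inj:
  assumes "trie free T L key" "1 \<le> c" "c < free" "1 \<le> d" "d < free" "key c = key d"
  shows "c = d"
proof -
  have "foldl (\<lambda>c b. T b c) 1 (key c) = c" "foldl (\<lambda>c b. T b c) 1 (key d) = d"
    using assms unfolding trie_def by blast+
  then show ?thesis using assms(6) by simp
qed

lemma trie_new_leaf:
  "trie free T L key \<Longrightarrow> 1 \<le> c \<Longrightarrow> c < free \<Longrightarrow> trie free T (L(c := x)) key"
  unfolding trie_def by auto

text \<open>Only a missing child is overwritten, and walks to existing nodes never meet one, so they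
  are unchanged.\<close>

lemma trie_new_node:
  assumes t: "trie free T L key" and c: "1 \<le> c" "c < free" "T b c = 0"
  defines "T' \<equiv> T(b := (T b)(c := free))" and "key' \<equiv> key(free := key c @ [b])"
  shows "trie (Suc free) T' L key'"
proof -
  have t': "2 \<le> free" "key 1 = []"
    "\<And>c. 1 \<le> c \<Longrightarrow> c < free \<Longrightarrow> foldl (\<lambda>c b. T b c) 1 (key c) = c"
    "\<And>b c. c = 0 \<or> free \<le> c \<Longrightarrow> T b c = 0" "\<And>c. c = 0 \<or> free \<le> c \<Longrightarrow> L c = 0"
    "\<And>b c. 1 \<le> c \<Longrightarrow> c < free \<Longrightarrow> T b c \<noteq> 0 \<Longrightarrow> T b c < free \<and> key (T b c) = key c @ [b]"
    using t unfolding trie_def by auto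
  have mono: "T' a d = T a d" if "T a d \<noteq> 0" for a d using that c(3) unfolding T'_def by auto
  have walk: "foldl (\<lambda>c b. T' b c) 1 (key d) = d" if "1 \<le> d" "d < free" for d
    using trie_walk_mono[of T T' 1 "key d"] mono t'(4) t'(3)[OF that] that(1) by simp
  show ?thesis unfolding trie_def
  proof (intro conjI allI impI)
    show "2 \<le> Suc free" using t'(1) by simp
    show "key' 1 = []" using t'(1,2) unfolding key'_def by simp
    show "foldl (\<lambda>c b. T' b c) 1 (key' d) = d" if "1 \<le> d" "d < Suc free" for d
    proof (cases "d = free")
      case True
      then show ?thesis using walk[OF c(1,2)] unfolding key'_def by (simp add: T'_def)
    next
      case False
      then show ?thesis using walk[of d] that unfolding key'_def by simp
    qed
    show "T' a d = 0" if "d = 0 \<or> Suc free \<le> d" for a d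
      using that t'(4)[of d a] c(1,2) unfolding T'_def by auto
    show "L d = 0" if "d = 0 \<or> Suc free \<le> d" for d using that t'(5)[of d] by auto
    fix a d assume d: "1 \<le> d" "d < Suc free" "T' a d \<noteq> 0"
    have "(a = b \<and> d = c) \<or> (T a d \<noteq> 0 \<and> T' a d = T a d)"
      using d(3) unfolding T'_def by (auto split: if_splits)
    then show "T' a d < Suc free" "key' (T' a d) = key' d @ [a]"
    proof -
      have "T' a d < Suc free \<and> key' (T' a d) = key' d @ [a]"
        if "T a d \<noteq> 0" "T' a d = T a d"
      proof -
        have "d < free" using that(1) t'(4)[of d a] by (meson linorder_not_less)
        then show ?thesis using t'(6)[OF d(1) _ that(1)] that unfolding key'_def by auto
      qed
      moreover have "T' a d < Suc free \<and> key' (T' a d) = key' d @ [a]" if "a = b" "d = c"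
        using that c unfolding T'_def key'_def by auto
      ultimately show "T' a d < Suc free" "key' (T' a d) = key' d @ [a]"
        using \<open>(a = b \<and> d = c) \<or> (T a d \<noteq> 0 \<and> T' a d = T a d)\<close> by blast+
    qed
  qed
qed

subsection \<open>Storing solutions\<close>

definition add_new :: "'a \<Rightarrow> 'a list \<Rightarrow> 'a list" where
  "add_new x xs = (if x \<in> set xs then xs else xs @ [x])"

lemma set_fold_add_new: "set (fold add_new ys xs) = set xs \<union> set ys"
  by (induction ys arbitrary: xs) (auto simp: add_new_def)

text \<open>Entries keep their positions, so the read position of the queue remains
  meaningful.\<close>

lemma fold_add_new_prefix: "\<exists>zs. fold add_new ys xs = xs @ zs"
proof (induction ys arbitrary: xs)
  case (Cons y ys)
  obtain zs where "fold add_new ys (add_new y xs) = add_new y xs @ zs" using Cons by blast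
  then show ?case by (cases "y \<in> set xs") (simp_all add: add_new_def[of y])
qed simp

definition descend :: "nat \<Rightarrow> acom" where
  "descend k = Cond (Equal (Arr k (Reg 16)) (Const 0))
      (Write k (Reg 16) (Reg 20) ;; Assign 20 (Succ (Reg 20))) Nop ;;
     Assign 16 (Arr k (Reg 16))"

text \<open>Missing nodes are created on the way down, so looking up and inserting are the same walk
  of m steps, however many solutions are stored. Whether the solution is new is decided at its end
  by array 10.\<close>

definition walk_prog :: acom where
  "walk_prog = Assign 16 (Const 1) ;; For 5 2 (Cond (Equal (Arr 3 (Reg 5)) (Const 0)) (descend 8) (descend 9))"

text \<open>Register 21 is the next free address and register 22 the number of entries. Both are
  kept because neither can be computed quickly from the other without multiplication.\<close>

definition enqueue :: acom where
  "enqueue = For 5 2 (Write 11 (Reg 21) (Arr 3 (Reg 5)) ;; Assign 21 (Succ (Reg 21))) ;;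
     Assign 22 (Succ (Reg 22))"

definition insert_prog :: acom where
  "insert_prog = walk_prog ;; Cond (Equal (Arr 10 (Reg 16)) (Const 0))
     (Write 10 (Reg 16) (Const 1) ;; enqueue) Nop"

lemma assigned_walk: "assigned walk_prog = {5, 16, 20}"
  by (auto simp: walk_prog_def descend_def)

lemma modified_walk: "modified walk_prog = {8, 9}"
  by (auto simp: walk_prog_def descend_def)

lemma assigned_enqueue: "assigned enqueue = {5, 21, 22}"
  by (auto simp: enqueue_def)

lemma modified_enqueue: "modified enqueue = {11}"
  by (auto simp: enqueue_def)

lemma assigned_insert: "assigned insert_prog = {5, 16, 20, 21, 22}"
  by (auto simp: insert_prog_def assigned_walk assigned_enqueue)

lemma modified_insert: "modified insert_prog = {8, 9, 10, 11}"
  by (auto simp: insert_prog_def modified_walk modified_enqueue)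

lemma quiet_insert: "quiet insert_prog"
  by (simp add: insert_prog_def walk_prog_def descend_def enqueue_def)

definition trie_state :: "astate \<Rightarrow> bool list set \<Rightarrow> (nat \<Rightarrow> bool list) \<Rightarrow> bool" where
  "trie_state s K key \<longleftrightarrow> trie (reg s 20) (\<lambda>b. arr s (if b then 9 else 8)) (arr s 10) key \<and>
     key ` {c. arr s 10 c \<noteq> 0} = K"

lemma trie_state_leaf:
  assumes "trie_state s K key" "1 \<le> c" "c < reg s 20"
  shows "arr s 10 c \<noteq> 0 \<longleftrightarrow> key c \<in> K"
proof
  assume "key c \<in> K"
  then obtain d where d: "arr s 10 d \<noteq> 0" "key d = key c" using assms(1) unfolding trie_state_def by auto
  have t: "trie (reg s 20) (\<lambda>b. arr s (if b then 9 else 8)) (arr s 10) key"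
    using assms(1) unfolding trie_state_def by blast
  then have "1 \<le> d" "d < reg s 20" using d(1) unfolding trie_def by (metis less_one linorder_not_less)+
  then show "arr s 10 c \<noteq> 0" using trie_key_inj[OF t _ _ assms(2,3) d(2)] d(1) by simp
qed (use assms in \<open>auto simp: trie_state_def\<close>)

lemma descend:
  assumes t: "trie_state s K key" and c: "reg s 16 = c" "1 \<le> c" "c < reg s 20" and k: "k = (if b then 9 else 8)"
  shows "\<exists>key'. trie_state (den (descend k) s) K key' \<and> 1 \<le> reg (den (descend k) s) 16 \<and>
     reg (den (descend k) s) 16 < reg (den (descend k) s) 20 \<and> key' (reg (den (descend k) s) 16) = key c @ [b]"
proof -
  let ?T = "\<lambda>b. arr s (if b then 9 else 8)"
  have tr: "trie (reg s 20) ?T (arr s 10) key" and K: "key ` {c. arr s 10 c \<noteq> 0} = K"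
    using t unfolding trie_state_def by auto
  show ?thesis
  proof (cases "arr s k c = 0")
    case False
    then have "den (descend k) s = set_reg 16 (arr s k c) s" unfolding descend_def using c by simp
    moreover have "arr s k c < reg s 20 \<and> key (arr s k c) = key c @ [b]"
      using tr c(2,3) False unfolding trie_def k by meson
    ultimately show ?thesis using t False unfolding trie_state_def by (intro exI[of _ key]) simp
  next
    case True
    let ?f = "reg s 20"
    let ?key = "key(?f := key c @ [b])"
    define s' where "s' = den (descend k) s"
    have k': "k = 8 \<or> k = 9" using k by auto
    have s': "reg s' 20 = Suc ?f" "reg s' 16 = ?f" "arr s' = (arr s)(k := (arr s k)(c := ?f))"
      unfolding s'_def descend_def using True c by simp_all
    have "(\<lambda>b. arr s' (if b then 9 else 8)) = ?T(b := (?T b)(c := ?f))"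
      unfolding s'(3) k by (auto simp: fun_eq_iff)
    moreover have "arr s' 10 = arr s 10" unfolding s'(3) using k' by auto
    ultimately have "trie (reg s' 20) (\<lambda>b. arr s' (if b then 9 else 8)) (arr s' 10) ?key"
      using trie_new_node[OF tr c(2,3), of b] True unfolding s'(1) k by simp
    moreover have "?key ` {c. arr s' 10 c \<noteq> 0} = K"
    proof -
      have "arr s 10 ?f = 0" using tr unfolding trie_def by blast
      then have "?key ` {c. arr s 10 c \<noteq> 0} = key ` {c. arr s 10 c \<noteq> 0}" by (intro image_cong) auto
      then show ?thesis unfolding \<open>arr s' 10 = arr s 10\<close> K .
    qed
    moreover have "1 \<le> ?f" using tr unfolding trie_def by linarith
    ultimately show ?thesis unfolding s'_def[symmetric] trie_state_def using s'(1,2)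
      by (intro exI[of _ ?key]) simp
  qed
qed

context edge_table
begin

definition bits :: "nat set set \<Rightarrow> bool list" where
  "bits T = map (\<lambda>p. edge p \<in> T) es"

lemma bits_inj: "T \<subseteq> edge ` set es \<Longrightarrow> T' \<subseteq> edge ` set es \<Longrightarrow> bits T = bits T' \<longleftrightarrow> T = T'"
  unfolding bits_def by auto

lemma walk_prog:
  assumes t: "table_state n es s" and tr: "trie_state s K key"
  defines "s' \<equiv> den walk_prog s"
  shows "\<exists>key. trie_state s' K key \<and> 1 \<le> reg s' 16 \<and> reg s' 16 < reg s' 20 \<and>
     key (reg s' 16) = bits (edge_set es (arr s 3))"
proof -
  let ?m = "length es"
  define f where "f = arr s 3"
  define bs where "bs = bits (edge_set es f)"
  define s1 where "s1 = set_reg 16 1 s"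
  define I where "I = (\<lambda>i t. table_state n es t \<and> arr t 3 = f \<and> (\<exists>key. trie_state t K key \<and>
    1 \<le> reg t 16 \<and> reg t 16 < reg t 20 \<and> key (reg t 16) = take i bs))"
  have t1: "table_state n es s1" unfolding s1_def by (rule table_state_set_reg[OF t]) simp
  have "trie_state s1 K key" using tr unfolding s1_def trie_state_def by simp
  moreover have "reg s1 16 = 1" "1 < reg s1 20" "key 1 = []"
    using tr unfolding s1_def trie_state_def trie_def by auto
  ultimately have I0: "I 0 s1" using t1 unfolding I_def by (auto simp: f_def s1_def)
  have step: "I (Suc i) (den (Cond (Equal (Arr 3 (Reg 5)) (Const 0)) (descend 8) (descend 9)) (set_reg 5 i t))"
    if i: "i < ?m" and I: "I i t" for i t
  proof -
    obtain key where T: "table_state n es t" "arr t 3 = f" "trie_state t K key"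
      "1 \<le> reg t 16" "reg t 16 < reg t 20" "key (reg t 16) = take i bs" using I unfolding I_def by auto
    define t0 where "t0 = set_reg 5 i t"
    have t0: "table_state n es t0" "arr t0 3 = f" "trie_state t0 K key" "1 \<le> reg t0 16" "reg t0 16 < reg t0 20"
      "key (reg t0 16) = take i bs" "reg t0 5 = i"
      using T unfolding t0_def trie_state_def by (simp_all add: table_state_set_reg)
    define b where "b = (f i \<noteq> 0)"
    define k :: nat where "k = (if b then 9 else 8)"
    have D: "den (Cond (Equal (Arr 3 (Reg 5)) (Const 0)) (descend 8) (descend 9)) t0 = den (descend k) t0"
      using t0 unfolding k_def b_def by simp
    obtain key' where key': "trie_state (den (descend k) t0) K key'" "1 \<le> reg (den (descend k) t0) 16"
      "reg (den (descend k) t0) 16 < reg (den (descend k) t0) 20"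
      "key' (reg (den (descend k) t0) 16) = take i bs @ [b]"
      using descend[OF t0(3) refl t0(4,5) k_def] t0(6) by auto
    have "take (Suc i) bs = take i bs @ [b]"
      using i edge_in_edge_set[OF i, of f] unfolding bs_def bits_def b_def by (simp add: take_Suc_conv_app_nth)
    moreover have "table_state n es (den (descend k) t0)" by (rule table_state_den[OF t0(1)])
        (auto simp: descend_def k_def)
    moreover have "arr (den (descend k) t0) 3 = f" using t0(2) by (subst arr_den) (auto simp: descend_def k_def)
    ultimately show ?thesis unfolding I_def t0_def[symmetric] D using key' by auto
  qed
  have fin: "I ?m (set_reg 5 ?m t)" if "I ?m t" for t
    using that unfolding I_def trie_state_def by (simp add: table_state_set_reg)
  have D: "s' = den (For 5 2 (Cond (Equal (Arr 3 (Reg 5)) (Const 0)) (descend 8) (descend 9))) s1"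
    unfolding s'_def walk_prog_def s1_def by simp
  have "I ?m s'" unfolding D
    by (rule den_for_invariant[where I = I, OF I0 step table_stateD(3)[OF t1] fin])
  then show ?thesis unfolding I_def f_def[symmetric] bs_def bits_def by auto
qed

definition queue_state :: "astate \<Rightarrow> nat set set list \<Rightarrow> bool" where
  "queue_state s Ls \<longleftrightarrow> reg s 22 = length Ls \<and> reg s 21 = length Ls * length es \<and>
     (\<forall>j<length Ls. \<forall>i<length es. arr s 11 (j * length es + i) \<noteq> 0 \<longleftrightarrow> edge (es ! i) \<in> Ls ! j)"

lemma enqueue:
  assumes t: "table_state n es s" and q: "queue_state s Ls"
  shows "queue_state (den enqueue s) (Ls @ [edge_set es (arr s 3)])"
proof -
  let ?m = "length es" and ?l = "length Ls"
  define f where "f = arr s 3"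
  define I where "I = (\<lambda>i t. table_state n es t \<and> arr t 3 = f \<and> reg t 22 = ?l \<and> reg t 21 = ?l * ?m + i \<and>
    (\<forall>a < ?l * ?m. arr t 11 a = arr s 11 a) \<and> (\<forall>j<i. arr t 11 (?l * ?m + j) = f j))"
  have I0: "I 0 s" using t q unfolding I_def f_def queue_state_def by simp
  have step: "I (Suc i) (den (Write 11 (Reg 21) (Arr 3 (Reg 5)) ;; Assign 21 (Succ (Reg 21))) (set_reg 5 i t))"
    if i: "i < ?m" and I: "I i t" for i t
  proof -
    have T: "table_state n es t" "arr t 3 = f" "reg t 22 = ?l" "reg t 21 = ?l * ?m + i"
      "\<forall>a < ?l * ?m. arr t 11 a = arr s 11 a" "\<forall>j<i. arr t 11 (?l * ?m + j) = f j" using I unfolding I_def by auto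
    define t' where "t' = den (Write 11 (Reg 21) (Arr 3 (Reg 5)) ;; Assign 21 (Succ (Reg 21))) (set_reg 5 i t)"
    have "arr t' = (arr t)(11 := (arr t 11)(?l * ?m + i := f i))" "reg t' 21 = Suc (?l * ?m + i)" "reg t' 22 = ?l"
      unfolding t'_def using T by simp_all
    moreover have "table_state n es t'" unfolding t'_def
      by (intro table_state_den table_state_set_reg T(1)) auto
    ultimately show ?thesis unfolding I_def t'_def[symmetric] using T by (auto simp: less_Suc_eq)
  qed
  have fin: "I ?m (set_reg 5 ?m t)" if "I ?m t" for t
    using that unfolding I_def by (simp add: table_state_set_reg)
  define s1 where "s1 = den (For 5 2 (Write 11 (Reg 21) (Arr 3 (Reg 5)) ;; Assign 21 (Succ (Reg 21)))) s"
  have I: "I ?m s1" unfolding s1_def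
    by (rule den_for_invariant[where I = I, OF I0 step table_stateD(3)[OF t] fin])
  have D: "den enqueue s = set_reg 22 (Suc (reg s1 22)) s1" unfolding enqueue_def s1_def by simp
  show ?thesis unfolding queue_state_def
  proof (intro conjI allI impI)
    show "reg (den enqueue s) 22 = length (Ls @ [edge_set es (arr s 3)])"
      "reg (den enqueue s) 21 = length (Ls @ [edge_set es (arr s 3)]) * ?m"
      using I unfolding D I_def by simp_all
  next
    fix j i assume j: "j < length (Ls @ [edge_set es (arr s 3)])" and i: "i < ?m"
    have a: "arr (den enqueue s) 11 = arr s1 11" unfolding D by simp
    show "arr (den enqueue s) 11 (j * ?m + i) \<noteq> 0 \<longleftrightarrow> edge (es ! i) \<in> (Ls @ [edge_set es (arr s 3)]) ! j"
    proof (cases "j = ?l")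
      case True
      then show ?thesis using I i edge_in_edge_set[OF i, of f] unfolding a I_def f_def by simp
    next
      case False
      then have j: "j < ?l" using j by simp
      have "j * ?m + i < Suc j * ?m" using i by simp
      also have "\<dots> \<le> ?l * ?m" using j by (intro mult_le_mono1) simp
      finally have "arr s1 11 (j * ?m + i) = arr s 11 (j * ?m + i)" using I unfolding I_def by blast
      then show ?thesis using q i j unfolding a queue_state_def by (simp add: nth_append)
    qed
  qed
qed

definition store_state :: "astate \<Rightarrow> nat set set list \<Rightarrow> bool" where
  "store_state s Ls \<longleftrightarrow> distinct Ls \<and> (\<forall>T \<in> set Ls. T \<subseteq> edge ` set es) \<and> queue_state s Ls \<and>
     (\<exists>key. trie_state s (bits ` set Ls) key)"

lemma store_state_cong:
  assumes "store_state s Ls" "\<And>r. r \<in> {20, 21, 22} \<Longrightarrow> reg s' r = reg s r" "\<And>k. 7 < k \<Longrightarrow> arr s' k = arr s k"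
  shows "store_state s' Ls"
  using assms unfolding store_state_def queue_state_def trie_state_def by simp

lemma insert_prog:
  assumes t: "table_state n es s" and st: "store_state s Ls"
  shows "store_state (den insert_prog s) (add_new (edge_set es (arr s 3)) Ls)"
proof -
  define T where "T = edge_set es (arr s 3)"
  define K where "K = bits ` set Ls"
  have Ls: "distinct Ls" "\<forall>T \<in> set Ls. T \<subseteq> edge ` set es" "queue_state s Ls"
    using st unfolding store_state_def by auto
  define s1 where "s1 = den walk_prog s"
  obtain key0 where key0: "trie_state s K key0" using st unfolding store_state_def K_def by (elim conjE exE)
  obtain key where key: "trie_state s1 K key" "1 \<le> reg s1 16" "reg s1 16 < reg s1 20"
    "key (reg s1 16) = bits T"
    using walk_prog[OF t key0] unfolding s1_def[symmetric] T_def[symmetric] by (elim conjE exE)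
  have t1: "table_state n es s1" unfolding s1_def
    by (rule table_state_den[OF t]) (auto simp: assigned_walk modified_walk)
  have q1: "queue_state s1 Ls" and a3: "arr s1 3 = arr s 3" using Ls(3) unfolding s1_def queue_state_def
    by (simp_all add: reg_den arr_den assigned_walk modified_walk)
  have TE: "T \<subseteq> edge ` set es" unfolding T_def by (rule edge_set_subset)
  have "bits T \<in> K \<longleftrightarrow> T \<in> set Ls" using bits_inj[OF TE] Ls(2) unfolding K_def by auto
  then have leaf: "arr s1 10 (reg s1 16) \<noteq> 0 \<longleftrightarrow> T \<in> set Ls" using trie_state_leaf[OF key(1-3)] key(4) by simp
  show ?thesis
  proof (cases "T \<in> set Ls")
    case True
    then have "den insert_prog s = s1" using leaf unfolding insert_prog_def s1_def by simp
    then show ?thesis using True Ls q1 key(1) unfolding T_def[symmetric] add_new_def store_state_def K_def by auto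
  next
    case False
    define s2 where "s2 = den (Write 10 (Reg 16) (Const 1)) s1"
    have D: "den insert_prog s = den enqueue s2" using leaf False unfolding insert_prog_def s1_def s2_def by simp
    have s2: "arr s2 = (arr s1)(10 := (arr s1 10)(reg s1 16 := 1))" "reg s2 = reg s1" unfolding s2_def by simp_all
    have "trie (reg s1 20) (\<lambda>b. arr s1 (if b then 9 else 8)) (arr s1 10) key"
      using key(1) unfolding trie_state_def by blast
    then have "trie (reg s1 20) (\<lambda>b. arr s1 (if b then 9 else 8)) ((arr s1 10)(reg s1 16 := 1)) key"
      by (intro trie_new_leaf key(2,3))
    moreover have "(\<lambda>b. arr s2 (if b then 9 else 8)) = (\<lambda>b. arr s1 (if b then 9 else 8))"
      unfolding s2 by (auto simp: fun_eq_iff)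
    moreover have "arr s2 10 = (arr s1 10)(reg s1 16 := 1)" unfolding s2 by simp
    moreover have "{c. ((arr s1 10)(reg s1 16 := 1)) c \<noteq> 0} = insert (reg s1 16) {c. arr s1 10 c \<noteq> 0}" by auto
    then have "key ` {c. ((arr s1 10)(reg s1 16 := 1)) c \<noteq> 0} = insert (bits T) K"
      using key(1,4) unfolding trie_state_def by simp
    ultimately have tr2: "trie_state s2 (insert (bits T) K) key"
      unfolding trie_state_def s2(2) by metis
    have t2: "table_state n es s2" unfolding s2_def by (rule table_state_den[OF t1]) auto
    have q2: "queue_state s2 Ls" using q1 unfolding queue_state_def s2 by simp
    have "arr s2 3 = arr s 3" unfolding s2 using a3 by simp
    then have "queue_state (den enqueue s2) (Ls @ [T])" using enqueue[OF t2 q2] unfolding T_def by simp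
    moreover have "trie_state (den enqueue s2) (insert (bits T) K) key"
      using tr2 unfolding trie_state_def by (simp add: reg_den arr_den assigned_enqueue modified_enqueue)
    ultimately show ?thesis using False Ls TE
      unfolding D T_def[symmetric] add_new_def store_state_def K_def by auto
  qed
qed

end

subsection \<open>Sorting the edges\<close>

text \<open>The neighbours of a solution may not depend on the word for the graph, but the greedy
  completion depends on the order of the edges: so they are sorted first.\<close>

definition sorted_edges :: "nat \<Rightarrow> nat set set \<Rightarrow> (nat \<times> nat) list" where
  "sorted_edges n E = concat (map (\<lambda>a. map (Pair a) (filter (\<lambda>b. a < b \<and> {a, b} \<in> E) [0..<n])) [0..<n])"

lemma set_sorted_edges: "set (sorted_edges n E) = {(a, b). a < b \<and> b < n \<and> {a, b} \<in> E}"
  unfolding sorted_edges_def by (fastforce simp: image_iff)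

lemma distinct_sorted_edges: "distinct (sorted_edges n E)"
proof -
  have "distinct (concat (map (\<lambda>a. map (Pair a) (f a)) xs))"
    if "distinct xs" "\<And>a. distinct (f a)" for xs :: "nat list" and f :: "nat \<Rightarrow> nat list"
    using that(1) by (induction xs) (auto simp: distinct_map inj_on_def that(2))
  then show ?thesis unfolding sorted_edges_def by simp
qed

lemma inj_edge_sorted: "inj_on edge {(a, b). (a::nat) < b \<and> P a b}"
  by (auto simp: inj_on_def doubleton_eq_iff)

lemma edge_table_sorted_edges: "edge_table n (sorted_edges n E)"
proof
  have "inj_on edge (set (sorted_edges n E))" unfolding set_sorted_edges
    using inj_edge_sorted[of "\<lambda>a b. b < n \<and> {a, b} \<in> E"] by simp
  then show "distinct (map edge (sorted_edges n E))" using distinct_sorted_edges by (simp add: distinct_map)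
qed (auto simp: set_sorted_edges)

lemma edge_sorted_edges:
  assumes "simple_graph E" "\<Union>E \<subseteq> {..<n}" shows "edge ` set (sorted_edges n E) = E"
proof
  show "E \<subseteq> edge ` set (sorted_edges n E)"
  proof
    fix e assume e: "e \<in> E"
    then have "card e = 2" using assms(1) unfolding simple_graph_def by blast
    then obtain a b where ab: "e = {a, b}" "a < b" by (metis card_2_iff insert_commute linorder_neqE_nat)
    then have "b < n" using e assms(2) by blast
    then have "(a, b) \<in> set (sorted_edges n E)" using ab e unfolding set_sorted_edges by simp
    then show "e \<in> edge ` set (sorted_edges n E)" using ab(1) by force
  qed
qed (auto simp: set_sorted_edges)

lemma length_sorted_edges:
  assumes "simple_graph E" "\<Union>E \<subseteq> {..<n}" shows "length (sorted_edges n E) = card E"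
proof -
  have "distinct (map edge (sorted_edges n E))" using edge_table_sorted_edges edge_table.distinct_edges by blast
  then have "card (set (map edge (sorted_edges n E))) = length (map edge (sorted_edges n E))"
    by (rule distinct_card)
  then show ?thesis using edge_sorted_edges[OF assms] by simp
qed

definition match :: "aexp \<Rightarrow> aexp \<Rightarrow> acom \<Rightarrow> acom" where
  "match e f c = Cond (Equal (Arr 0 (Reg 6)) e) (Cond (Equal (Arr 0 (Succ (Reg 6))) f) c Nop) Nop"

definition next_edge :: acom where
  "next_edge = Assign 6 (Succ (Succ (Reg 6)))"

definition push_edge :: acom where
  "push_edge = Write 1 (Reg 7) (Reg 3) ;; Write 2 (Reg 7) (Reg 4) ;; Assign 7 (Succ (Reg 7))"

definition scan_edges :: acom where
  "scan_edges = Assign 6 (Const 2) ;; For 5 2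
     (match (Reg 3) (Reg 4) push_edge ;; match (Reg 4) (Reg 3) push_edge ;; next_edge)"

text \<open>One scan of the input for every pair takes of the order of \<open>n^2 m\<close> steps;
  this stays within the bound because n is at most 2m.\<close>

definition sort_edges :: acom where
  "sort_edges = Assign 7 (Const 0) ;; For 3 1 (For 4 1 (Cond (Less (Reg 3) (Reg 4)) scan_edges Nop))"

section \<open>Correctness of the sorting\<close>

definition input_edges :: "nat \<Rightarrow> (nat \<times> nat) list \<Rightarrow> astate \<Rightarrow> bool" where
  "input_edges n ws s \<longleftrightarrow> reg s 1 = n \<and> reg s 2 = length ws \<and>
     (\<forall>i<length ws. arr s 0 (2 + 2 * i) = fst (ws ! i) \<and> arr s 0 (Suc (2 + 2 * i)) = snd (ws ! i))"

definition listed :: "(nat \<times> nat) list \<Rightarrow> astate \<Rightarrow> bool" where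
  "listed xs s \<longleftrightarrow> reg s 7 = length xs \<and>
     (\<forall>i<length xs. arr s 1 i = fst (xs ! i) \<and> arr s 2 i = snd (xs ! i))"

lemma listed_cong: "listed xs s \<Longrightarrow> reg s' 7 = reg s 7 \<Longrightarrow> arr s' 1 = arr s 1 \<Longrightarrow> arr s' 2 = arr s 2 \<Longrightarrow> listed xs s'"
  unfolding listed_def by simp

lemma input_edges_cong: "input_edges n ws s \<Longrightarrow> reg s' 1 = reg s 1 \<Longrightarrow> reg s' 2 = reg s 2 \<Longrightarrow> arr s' 0 = arr s 0 \<Longrightarrow> input_edges n ws s'"
  unfolding input_edges_def by simp

lemma listed_set_reg: "r \<noteq> 7 \<Longrightarrow> listed xs (set_reg r v s) = listed xs s"
  unfolding listed_def by simp

lemma input_edges_set_reg: "2 < r \<Longrightarrow> input_edges n ws (set_reg r v s) = input_edges n ws s"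
  unfolding input_edges_def by simp

lemma den_match: "den (match e f c) s =
  (if arr s 0 (reg s 6) = ev e s \<and> arr s 0 (Suc (reg s 6)) = ev f s then den c s else s)"
  unfolding match_def by simp

lemma push_edge:
  assumes "listed xs s" "reg s 3 = a" "reg s 4 = b"
  shows "listed (xs @ [(a, b)]) (den push_edge s)"
  using assms unfolding listed_def push_edge_def by (auto simp: nth_append less_Suc_eq)

lemma scan_edges:
  assumes inp: "input_edges n ws s" and d: "distinct (map edge ws)" and xs: "listed xs s"
    and ab: "reg s 3 = a" "reg s 4 = b" "a \<noteq> b"
  shows "listed (xs @ (if {a, b} \<in> edge ` set ws then [(a, b)] else [])) (den scan_edges s)"
proof -
  let ?m = "length ws"
  define body where "body = match (Reg 3) (Reg 4) push_edge ;; match (Reg 4) (Reg 3) push_edge ;; next_edge"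
  define I where "I = (\<lambda>i t. input_edges n ws t \<and> reg t 3 = a \<and> reg t 4 = b \<and> reg t 6 = 2 + 2 * i \<and>
    listed (xs @ (if {a, b} \<in> edge ` set (take i ws) then [(a, b)] else [])) t)"
  define s1 where "s1 = set_reg 6 2 s"
  have I0: "I 0 s1" using ab unfolding I_def s1_def
    by (auto intro: input_edges_cong[OF inp] listed_cong[OF xs])
  have step: "I (Suc i) (den body (set_reg 5 i t))" if i: "i < ?m" and I: "I i t" for i t
  proof -
    define ys where "ys = xs @ (if {a, b} \<in> edge ` set (take i ws) then [(a, b)] else [])"
    have T: "input_edges n ws t" "reg t 3 = a" "reg t 4 = b" "reg t 6 = 2 + 2 * i" "listed ys t"
      using I unfolding I_def ys_def by auto
    obtain u v where uv: "ws ! i = (u, v)" by force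
    define t0 where "t0 = set_reg 5 i t"
    have t0: "arr t0 0 (reg t0 6) = u" "arr t0 0 (Suc (reg t0 6)) = v" "reg t0 3 = a" "reg t0 4 = b" "reg t0 6 = 2 + 2 * i"
      using T i uv unfolding t0_def input_edges_def by auto
    have l0: "listed ys t0" unfolding t0_def by (rule listed_cong[OF T(5)]) auto
    define t1 where "t1 = (if {a, b} = {u, v} then den push_edge t0 else t0)"
    have p: "arr (den push_edge t0) 0 = arr t0 0" "reg (den push_edge t0) 6 = reg t0 6"
      "reg (den push_edge t0) 3 = a" "reg (den push_edge t0) 4 = b"
      using t0 by (simp_all add: push_edge_def)
    have D: "den body t0 = set_reg 6 (Suc (Suc (reg t1 6))) t1"
      unfolding body_def t1_def next_edge_def using t0 ab(3) p
      by (auto simp: den_match doubleton_eq_iff)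
    have new: "{a, b} \<in> edge ` set (take (Suc i) ws) \<longleftrightarrow> {a, b} \<in> edge ` set (take i ws) \<or> {a, b} = {u, v}"
      using i uv by (auto simp: take_Suc_conv_app_nth)
    \<comment> \<open>The word lists each edge once, so no edge is pushed twice.\<close>
    have fresh: "{u, v} \<notin> edge ` set (take i ws)"
    proof
      assume "{u, v} \<in> edge ` set (take i ws)"
      then have "map edge ws ! i \<in> set (take i (map edge ws))" using i uv by (simp add: take_map)
      then obtain j where "j < i" "map edge ws ! j = map edge ws ! i" using i by (auto simp: in_set_conv_nth)
      then show False using nth_eq_iff_index_eq[OF d, of j i] i by simp
    qed
    have "listed (xs @ (if {a, b} \<in> edge ` set (take (Suc i) ws) then [(a, b)] else [])) t1"
    proof (cases "{a, b} = {u, v}")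
      case True
      then have "ys = xs" using fresh unfolding ys_def by simp
      then show ?thesis using True push_edge[OF l0 t0(3,4)] unfolding t1_def new by simp
    next
      case False
      then show ?thesis using l0 unfolding t1_def new ys_def by simp
    qed
    then have "listed (xs @ (if {a, b} \<in> edge ` set (take (Suc i) ws) then [(a, b)] else [])) (den body t0)"
      unfolding D by (rule listed_cong) auto
    moreover have "input_edges n ws (den body t0)" unfolding t0_def
      by (rule input_edges_cong[OF T(1)])
        (simp_all add: reg_den arr_den body_def match_def push_edge_def next_edge_def del: den.simps)
    moreover have "reg (den body t0) 3 = a" "reg (den body t0) 4 = b" "reg (den body t0) 6 = 2 + 2 * Suc i"
      unfolding D t1_def using t0 p by auto
    ultimately show ?thesis unfolding I_def t0_def by blast
  qed
  have fin: "I ?m (set_reg 5 ?m t)" if "I ?m t" for t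
    using that unfolding I_def by (simp add: listed_set_reg input_edges_set_reg)
  have m: "reg s1 2 = ?m" using inp unfolding s1_def input_edges_def by simp
  have "I ?m (den (For 5 2 body) s1)"
    by (rule den_for_invariant[where I = I, OF I0 step m fin])
  moreover have "den scan_edges s = den (For 5 2 body) s1" unfolding scan_edges_def s1_def body_def by simp
  ultimately show ?thesis unfolding I_def by simp
qed

lemma assigned_scan: "assigned scan_edges = {5, 6, 7}"
  by (auto simp: scan_edges_def match_def push_edge_def next_edge_def)

lemma modified_scan: "modified scan_edges = {1, 2}"
  by (auto simp: scan_edges_def match_def push_edge_def next_edge_def)

lemma assigned_sort: "assigned sort_edges = {3, 4, 5, 6, 7}"
  by (auto simp: sort_edges_def assigned_scan)

lemma modified_sort: "modified sort_edges = {1, 2}"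
  by (auto simp: sort_edges_def modified_scan)

lemma quiet_sort: "quiet sort_edges"
  by (simp add: sort_edges_def scan_edges_def match_def push_edge_def next_edge_def)

lemma sort_edges:
  assumes inp: "input_edges n ws s" and d: "distinct (map edge ws)" and E: "edge ` set ws = E"
    and sE: "simple_graph E" "\<Union>E \<subseteq> {..<n}"
  shows "table_state n (sorted_edges n E) (den sort_edges s)"
proof -
  define row where "row = (\<lambda>a k. map (Pair a) (filter (\<lambda>b. a < b \<and> {a, b} \<in> E) [0..<k]))"
  define inner where "inner = Cond (Less (Reg 3) (Reg 4)) scan_edges Nop"
  have row: "input_edges n ws (den (For 4 1 inner) s) \<and> listed (xs @ row a n) (den (For 4 1 inner) s)"
    if inp: "input_edges n ws s" and xs: "listed xs s" and a: "reg s 3 = a" for s xs a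
  proof -
    define I where "I = (\<lambda>i t. input_edges n ws t \<and> reg t 3 = a \<and> listed (xs @ row a i) t)"
    have I0: "I 0 s" using inp xs a unfolding I_def row_def by simp
    have step: "I (Suc i) (den inner (set_reg 4 i t))" if I: "I i t" for i t
    proof -
      define t0 where "t0 = set_reg 4 i t"
      have t0: "input_edges n ws t0" "reg t0 3 = a" "reg t0 4 = i" "listed (xs @ row a i) t0"
        using I unfolding I_def t0_def by (auto intro: input_edges_cong listed_cong)
      define t1 where "t1 = den inner t0"
      have "input_edges n ws t1" "reg t1 3 = a"
        unfolding t1_def inner_def using t0
        by (auto simp: reg_den arr_den assigned_scan modified_scan intro: input_edges_cong[OF t0(1)])
      moreover have "listed (xs @ row a (Suc i)) t1"
      proof (cases "a < i")
        case True
        then have "t1 = den scan_edges t0" unfolding t1_def inner_def using t0 by simp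
        moreover have "row a (Suc i) = row a i @ (if {a, i} \<in> E then [(a, i)] else [])"
          using True unfolding row_def by simp
        ultimately show ?thesis using scan_edges[OF t0(1) d t0(4,2,3)] True unfolding E by simp
      next
        case False
        then have "t1 = t0" unfolding t1_def inner_def using t0 by simp
        then show ?thesis using t0(4) False unfolding row_def by simp
      qed
      ultimately show ?thesis unfolding I_def t1_def t0_def by blast
    qed
    have fin: "I n (set_reg 4 n t)" if "I n t" for t
      using that unfolding I_def by (simp add: listed_set_reg input_edges_set_reg)
    have n: "reg s 1 = n" using inp unfolding input_edges_def by simp
    have "I n (den (For 4 1 inner) s)" by (rule den_for_invariant[where I = I, OF I0 step n fin])
    then show ?thesis unfolding I_def by blast
  qed
  define I where "I = (\<lambda>i t. input_edges n ws t \<and> listed (concat (map (\<lambda>a. row a n) [0..<i])) t)"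
  define s1 where "s1 = set_reg 7 0 s"
  have I0: "I 0 s1" using inp unfolding I_def s1_def by (auto intro: input_edges_cong simp: listed_def)
  have step: "I (Suc i) (den (For 4 1 inner) (set_reg 3 i t))" if I: "I i t" for i t
  proof -
    have "input_edges n ws (set_reg 3 i t)" "listed (concat (map (\<lambda>a. row a n) [0..<i])) (set_reg 3 i t)"
      "reg (set_reg 3 i t) 3 = i"
      using I unfolding I_def by (auto intro: input_edges_cong listed_cong)
    from row[OF this] show ?thesis unfolding I_def by simp
  qed
  have fin: "I n (set_reg 3 n t)" if "I n t" for t
    using that unfolding I_def by (simp add: listed_set_reg input_edges_set_reg)
  have n: "reg s1 1 = n" using inp unfolding s1_def input_edges_def by simp
  have "I n (den (For 3 1 (For 4 1 inner)) s1)" by (rule den_for_invariant[where I = I, OF I0 step n fin])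
  moreover have "den sort_edges s = den (For 3 1 (For 4 1 inner)) s1"
    unfolding sort_edges_def s1_def inner_def by simp
  moreover have "concat (map (\<lambda>a. row a n) [0..<n]) = sorted_edges n E" unfolding sorted_edges_def row_def ..
  ultimately have *: "input_edges n ws (den sort_edges s)" "listed (sorted_edges n E) (den sort_edges s)"
    unfolding I_def by auto
  have "length ws = card E" using distinct_card[OF d] E by simp
  then show ?thesis using * length_sorted_edges[OF sE] unfolding table_state_def input_edges_def listed_def by simp
qed

subsection \<open>Reading a solution\<close>

text \<open>Register 0, the length of the first word, is where the second word begins. Loops are
  bounded by m or n only, so m pairs are read even if the solution has fewer; beyond the input the
  memory yields the pair (0, 0), which is no edge.\<close>

definition read_solution :: acom where
  "read_solution = Assign 6 (Reg 0) ;; For 12 2 (For 15 2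
     (match (Arr 1 (Reg 15)) (Arr 2 (Reg 15)) (Write 4 (Reg 15) (Const 1)) ;;
      match (Arr 2 (Reg 15)) (Arr 1 (Reg 15)) (Write 4 (Reg 15) (Const 1))) ;; next_edge)"

lemma assigned_read_solution: "assigned read_solution = {6, 12, 15}"
  by (auto simp: read_solution_def match_def next_edge_def)

lemma modified_read_solution: "modified read_solution = {4}"
  by (auto simp: read_solution_def match_def next_edge_def)

lemma quiet_read_solution: "quiet read_solution"
  by (simp add: read_solution_def match_def next_edge_def)

context edge_table
begin

lemma read_solution:
  assumes t: "table_state n es s" and a0: "reg s 0 = p" and z: "\<forall>q. arr s 4 q = 0"
    and vs: "\<And>i. i < length vs \<Longrightarrow> arr s 0 (p + 2 * i) = fst (vs ! i) \<and> arr s 0 (Suc (p + 2 * i)) = snd (vs ! i)"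
    and beyond: "\<And>a. p + 2 * length vs \<le> a \<Longrightarrow> arr s 0 a = 0"
    and d: "distinct (map edge vs)" and sub: "edge ` set vs \<subseteq> edge ` set es"
  shows "edge_set es (arr (den read_solution s) 4) = edge ` set vs"
proof -
  let ?m = "length es"
  define g where "g = arr s 0"
  define hit where "hit = (\<lambda>i q. {g (p + 2 * i), g (Suc (p + 2 * i))} = edge (es ! q))"
  define body where "body = match (Arr 1 (Reg 15)) (Arr 2 (Reg 15)) (Write 4 (Reg 15) (Const 1)) ;;
      match (Arr 2 (Reg 15)) (Arr 1 (Reg 15)) (Write 4 (Reg 15) (Const 1))"
  have inner: "table_state n es (den (For 15 2 body) s) \<and> arr (den (For 15 2 body) s) 0 = g \<and>
      reg (den (For 15 2 body) s) 6 = p + 2 * i \<and>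
      (\<forall>q<?m. arr (den (For 15 2 body) s) 4 q \<noteq> 0 \<longleftrightarrow> arr s 4 q \<noteq> 0 \<or> hit i q)"
    if s: "table_state n es s" "arr s 0 = g" "reg s 6 = p + 2 * i" for s i
  proof -
    define f where "f = arr s 4"
    define I where "I = (\<lambda>j t. table_state n es t \<and> arr t 0 = g \<and> reg t 6 = p + 2 * i \<and>
      (\<forall>q. arr t 4 q \<noteq> 0 \<longleftrightarrow> f q \<noteq> 0 \<or> (q < j \<and> hit i q)))"
    have I0: "I 0 s" using s unfolding I_def f_def by simp
    have step: "I (Suc j) (den body (set_reg 15 j t))" if j: "j < ?m" and I: "I j t" for j t
    proof -
      have T: "table_state n es t" "arr t 0 = g" "reg t 6 = p + 2 * i"
        "\<And>q. arr t 4 q \<noteq> 0 \<longleftrightarrow> f q \<noteq> 0 \<or> (q < j \<and> hit i q)" using I unfolding I_def by auto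
      have ab: "arr t 1 j = fst (es ! j)" "arr t 2 j = snd (es ! j)" using table_stateD(4,6)[OF T(1) j] .
      define t0 where "t0 = set_reg 15 j t"
      define t' where "t' = den body t0"
      have t0: "arr t0 = arr t" "reg t0 6 = p + 2 * i" "reg t0 15 = j" unfolding t0_def using T(3) by simp_all
      have h: "hit i j \<longleftrightarrow> g (p + 2 * i) = fst (es ! j) \<and> g (Suc (p + 2 * i)) = snd (es ! j) \<or>
          g (p + 2 * i) = snd (es ! j) \<and> g (Suc (p + 2 * i)) = fst (es ! j)"
        unfolding hit_def doubleton_eq_iff by blast
      have t': "t' = (if hit i j then t0\<lparr>arr := (arr t)(4 := (arr t 4)(j := 1))\<rparr> else t0)"
        unfolding t'_def body_def using t0 T(2) ab irrefl_nth[OF j] unfolding h by (auto simp: den_match)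
      have "table_state n es t0" unfolding t0_def by (rule table_state_set_reg[OF T(1)]) simp
      then have "table_state n es t'" unfolding t' by (auto intro: table_state_cong simp: t0)
      moreover have "arr t' 0 = g" "reg t' 6 = p + 2 * i" unfolding t' using t0 T(2) by auto
      moreover have "arr t' 4 q \<noteq> 0 \<longleftrightarrow> f q \<noteq> 0 \<or> (q < Suc j \<and> hit i q)" for q
        unfolding t' using T(4)[of q] t0(1) by (auto simp: less_Suc_eq)
      ultimately show ?thesis unfolding I_def t'_def t0_def by blast
    qed
    have fin: "I ?m (set_reg 15 ?m t)" if "I ?m t" for t
      using that unfolding I_def by (simp add: table_state_set_reg)
    have "I ?m (den (For 15 2 body) s)"
      by (rule den_for_invariant[where I = I, OF I0 step table_stateD(3)[OF s(1)] fin])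
    then show ?thesis unfolding I_def f_def by auto
  qed
  define I where "I = (\<lambda>i t. table_state n es t \<and> arr t 0 = g \<and> reg t 6 = p + 2 * i \<and>
      (\<forall>q<?m. arr t 4 q \<noteq> 0 \<longleftrightarrow> (\<exists>j<i. hit j q)))"
  define s1 where "s1 = set_reg 6 p s"
  have t1: "table_state n es s1" unfolding s1_def by (rule table_state_set_reg[OF t]) simp
  have I0: "I 0 s1" using t1 z unfolding I_def by (simp add: s1_def g_def)
  have step: "I (Suc i) (den (For 15 2 body ;; next_edge) (set_reg 12 i t))" if I: "I i t" for i t
  proof -
    have "table_state n es (set_reg 12 i t)" "arr (set_reg 12 i t) 0 = g" "reg (set_reg 12 i t) 6 = p + 2 * i"
      using I unfolding I_def by (simp_all add: table_state_set_reg)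
    note r = inner[OF this]
    define t1 where "t1 = den (For 15 2 body) (set_reg 12 i t)"
    have D: "den (For 15 2 body ;; next_edge) (set_reg 12 i t) = set_reg 6 (Suc (Suc (reg t1 6))) t1"
      unfolding t1_def next_edge_def by simp
    have "arr t1 4 q \<noteq> 0 \<longleftrightarrow> (\<exists>j<Suc i. hit j q)" if "q < ?m" for q
      using r that I unfolding t1_def I_def ex_less_Suc by simp
    then show ?thesis using r unfolding D I_def t1_def[symmetric] by (simp add: table_state_set_reg)
  qed
  have fin: "I ?m (set_reg 12 ?m t)" if "I ?m t" for t
    using that unfolding I_def by (simp add: table_state_set_reg)
  have D: "den read_solution s = den (For 12 2 (For 15 2 body ;; next_edge)) s1"
    unfolding read_solution_def s1_def body_def a0[symmetric] by simp
  have I: "I ?m (den read_solution s)" unfolding D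
    by (rule den_for_invariant[where I = I, OF I0 step table_stateD(3)[OF t1] fin])
  have "card (set (map edge vs)) \<le> card (edge ` set es)" using sub by (intro card_mono) auto
  then have len: "length vs \<le> ?m" using distinct_card[OF d] distinct_card[OF distinct_edges] by simp
  show ?thesis
  proof (rule edge_set_eqI[OF sub])
    fix q assume q: "q < ?m"
    have in_vs: "hit j q \<longleftrightarrow> edge (vs ! j) = edge (es ! q)" if "j < length vs" for j
      using vs[OF that] unfolding hit_def g_def by simp
    \<comment> \<open>Past the end both entries are 0, and no edge has equal ends.\<close>
    have out_vs: "\<not> hit j q" if "\<not> j < length vs" for j
      using beyond[of "p + 2 * j"] beyond[of "Suc (p + 2 * j)"] that irrefl_nth[OF q]
      unfolding hit_def g_def by (auto simp: doubleton_eq_iff)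
    have "(\<exists>j<?m. hit j q) \<longleftrightarrow> (\<exists>j<length vs. edge (vs ! j) = edge (es ! q))"
      using in_vs out_vs len by (meson less_le_trans)
    also have "\<dots> \<longleftrightarrow> edge (es ! q) \<in> edge ` set vs"
    proof
      assume "\<exists>j<length vs. edge (vs ! j) = edge (es ! q)"
      then obtain j where j: "j < length vs" "edge (vs ! j) = edge (es ! q)" by blast
      show "edge (es ! q) \<in> edge ` set vs" using imageI[OF nth_mem[OF j(1)], of edge] unfolding j(2) .
    next
      assume "edge (es ! q) \<in> edge ` set vs"
      then obtain x where "x \<in> set vs" "edge (es ! q) = edge x" by blast
      then show "\<exists>j<length vs. edge (vs ! j) = edge (es ! q)" by (metis in_set_conv_nth)
    qed
    finally show "arr (den read_solution s) 4 q \<noteq> 0 \<longleftrightarrow> edge (es ! q) \<in> edge ` set vs"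
      using I q unfolding I_def by simp
  qed
qed

end

subsection \<open>Running programs on words\<close>

definition load_sizes :: acom where
  "load_sizes = Assign 1 (Arr 0 (Const 0)) ;; Assign 2 (Arr 0 (Const 1))"

definition start :: "nat list list \<Rightarrow> astate" where
  "start ws = den load_sizes (input_state ws)"

definition with_input :: "com \<Rightarrow> com" where
  "with_input c = SEQ read_input (SEQ (compile load_sizes) c)"

text \<open>The continuation is arbitrary, because the main loop of the listing is not obtained from
  a program with counted loops.\<close>

lemma run_start:
  assumes "ws \<noteq> []" "length ws \<le> 2" "\<And>v. v \<in> set (concat ws) \<Longrightarrow> v \<le> W"
  shows "\<exists>t X M. (\<forall>c t' s'. exec c (X, M) t' s' \<longrightarrow> exec (with_input c) (init ws) (t @ t') s') \<and>
     represents (length (concat ws)) (set (concat ws)) (X, M) (start ws) \<and> visible t = [] \<and>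
     length t \<le> 70 + length (concat ws) * (70 + 19 * W)"
proof -
  let ?n = "60 + length (concat ws) * (70 + 19 * W)"
  obtain s1 where s1: "runs read_input (init ws) ?n s1"
    "represents (length (concat ws)) (set (concat ws)) s1 (input_state ws)"
    using runs_read_input[OF assms] by blast
  obtain t1 where t1: "exec read_input (init ws) t1 s1" "silent t1" "length t1 \<le> ?n"
    using s1(1) unfolding runs_def by blast
  obtain X1 M1 where X1: "s1 = (X1, M1)" by force
  have o: "out (den load_sizes (input_state ws)) = []" unfolding load_sizes_def input_state_def by simp
  obtain t2 X M where t2: "exec (compile load_sizes) (X1, M1) t2 (X, M)"
    "represents (length (concat ws)) (set (concat ws)) (X, M) (start ws)"
    "out (den load_sizes (input_state ws)) = out (input_state ws) @ visible t2"
    "length t2 \<le> time load_sizes (reg (input_state ws))"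
    using exec_compile[of "{}" load_sizes, OF _ s1(2)[unfolded X1]] unfolding o start_def
    by (auto simp: load_sizes_def o[unfolded load_sizes_def] simp del: den.simps)
  have "exec (with_input c) (init ws) ((t1 @ t2) @ t') s'" if "exec c (X, M) t' s'" for c t' s'
    unfolding with_input_def append_assoc
    by (rule exec.Seq[OF t1(1)[unfolded X1] exec.Seq[OF t2(1) that]])
  moreover have "visible (t1 @ t2) = []" using visible_silent[OF t1(2)] t2(3) o by simp
  moreover have "length (t1 @ t2) \<le> 70 + length (concat ws) * (70 + 19 * W)"
    using t1(3) t2(4) by (simp add: load_sizes_def)
  ultimately show ?thesis using t2(2) by blast
qed

lemma run_compiled:
  assumes "ws \<noteq> []" "length ws \<le> 2" "\<And>v. v \<in> set (concat ws) \<Longrightarrow> v \<le> W" "wf L c"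
    "\<And>v. Put v \<in> set (out (den c (start ws))) \<Longrightarrow> v \<in> set (concat ws)"
  shows "\<exists>t s. exec (with_input (compile c)) (init ws) t s \<and> visible t = out (den c (start ws)) \<and>
    length t \<le> 70 + length (concat ws) * (70 + 19 * W) + time c (reg (start ws))"
proof -
  obtain t1 X M where 1: "\<forall>c t' s'. exec c (X, M) t' s' \<longrightarrow> exec (with_input c) (init ws) (t1 @ t') s'"
    "represents (length (concat ws)) (set (concat ws)) (X, M) (start ws)" "visible t1 = []"
    "length t1 \<le> 70 + length (concat ws) * (70 + 19 * W)"
    using run_start[OF assms(1-3)] by blast
  obtain t2 X2 M2 where 2: "exec (compile c) (X, M) t2 (X2, M2)"
    "out (den c (start ws)) = out (start ws) @ visible t2" "length t2 \<le> time c (reg (start ws))"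
    using exec_compile[OF assms(4) 1(2) assms(5)] by blast
  have "out (start ws) = []" unfolding start_def load_sizes_def input_state_def by simp
  then show ?thesis using 1 2 by (intro exI[of _ "t1 @ t2"] exI[of _ "(X2, M2)"]) auto
qed

lemma length_edge_word: "length (concat (map (\<lambda>(u, v). [u, v]) ws)) = 2 * length ws"
  by (induction ws) auto

lemma nth_edge_word:
  "i < length ws \<Longrightarrow> (concat (map (\<lambda>(u, v). [u, v]) ws) @ ys) ! (2 * i) = fst (ws ! i) \<and>
     (concat (map (\<lambda>(u, v). [u, v]) ws) @ ys) ! Suc (2 * i) = snd (ws ! i)"
proof (induction ws arbitrary: i)
  case (Cons p ws)
  then show ?case by (cases i) (auto simp: case_prod_unfold)
qed simp

lemma start_simps:
  "reg (start (w # vs)) 0 = length w"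
  "r \<notin> {0, 1, 2} \<Longrightarrow> reg (start (w # vs)) r = 0"
  "arr (start (w # vs)) 0 i = (if i < length (concat (w # vs)) then concat (w # vs) ! i else 0)"
  "k \<noteq> 0 \<Longrightarrow> arr (start (w # vs)) k i = 0"
  "out (start (w # vs)) = []"
  by (simp_all add: start_def load_sizes_def input_state_def)

lemma start_input_edges:
  assumes w: "w = n # length ws # concat (map (\<lambda>(u, v). [u, v]) ws)"
  shows "input_edges n ws (start (w # vs))"
  unfolding input_edges_def
proof (intro conjI allI impI)
  have "arr (input_state (w # vs)) 0 0 = n" "arr (input_state (w # vs)) 0 1 = length ws"
    unfolding input_state_def w by simp_all
  then show "reg (start (w # vs)) 1 = n" "reg (start (w # vs)) 2 = length ws"
    unfolding start_def load_sizes_def by simp_all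
next
  fix i assume i: "i < length ws"
  note n = nth_edge_word[OF i, of "concat vs"]
  show "arr (start (w # vs)) 0 (2 + 2 * i) = fst (ws ! i)"
    "arr (start (w # vs)) 0 (Suc (2 + 2 * i)) = snd (ws ! i)"
    using n i length_edge_word[of ws] unfolding start_simps unfolding w by simp_all
qed

lemma edge_case_prod: "(\<lambda>(u, v). {u, v}) = edge"
  by auto

lemma graph_wordE:
  assumes "graph_word E w"
  obtains ws where "w = card (\<Union>E) # length ws # concat (map (\<lambda>(u, v). [u, v]) ws)"
    "distinct (map edge ws)" "edge ` set ws = E"
proof -
  obtain ws where ws: "w = card (\<Union>E) # card E # concat (map (\<lambda>(u, v). [u, v]) ws)"
    "distinct (map edge ws)" "set (map edge ws) = E"
    using assms unfolding graph_word_def edges_word_def edge_case_prod by blast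
  have "card E = length ws" using distinct_card[OF ws(2)] ws(3) by simp
  then show ?thesis using that ws by auto
qed

lemma set_edge_word: "set (concat (map (\<lambda>(u, v). [u, v]) ws)) = \<Union> (edge ` set ws)"
  by (induction ws) auto

lemma Put_output_events: "Put v \<in> set (output_events xs) \<longleftrightarrow> (\<exists>x \<in> set xs. v \<in> set x)"
  unfolding output_events_def by auto

lemma output_events_append: "output_events (xs @ ys) = output_events xs @ output_events ys"
  unfolding output_events_def by simp

lemma output_events_single: "output_events [x] = map Put x @ [Emit]"
  unfolding output_events_def by simp

lemma set_edge_set_word: "set (edge_set_word es T) \<subseteq> \<Union> (edge ` set es)"
  unfolding edge_set_word_def set_edge_word by auto

subsection \<open>The programs\<close>

definition first_prog :: acom where
  "first_prog = sort_edges ;; complete_prog ;; output_prog 3"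

definition neighbours_prog :: acom where
  "neighbours_prog = sort_edges ;; read_solution ;; for_neighbours (output_prog 3)"

definition init_prog :: acom where
  "init_prog = sort_edges ;; complete_prog ;; Assign 20 (Const 2) ;; insert_prog"

definition pop_prog :: acom where
  "pop_prog = For 5 2 (Write 4 (Reg 5) (Arr 11 (Reg 23)) ;; Assign 23 (Succ (Reg 23))) ;;
     Assign 24 (Succ (Reg 24))"

definition process_prog :: acom where
  "process_prog = pop_prog ;; output_prog 4 ;; for_neighbours insert_prog"

text \<open>The number of rounds is the number of solutions, which no register holds in advance, so
  this loop is unbounded. It compares the entries taken from the queue with the entries put into it;
  both registers are scaled, which preserves the order.\<close>

definition main_loop :: com where
  "main_loop = WHILE (LESS (24 + 24) (24 + 22)) (compile process_prog)"

definition list_prog :: com where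
  "list_prog = with_input (SEQ (compile init_prog) main_loop)"

lemmas prog_defs = search_def search_round_def relax_def mark_neighbours_def clear_def try_prog_def
  complete_prog_def attach_prog_def for_neighbours_def output_prog_def walk_prog_def descend_def
  enqueue_def insert_prog_def scan_edges_def match_def push_edge_def next_edge_def sort_edges_def
  read_solution_def

lemma wf_progs: "wf {2, 1} first_prog" "wf {2, 1} neighbours_prog" "wf {2, 1} init_prog" "wf {2, 1} process_prog"
  by (simp_all add: first_prog_def neighbours_prog_def init_prog_def process_prog_def pop_prog_def prog_defs)

text \<open>Registers 2 and 1 hold m and n. The \<open>m^4 n\<close> of the delay is read off
  \<open>process_prog\<close>; the square of n in the other programs comes from sorting.\<close>

lemma degree_progs:
  "degree 2 first_prog = 3" "degree 1 first_prog = 2"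
  "degree 2 neighbours_prog = 4" "degree 1 neighbours_prog = 2"
  "degree 2 init_prog = 3" "degree 1 init_prog = 2"
  "degree 2 process_prog = 4" "degree 1 process_prog = 1"
  by (simp_all add: first_prog_def neighbours_prog_def init_prog_def process_prog_def pop_prog_def prog_defs)

lemma assigned_output: "assigned (output_prog k) = {5}"
  and modified_output: "modified (output_prog k) = {}"
  by (auto simp: output_prog_def)

lemma assigned_pop: "assigned pop_prog = {5, 23, 24}"
  and modified_pop: "modified pop_prog = {4}"
  and quiet_pop: "quiet pop_prog"
  by (auto simp: pop_prog_def)

context edge_table
begin

section \<open>Breadth-first search over the solutions\<close>

definition queue_position :: "nat \<Rightarrow> astate \<Rightarrow> bool" where
  "queue_position h s \<longleftrightarrow> reg s 23 = h * length es \<and> reg s 24 = h"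

lemma pop_prog:
  assumes t: "table_state n es s" and st: "store_state s Ls" and h: "queue_position h s" "h < length Ls"
  defines "s' \<equiv> den pop_prog s"
  shows "table_state n es s'" "store_state s' Ls" "queue_position (Suc h) s'" "edge_set es (arr s' 4) = Ls ! h"
proof -
  let ?m = "length es"
  show "table_state n es s'" unfolding s'_def
    by (rule table_state_den[OF t]) (auto simp: assigned_pop modified_pop)
  show "store_state s' Ls" unfolding s'_def
    by (rule store_state_cong[OF st]) (auto simp: reg_den arr_den assigned_pop modified_pop)
  define q where "q = arr s 11"
  define I where "I = (\<lambda>i t. table_state n es t \<and> arr t 11 = q \<and> reg t 23 = h * ?m + i \<and> reg t 24 = h \<and>
    (\<forall>j<i. arr t 4 j = q (h * ?m + j)))"
  define body where "body = Write 4 (Reg 5) (Arr 11 (Reg 23)) ;; Assign 23 (Succ (Reg 23))"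
  have I0: "I 0 s" using t h(1) unfolding I_def q_def queue_position_def by simp
  have step: "I (Suc i) (den body (set_reg 5 i t))" if I: "I i t" for i t
  proof -
    have T: "table_state n es t" "arr t 11 = q" "reg t 23 = h * ?m + i" "reg t 24 = h"
      "\<forall>j<i. arr t 4 j = q (h * ?m + j)" using I unfolding I_def by auto
    define t' where "t' = den body (set_reg 5 i t)"
    have "arr t' = (arr t)(4 := (arr t 4)(i := q (h * ?m + i)))" "reg t' 23 = h * ?m + Suc i" "reg t' 24 = h"
      unfolding t'_def body_def using T by simp_all
    moreover have "table_state n es t'" unfolding t'_def body_def
      by (intro table_state_den table_state_set_reg T(1)) auto
    ultimately show ?thesis unfolding I_def t'_def[symmetric] using T by (auto simp: less_Suc_eq)
  qed
  have fin: "I ?m (set_reg 5 ?m t)" if "I ?m t" for t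
    using that unfolding I_def by (simp add: table_state_set_reg)
  define s1 where "s1 = den (For 5 2 body) s"
  have I: "I ?m s1" unfolding s1_def
    by (rule den_for_invariant[where I = I, OF I0 step table_stateD(3)[OF t] fin])
  have D: "s' = set_reg 24 (Suc (reg s1 24)) s1" unfolding s'_def pop_prog_def s1_def body_def by simp
  show "queue_position (Suc h) s'" using I unfolding D I_def queue_position_def by simp
  have Q: "queue_state s Ls" "Ls ! h \<subseteq> edge ` set es" using st h(2) unfolding store_state_def by auto
  show "edge_set es (arr s' 4) = Ls ! h"
  proof (rule edge_set_eqI[OF Q(2)])
    show "arr s' 4 i \<noteq> 0 \<longleftrightarrow> edge (es ! i) \<in> Ls ! h" if "i < ?m" for i
      using I Q(1) h(2) that unfolding D I_def queue_state_def q_def by simp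
  qed
qed

lemma process_prog:
  assumes t: "table_state n es s" and st: "store_state s Ls" and h: "queue_position h s" "h < length Ls"
    and o: "out s = []"
  defines "s' \<equiv> den process_prog s" and "Ls' \<equiv> fold add_new (neighbour_list es (Ls ! h)) Ls"
  shows "table_state n es s'" "store_state s' Ls'" "queue_position (Suc h) s'"
    "out s' = output_events [edge_set_word es (Ls ! h)]"
proof -
  define s1 where "s1 = den pop_prog s"
  define s2 where "s2 = den (output_prog 4) s1"
  note p = pop_prog[OF t st h, folded s1_def]
  have t2: "table_state n es s2" unfolding s2_def
    by (rule table_state_den[OF p(1)]) (auto simp: assigned_output modified_output)
  have st2: "store_state s2 Ls" unfolding s2_def
    by (rule store_state_cong[OF p(2)]) (auto simp: reg_den arr_den assigned_output modified_output)
  have q2: "queue_position (Suc h) s2" using p(3) unfolding s2_def queue_position_def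
    by (simp add: reg_den assigned_output)
  have a2: "edge_set es (arr s2 4) = Ls ! h" using p(4) unfolding s2_def by (simp add: arr_den modified_output)
  have "out s1 = []" using o unfolding s1_def by (simp add: out_den quiet_pop)
  then have o2: "out s2 = output_events [edge_set_word es (Ls ! h)]"
    using output_prog[OF p(1), of 4] p(4) unfolding s2_def output_events_single by simp
  define I where "I = (\<lambda>Ts t. store_state t (fold add_new Ts Ls) \<and> queue_position (Suc h) t \<and>
    out t = output_events [edge_set_word es (Ls ! h)])"
  have D: "s' = den (for_neighbours insert_prog) s2" unfolding s'_def process_prog_def s2_def s1_def by simp
  have "I (neighbour_list es (edge_set es (arr s2 4))) s'" unfolding D
  proof (rule for_neighbours[OF t2])
    show "I [] s2" using st2 q2 o2 unfolding I_def by simp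
    show "I (Ts @ [edge_set es (arr s 3)]) (den insert_prog s)" if "table_state n es s" "I Ts s" for Ts s
      using insert_prog[OF that(1)] that(2) unfolding I_def queue_position_def
      by (simp add: reg_den out_den assigned_insert quiet_insert)
    show "I Ts s'" if "I Ts s" "\<And>r. 15 < r \<Longrightarrow> reg s' r = reg s r" "\<And>k. 7 < k \<Longrightarrow> arr s' k = arr s k"
      "out s' = out s" for Ts s s'
    proof -
      have "store_state s' (fold add_new Ts Ls)"
        by (rule store_state_cong[of s]) (use that in \<open>auto simp: I_def\<close>)
      then show ?thesis using that(1,2,4) unfolding I_def queue_position_def by simp
    qed
  qed (simp_all add: assigned_insert modified_insert)
  then show "store_state s' Ls'" "queue_position (Suc h) s'" "out s' = output_events [edge_set_word es (Ls ! h)]"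
    unfolding I_def a2 Ls'_def by blast+
  show "table_state n es s'" unfolding D
    by (rule table_state_den[OF t2])
      (auto simp: for_neighbours_def assigned_insert modified_insert assigned_attach modified_attach assigned_complete modified_complete)
qed

lemma represents_out: "represents D V \<sigma> s \<Longrightarrow> represents D V \<sigma> (s\<lparr>out := o'\<rparr>)"
  unfolding represents_def by (cases \<sigma>) simp

text \<open>Queue entries are distinct solutions and each round takes one, so the number of
  solutions minus h decreases. Neighbours of processed entries are already in the queue; when h
  reaches its end, the queue is closed under neighbours.\<close>

lemma run_main_loop:
  assumes V: "\<Union> (edge ` set es) \<subseteq> V"
    and B: "\<And>s. table_state n es s \<Longrightarrow> time process_prog (reg s) < B"
    and rep: "represents D V (X, M) s" and t: "table_state n es s" and st: "store_state s Ls"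
    and h: "queue_position h s" "h \<le> length Ls"
    and Ls: "set Ls \<subseteq> maximal_chordal_subgraphs (edge ` set es)"
    and cl: "\<And>i. i < h \<Longrightarrow> set (neighbour_list es (Ls ! i)) \<subseteq> set Ls"
  shows "\<exists>ts \<sigma> xs. exec main_loop (X, M) (concat ts @ [Tick]) \<sigma> \<and>
    (\<forall>t \<in> set ts. length t \<le> B \<and> Emit \<in> set t) \<and>
    visible (concat ts) = output_events (map (edge_set_word es) (drop h (Ls @ xs))) \<and>
    set (Ls @ xs) \<subseteq> maximal_chordal_subgraphs (edge ` set es) \<and> distinct (Ls @ xs) \<and>
    (\<forall>T \<in> set (Ls @ xs). set (neighbour_list es T) \<subseteq> set (Ls @ xs))"
  using rep t st h Ls cl
proof (induction "card (maximal_chordal_subgraphs (edge ` set es)) - h" arbitrary: X M s Ls h rule: less_induct)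
  case less
  let ?S = "maximal_chordal_subgraphs (edge ` set es)"
  have fin: "finite ?S"
    by (rule finite_subset[of _ "Pow (edge ` set es)"]) (auto simp: maximal_chordal_subgraphs_def)
  have dLs: "distinct Ls" and qLs: "reg s 22 = length Ls"
    using less.prems(3) unfolding store_state_def queue_state_def by auto
  have X: "X (24 + 24) = 16 * h" "X (24 + 22) = 16 * length Ls"
  proof -
    have "\<forall>r. X (24 + r) = 16 * reg s r" using less.prems(1) unfolding represents_def by simp
    then show "X (24 + 24) = 16 * h" "X (24 + 22) = 16 * length Ls"
      using qLs less.prems(4) unfolding queue_position_def by metis+
  qed
  show ?case
  proof (cases "h = length Ls")
    case True
    have "exec main_loop (X, M) [Tick] (X, M)" unfolding main_loop_def
      by (rule exec.WhileFalse) (use X True in simp)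
    moreover have "\<forall>T \<in> set Ls. set (neighbour_list es T) \<subseteq> set Ls"
      using less.prems(7) True by (metis in_set_conv_nth)
    moreover have "visible (concat []) = output_events (map (edge_set_word es) (drop h (Ls @ [])))"
      using True by (simp add: output_events_def)
    ultimately show ?thesis using less.prems(6) dLs
      by (intro exI[of _ "[]"] exI[of _ "(X, M)"]) simp
  next
    case False
    then have hl: "h < length Ls" using less.prems(5) by simp
    \<comment> \<open>Clearing the record of past events, on which \<open>represents\<close> does
      not depend, isolates the events of this round.\<close>
    define s0 where "s0 = s\<lparr>out := []\<rparr>"
    have s0: "represents D V (X, M) s0" "table_state n es s0" "store_state s0 Ls" "queue_position h s0" "out s0 = []"
      using represents_out[OF less.prems(1)] less.prems(2-4) unfolding s0_def
      by (simp_all add: table_state_def queue_position_def store_state_def queue_state_def trie_state_def)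
    define s1 where "s1 = den process_prog s0"
    define Ls1 where "Ls1 = fold add_new (neighbour_list es (Ls ! h)) Ls"
    note p = process_prog[OF s0(2-4) hl s0(5), folded s1_def Ls1_def]
    have vV: "v \<in> V" if "Put v \<in> set (out s1)" for v
    proof -
      have "v \<in> set (edge_set_word es (Ls ! h))" using that unfolding p(4) Put_output_events by simp
      then show ?thesis using set_edge_set_word V by blast
    qed
    obtain t1 X1 M1 where 1: "exec (compile process_prog) (X, M) t1 (X1, M1)" "represents D V (X1, M1) s1"
      "out s1 = out s0 @ visible t1" "length t1 \<le> time process_prog (reg s0)"
      using exec_compile[OF wf_progs(4) s0(1) vV[unfolded s1_def]] unfolding s1_def by blast
    have hS: "Ls ! h \<in> ?S" using less.prems(6) hl by auto
    obtain ys where ys: "Ls1 = Ls @ ys" using fold_add_new_prefix unfolding Ls1_def by blast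
    have set1: "set Ls1 = set Ls \<union> set (neighbour_list es (Ls ! h))"
      unfolding Ls1_def by (rule set_fold_add_new)
    have Ls1: "set Ls1 \<subseteq> ?S" unfolding set1
      using less.prems(6) neighbour_list_maximal[OF hS refl simple_edges] by blast
    have cl1: "set (neighbour_list es (Ls1 ! i)) \<subseteq> set Ls1" if "i < Suc h" for i
    proof (cases "i = h")
      case True then show ?thesis using hl unfolding ys by (simp add: nth_append) (use set1 ys in simp)
    next
      case False
      then have "set (neighbour_list es (Ls ! i)) \<subseteq> set Ls" "Ls1 ! i = Ls ! i"
        using less.prems(7) that hl unfolding ys by (auto simp: nth_append)
      then show ?thesis unfolding ys by auto
    qed
    have "card (set Ls) \<le> card ?S" by (rule card_mono[OF fin less.prems(6)])
    then have "h < card ?S" using hl distinct_card[OF dLs] by simp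
    then have meas: "card ?S - Suc h < card ?S - h" by simp
    obtain ts \<sigma> xs where 2: "exec main_loop (X1, M1) (concat ts @ [Tick]) \<sigma>"
      "\<forall>t \<in> set ts. length t \<le> B \<and> Emit \<in> set t"
      "visible (concat ts) = output_events (map (edge_set_word es) (drop (Suc h) (Ls1 @ xs)))"
      "set (Ls1 @ xs) \<subseteq> ?S" "distinct (Ls1 @ xs)"
      "\<forall>T \<in> set (Ls1 @ xs). set (neighbour_list es T) \<subseteq> set (Ls1 @ xs)"
      using less.hyps[OF meas 1(2) p(1-3) _ Ls1 cl1] hl unfolding ys by auto
    have "exec main_loop (X, M) (Tick # t1 @ (concat ts @ [Tick])) \<sigma>"
      unfolding main_loop_def by (rule exec.WhileTrue[OF _ 1(1) 2(1)[unfolded main_loop_def]]) (use X hl in simp)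
    then have "exec main_loop (X, M) (concat ((Tick # t1) # ts) @ [Tick]) \<sigma>" by simp
    moreover have v1: "visible (Tick # t1) = output_events [edge_set_word es (Ls ! h)]"
      using 1(3) p(4) s0(5) by simp
    then have "Emit \<in> set (visible (Tick # t1))" unfolding output_events_single by simp
    then have "Emit \<in> set (Tick # t1)" by (meson filter_is_subset subsetD)
    \<comment> \<open>The strict inequality in the assumption on B pays for the test of the
      loop.\<close>
    moreover have "length (Tick # t1) \<le> B" using 1(4) B[OF s0(2)] by simp
    moreover have vis: "visible (concat ((Tick # t1) # ts)) = output_events (map (edge_set_word es) (drop h (Ls @ (ys @ xs))))"
    proof -
      have "h < length (Ls @ ys @ xs)" "(Ls @ ys @ xs) ! h = Ls ! h" using hl by (simp_all add: nth_append)
      then have d: "drop h (Ls @ ys @ xs) = Ls ! h # drop (Suc h) (Ls @ ys @ xs)"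
        using Cons_nth_drop_Suc[of h "Ls @ ys @ xs"] by (simp only:)
      have v: "visible (concat ts) = output_events (map (edge_set_word es) (drop (Suc h) (Ls @ ys @ xs)))"
        using 2(3) unfolding ys append_assoc .
      have "visible (concat ((Tick # t1) # ts)) = visible (Tick # t1) @ visible (concat ts)" by simp
      then show ?thesis unfolding v1 v d by (simp add: output_events_def)
    qed
    moreover have "set (Ls @ (ys @ xs)) \<subseteq> ?S" "distinct (Ls @ (ys @ xs))"
      "\<forall>T \<in> set (Ls @ (ys @ xs)). set (neighbour_list es T) \<subseteq> set (Ls @ (ys @ xs))"
      using 2(4-6) unfolding ys by simp_all
    ultimately show ?thesis using 2(2)
      by (intro exI[of _ "(Tick # t1) # ts"] exI[of _ \<sigma>] exI[of _ "ys @ xs"]) simp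
  qed
qed

end

subsection \<open>Correctness and running time\<close>

definition sorted_table :: "nat set set \<Rightarrow> (nat \<times> nat) list" where
  "sorted_table E = sorted_edges (card (\<Union>E)) E"

lemma edge_set_zero: "edge_set es (\<lambda>_. 0) = {}"
  unfolding edge_set_def by simp

lemma card_vertices_le:
  assumes "simple_graph E" shows "card (\<Union>E) \<le> 2 * card E"
proof -
  have "card (\<Union>E) \<le> sum card E" using assms card_Union_le_sum_card by blast
  also have "\<dots> = 2 * card E" using assms unfolding simple_graph_def by simp
  finally show ?thesis .
qed

locale graph_instance =
  fixes E :: "nat set set" and w :: "nat list"
  assumes simple: "simple_graph E" and vertices: "\<Union>E = {..<card (\<Union>E)}" and word: "graph_word E w"
begin

abbreviation "n \<equiv> card (\<Union>E)"
abbreviation "es \<equiv> sorted_table E"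
text \<open>Powers must grow with the exponent, also for the empty graph.\<close>

abbreviation "P \<equiv> max 1 (card E)"

sublocale edge_table n es
  unfolding sorted_table_def by (rule edge_table_sorted_edges)

lemma edges: "edge ` set es = E"
  unfolding sorted_table_def by (rule edge_sorted_edges) (use simple vertices in auto)

lemma length_es: "length es = card E"
  unfolding sorted_table_def by (rule length_sorted_edges) (use simple vertices in auto)

lemma length_w: "length w = 2 + 2 * card E"
proof -
  obtain ws where "w = n # length ws # concat (map (\<lambda>(u, v). [u, v]) ws)" "distinct (map edge ws)" "edge ` set ws = E"
    by (rule graph_wordE[OF word])
  then show ?thesis using distinct_card[of "map edge ws"] by (simp add: length_edge_word)
qed

lemma vertices_in_w: "\<Union>E \<subseteq> set w"
proof -
  obtain ws where "w = n # length ws # concat (map (\<lambda>(u, v). [u, v]) ws)" "edge ` set ws = E"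
    by (rule graph_wordE[OF word])
  then show ?thesis using set_edge_word[of ws] by auto
qed

lemma n_le: "n \<le> 2 * card E"
  by (rule card_vertices_le[OF simple])

lemma vertex_le: "v \<in> \<Union>E \<Longrightarrow> v \<le> 3 * P"
proof -
  assume "v \<in> \<Union>E"
  then have "v < n" using vertices by blast
  then show "v \<le> 3 * P" using n_le by simp
qed

lemma w_le: "v \<in> set w \<Longrightarrow> v \<le> 3 * P"
proof -
  assume v: "v \<in> set w"
  obtain ws where ws: "w = n # length ws # concat (map (\<lambda>(u, v). [u, v]) ws)" "distinct (map edge ws)" "edge ` set ws = E"
    by (rule graph_wordE[OF word])
  have "length ws = card E" using ws distinct_card[of "map edge ws"] by simp
  moreover have "set w = insert n (insert (length ws) (\<Union>E))"
    by (subst ws(1)) (simp only: list.set set_edge_word ws(3))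
  ultimately consider "v = n" | "v = card E" | "v \<in> \<Union>E" using v by auto
  then show "v \<le> 3 * P" by cases (use n_le vertex_le in auto)
qed

lemma sorted:
  assumes "s1 = den sort_edges (start (w # vs))"
  shows "table_state n es s1" "reg s1 0 = 2 + 2 * card E" "r > 7 \<Longrightarrow> reg s1 r = 0"
    "k > 2 \<Longrightarrow> arr s1 k = (\<lambda>_. 0)" "arr s1 0 = arr (start (w # vs)) 0" "out s1 = []"
proof -
  obtain ws where ws: "w = n # length ws # concat (map (\<lambda>(u, v). [u, v]) ws)" "distinct (map edge ws)" "edge ` set ws = E"
    by (rule graph_wordE[OF word])
  show "table_state n es s1" unfolding assms sorted_table_def
    by (rule sort_edges[OF start_input_edges[OF ws(1)] ws(2,3) simple]) (use vertices in simp)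
  show "reg s1 0 = 2 + 2 * card E" "r > 7 \<Longrightarrow> reg s1 r = 0"
    unfolding assms using length_w by (simp_all add: reg_den assigned_sort start_simps)
  show "k > 2 \<Longrightarrow> arr s1 k = (\<lambda>_. 0)" "arr s1 0 = arr (start (w # vs)) 0" "out s1 = []"
    unfolding assms by (auto simp: arr_den out_den modified_sort quiet_sort start_simps)
qed

lemma start_limits: "reg (start (w # vs)) 1 = n" "reg (start (w # vs)) 2 = card E"
proof -
  obtain ws where ws: "w = n # length ws # concat (map (\<lambda>(u, v). [u, v]) ws)" "distinct (map edge ws)" "edge ` set ws = E"
    by (rule graph_wordE[OF word])
  have "length ws = card E" using ws distinct_card[of "map edge ws"] by simp
  then show "reg (start (w # vs)) 1 = n" "reg (start (w # vs)) 2 = card E"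
    using start_input_edges[OF ws(1), of vs] unfolding input_edges_def by simp_all
qed

section \<open>Running times in terms of m and n\<close>

lemma time_le:
  assumes "wf {2, 1} c" "X 1 = n" "X 2 = card E"
  shows "time c X \<le> coeff c * (P ^ degree 2 c * max 1 n ^ degree 1 c)"
  by (rule time_bound[OF assms(1)]) (use assms in auto)

lemma max_n_le: "max 1 n \<le> 2 * P"
  using n_le by auto

lemma P_power: "P ^ k \<le> card E ^ k + 1"
  by (cases "card E = 0") (auto simp: max_def)

text \<open>The words have at most 2 + 4m numbers, hence at most 6P, and 70 + 57P is at most 127P.
  The product gives 762, and 70 more make 832.\<close>

lemma read_time:
  assumes "length u \<le> 2 * card E"
  shows "70 + length (w @ u) * (70 + 19 * (3 * P)) \<le> 832 * P ^ 2"
proof -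
  have "length (w @ u) \<le> 6 * P" using length_w assms by auto
  moreover have "70 + 19 * (3 * P) \<le> 127 * P" by auto
  ultimately have "length (w @ u) * (70 + 19 * (3 * P)) \<le> (6 * P) * (127 * P)" by (rule mult_le_mono)
  also have "\<dots> = 762 * P ^ 2" by (simp add: power2_eq_square)
  finally have "length (w @ u) * (70 + 19 * (3 * P)) \<le> 762 * P ^ 2" .
  moreover have "1 \<le> P ^ 2" by simp
  ultimately show ?thesis by linarith
qed

text \<open>A bound in m alone: the square of n becomes \<open>(2 * P) ^ 2\<close>, which explains
  the factor 4 and the exponent k.\<close>

lemma total_time:
  assumes "length u \<le> 2 * card E" "wf {2, 1} c" "degree 1 c = 2" "degree 2 c + 2 = k"
    and t: "length t \<le> 70 + length (w @ u) * (70 + 19 * (3 * P)) + time c (reg (start (w # vs)))"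
  shows "length t \<le> (832 + 4 * coeff c) * card E ^ k + (832 + 4 * coeff c)"
proof -
  have "P ^ degree 2 c * max 1 n ^ degree 1 c \<le> P ^ degree 2 c * (2 * P) ^ 2"
    unfolding assms(3) by (intro mult_le_mono2 power_mono max_n_le) simp
  also have "\<dots> = 4 * P ^ k" unfolding assms(4)[symmetric] by (simp add: power_add power_mult_distrib power2_eq_square)
  finally have "coeff c * (P ^ degree 2 c * max 1 n ^ degree 1 c) \<le> coeff c * (4 * P ^ k)" by (rule mult_le_mono2)
  moreover have "P ^ 2 \<le> P ^ k" using assms(4) by (intro power_increasing) auto
  ultimately have "length t \<le> 832 * P ^ k + coeff c * (4 * P ^ k)"
    using t read_time[OF assms(1)] time_le[OF assms(2) start_limits[of vs]] by linarith
  also have "\<dots> = (832 + 4 * coeff c) * P ^ k" by (simp add: algebra_simps)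
  also have "\<dots> \<le> (832 + 4 * coeff c) * (card E ^ k + 1)" by (intro mult_le_mono2 P_power)
  finally show ?thesis by simp
qed

lemma sol_words:
  assumes "\<And>T. T \<in> set Ts \<Longrightarrow> T \<subseteq> E"
  shows "list_all2 edges_word Ts (map (edge_set_word es) Ts)"
  unfolding list_all2_map2 by (rule list.rel_refl_strong, rule edges_word_edge_set) (use assms edges in auto)

text \<open>Meets the condition of \<open>exec_compile\<close>: vertices occur in the input, so
  array 15 knows them.\<close>

lemma put_vertices: "Put v \<in> set (output_events (map (edge_set_word es) Ts)) \<Longrightarrow> v \<in> \<Union>E"
proof -
  assume "Put v \<in> set (output_events (map (edge_set_word es) Ts))"
  then obtain T where "v \<in> set (edge_set_word es T)" unfolding Put_output_events by auto
  then show "v \<in> \<Union>E" using set_edge_set_word[of es T] unfolding edges by blast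
qed

lemma first_maximal: "complete es {} \<in> maximal_chordal_subgraphs E"
  by (rule complete_maximal(1)) (use chordal_empty edges simple in auto)

lemma run_first:
  "\<exists>t s. exec (with_input (compile first_prog)) (init [w]) t s \<and>
     outputs t = [edge_set_word es (complete es {})] \<and>
     length t \<le> (832 + 4 * coeff first_prog) * card E ^ 5 + (832 + 4 * coeff first_prog)"
proof -
  define s1 where "s1 = den sort_edges (start [w])"
  note s1 = sorted[OF s1_def]
  define s2 where "s2 = den complete_prog s1"
  have t2: "table_state n es s2" unfolding s2_def
    by (rule table_state_den[OF s1(1)]) (auto simp: assigned_complete modified_complete)
  have "edge_set es (arr s2 3) = complete es {}" unfolding s2_def complete_prog[OF s1(1)]
    using s1(4)[of 3] by (simp add: edge_set_zero)
  moreover have "out s2 = []" unfolding s2_def using s1(6) by (simp add: out_den quiet_complete)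
  ultimately have o: "out (den first_prog (start [w])) = output_events (map (edge_set_word es) [complete es {}])"
    using output_prog[OF t2, of 3] unfolding first_prog_def den.simps(6) s1_def[symmetric] s2_def[symmetric]
    by (simp add: output_events_single)
  have "\<exists>t s. exec (with_input (compile first_prog)) (init [w]) t s \<and> visible t = out (den first_prog (start [w])) \<and>
    length t \<le> 70 + length (concat [w]) * (70 + 19 * (3 * P)) + time first_prog (reg (start [w]))"
  proof (rule run_compiled[OF _ _ _ wf_progs(1)])
    show "x \<in> set (concat [w])" if "Put x \<in> set (out (den first_prog (start [w])))" for x
    proof -
      have "x \<in> \<Union>E" by (rule put_vertices) (use that in \<open>simp only: o\<close>)
      then show ?thesis using vertices_in_w by auto
    qed
    show "x \<le> 3 * P" if "x \<in> set (concat [w])" for x using that w_le by simp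
  qed simp_all
  then obtain t s where t: "exec (with_input (compile first_prog)) (init [w]) t s"
    "visible t = out (den first_prog (start [w]))"
    "length t \<le> 70 + length (w @ []) * (70 + 19 * (3 * P)) + time first_prog (reg (start [w]))" by auto
  have "outputs t = [edge_set_word es (complete es {})]"
    using outputs_visible[of t] unfolding t(2) o outputs_output_events by simp
  moreover have "length t \<le> (832 + 4 * coeff first_prog) * card E ^ 5 + (832 + 4 * coeff first_prog)"
    by (rule total_time[OF _ wf_progs(1) _ _ t(3)]) (simp_all add: degree_progs del: One_nat_def)
  ultimately show ?thesis using t(1) by blast
qed

lemma run_neighbours:
  assumes S: "S \<in> maximal_chordal_subgraphs E" and v: "edges_word S v"
  shows "\<exists>t s. exec (with_input (compile neighbours_prog)) (init [w, v]) t s \<and>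
     outputs t = map (edge_set_word es) (neighbour_list es S) \<and>
     length t \<le> (832 + 4 * coeff neighbours_prog) * card E ^ 6 + (832 + 4 * coeff neighbours_prog)"
proof -
  obtain vs where vs: "v = concat (map (\<lambda>(u, v). [u, v]) vs)" "distinct (map edge vs)" "edge ` set vs = S"
    using v unfolding edges_word_def edge_case_prod by auto
  have SE: "S \<subseteq> E" using maximal_chordalD[OF S] by blast
  have "card S \<le> card E" using SE simple card_mono unfolding simple_graph_def by blast
  moreover have "length vs = card S" using distinct_card[OF vs(2)] vs(3) by simp
  ultimately have lv: "length v \<le> 2 * card E" unfolding vs(1) length_edge_word by simp
  define s1 where "s1 = den sort_edges (start (w # [v]))"
  note s1 = sorted[OF s1_def]
  define s2 where "s2 = den read_solution s1"
  have a: "arr s1 0 i = (if i < length (w @ v) then (w @ v) ! i else 0)" for i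
    unfolding s1(5) start_simps by simp
  have "edge_set es (arr s2 4) = edge ` set vs" unfolding s2_def
  proof (rule read_solution[OF s1(1,2)])
    show "\<forall>q. arr s1 4 q = 0" using s1(4)[of 4] by simp
    show "arr s1 0 (2 + 2 * card E + 2 * i) = fst (vs ! i) \<and> arr s1 0 (Suc (2 + 2 * card E + 2 * i)) = snd (vs ! i)"
      if "i < length vs" for i
      using nth_edge_word[OF that, of "[]"] that length_w unfolding a vs(1)
      by (auto simp: nth_append length_edge_word simp flip: length_w)
    show "arr s1 0 i = 0" if "2 + 2 * card E + 2 * length vs \<le> i" for i
      using that length_w unfolding a vs(1) by (simp add: length_edge_word)
  qed (use vs SE edges in auto)
  then have S2: "edge_set es (arr s2 4) = S" using vs(3) by simp
  have t2: "table_state n es s2" unfolding s2_def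
    by (rule table_state_den[OF s1(1)]) (auto simp: assigned_read_solution modified_read_solution)
  have o2: "out s2 = []" unfolding s2_def using s1(6) by (simp add: out_den quiet_read_solution)
  define I where "I = (\<lambda>Ts (t::astate). out t = output_events (map (edge_set_word es) Ts))"
  have "I (neighbour_list es (edge_set es (arr s2 4))) (den (for_neighbours (output_prog 3)) s2)"
  proof (rule for_neighbours[OF t2])
    show "I [] s2" using o2 unfolding I_def output_events_def by simp
    show "I (Ts @ [edge_set es (arr s 3)]) (den (output_prog 3) s)" if "table_state n es s" "I Ts s" for Ts s
      using output_prog[OF that(1), of 3] that(2) unfolding I_def
      by (simp add: output_events_append output_events_single)
    show "I Ts s'" if "I Ts s" "out s' = out s" for Ts s s' using that unfolding I_def by simp
  qed (simp_all add: assigned_output modified_output)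
  then have o: "out (den neighbours_prog (start [w, v])) = output_events (map (edge_set_word es) (neighbour_list es S))"
    unfolding I_def S2 neighbours_prog_def den.simps(6) s1_def[symmetric] s2_def[symmetric] .
  have "\<Union>S \<subseteq> \<Union>E" using SE by blast
  then have v_le: "x \<le> 3 * P" if "x \<in> set v" for x
    using that vertex_le unfolding vs(1) set_edge_word vs(3) by blast
  have "\<exists>t s. exec (with_input (compile neighbours_prog)) (init [w, v]) t s \<and> visible t = out (den neighbours_prog (start [w, v])) \<and>
    length t \<le> 70 + length (concat [w, v]) * (70 + 19 * (3 * P)) + time neighbours_prog (reg (start [w, v]))"
  proof (rule run_compiled[OF _ _ _ wf_progs(2)])
    show "x \<in> set (concat [w, v])" if "Put x \<in> set (out (den neighbours_prog (start [w, v])))" for x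
      using that put_vertices vertices_in_w unfolding o by auto
    show "x \<le> 3 * P" if "x \<in> set (concat [w, v])" for x using that w_le v_le by auto
  qed simp_all
  then obtain t s where t: "exec (with_input (compile neighbours_prog)) (init [w, v]) t s"
    "visible t = out (den neighbours_prog (start [w, v]))"
    "length t \<le> 70 + length (w @ v) * (70 + 19 * (3 * P)) + time neighbours_prog (reg (start [w, v]))" by auto
  have "outputs t = map (edge_set_word es) (neighbour_list es S)"
    using outputs_visible[of t] unfolding t(2) o outputs_output_events by simp
  moreover have "length t \<le> (832 + 4 * coeff neighbours_prog) * card E ^ 6 + (832 + 4 * coeff neighbours_prog)"
    by (rule total_time[OF lv wf_progs(2) _ _ t(3)]) (simp_all add: degree_progs del: One_nat_def)
  ultimately show ?thesis using t(1) by blast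
qed

text \<open>A nonempty graph has m and n positive, so the maxima vanish; the summand 1 pays for the
  empty graph.\<close>

lemma main_time: "P ^ 4 * max 1 n \<le> card E ^ 4 * n + 1"
proof (cases "card E = 0")
  case True
  then show ?thesis using n_le by simp
next
  case False
  then have "E \<noteq> {}" by auto
  then obtain e where e: "e \<in> E" by blast
  then have "e \<noteq> {}" using simple unfolding simple_graph_def by force
  then have "n \<noteq> 0" using e vertices by auto
  then show ?thesis using False by (simp add: max_def)
qed

lemma run_list:
  "\<exists>t s Ts. exec list_prog (init [w]) t s \<and> outputs t = map (edge_set_word es) Ts \<and> distinct Ts \<and>
     set Ts = maximal_chordal_subgraphs E \<and>
     delay t \<le> 2 * ((833 + 2 * coeff init_prog + coeff process_prog) * (card E ^ 4 * n + 1))"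
proof -
  let ?S = "maximal_chordal_subgraphs E"
  let ?D = "length (concat [w])" and ?V = "set (concat [w])"
  define Z where "Z = P ^ 4 * max 1 n"
  \<comment> \<open>832 for reading the input, 1 for the test of the main loop, twice the
    coefficient of the initialisation because its \<open>m^3 n^2\<close> is at most twice
    \<open>Z\<close>, and the coefficient of one round.\<close>
  define B where "B = (833 + 2 * coeff init_prog + coeff process_prog) * Z"
  have Z1: "1 \<le> Z" unfolding Z_def by (simp add: Suc_le_eq less_max_iff_disj)
  obtain t0 X M where 0: "\<forall>c t' s'. exec c (X, M) t' s' \<longrightarrow> exec (with_input c) (init [w]) (t0 @ t') s'"
    "represents ?D ?V (X, M) (start [w])" "visible t0 = []" "length t0 \<le> 70 + ?D * (70 + 19 * (3 * P))"
    using run_start[of "[w]" "3 * P"] w_le by auto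
  define s1 where "s1 = den sort_edges (start [w])"
  note s1 = sorted[OF s1_def]
  define s2 where "s2 = den complete_prog s1"
  define s3 where "s3 = set_reg 20 2 s2"
  define s4 where "s4 = den insert_prog s3"
  have D: "den init_prog (start [w]) = s4" unfolding init_prog_def s4_def s3_def s2_def s1_def by simp
  have t2: "table_state n es s2" unfolding s2_def
    by (rule table_state_den[OF s1(1)]) (auto simp: assigned_complete modified_complete)
  have t3: "table_state n es s3" unfolding s3_def by (rule table_state_set_reg[OF t2]) simp
  have t4: "table_state n es s4" unfolding s4_def
    by (rule table_state_den[OF t3]) (auto simp: assigned_insert modified_insert)
  have "edge_set es (arr s2 3) = complete es {}" unfolding s2_def complete_prog[OF s1(1)]
    using s1(4)[of 3] by (simp add: edge_set_zero)
  then have c3: "edge_set es (arr s3 3) = complete es {}" unfolding s3_def by simp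
  have z3: "arr s3 k = (\<lambda>_. 0)" if "k > 7" for k
    unfolding s3_def s2_def using s1(4)[of k] that by (simp add: arr_den modified_complete)
  have r3: "reg s3 r = 0" if "r > 20" for r
    unfolding s3_def s2_def using s1(3)[of r] that by (simp add: reg_den assigned_complete)
  have "trie 2 (\<lambda>b. arr s3 (if b then 9 else 8)) (arr s3 10) (\<lambda>_. [])"
    unfolding trie_def using z3 by (auto simp: less_Suc_eq numeral_2_eq_2)
  then have "trie_state s3 {} (\<lambda>_. [])" unfolding trie_state_def using z3[of 10] by (simp add: s3_def)
  then have st3: "store_state s3 []" unfolding store_state_def queue_state_def using r3 by auto
  have st4: "store_state s4 [complete es {}]"
    using insert_prog[OF t3 st3] c3 unfolding s4_def by (simp add: add_new_def)
  have q4: "queue_position 0 s4" unfolding queue_position_def s4_def using r3 by (simp add: reg_den assigned_insert)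
  have o4: "out s4 = []" unfolding s4_def s3_def s2_def using s1(6) by (simp add: out_den quiet_complete quiet_insert)
  obtain t1 X1 M1 where 1: "exec (compile init_prog) (X, M) t1 (X1, M1)" "represents ?D ?V (X1, M1) s4"
    "out s4 = out (start [w]) @ visible t1" "length t1 \<le> time init_prog (reg (start [w]))"
    using exec_compile[OF wf_progs(3) 0(2)] unfolding D using o4 by auto
  have tb: "time process_prog (reg s) < B" if "table_state n es s" for s
  proof -
    have "time process_prog (reg s) \<le> coeff process_prog * Z"
      using time_le[OF wf_progs(4), of "reg s"] table_stateD(1,3)[OF that] length_es
      unfolding degree_progs Z_def by simp
    then show ?thesis unfolding B_def using Z1 by (simp add: algebra_simps)
  qed
  have V: "\<Union> (edge ` set es) \<subseteq> ?V" using vertices_in_w edges by simp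
  have S0: "set [complete es {}] \<subseteq> maximal_chordal_subgraphs (edge ` set es)" using first_maximal edges by simp
  obtain ts \<sigma> xs where 2: "exec main_loop (X1, M1) (concat ts @ [Tick]) \<sigma>"
    "\<forall>t \<in> set ts. length t \<le> B \<and> Emit \<in> set t"
    "visible (concat ts) = output_events (map (edge_set_word es) (drop 0 ([complete es {}] @ xs)))"
    "set ([complete es {}] @ xs) \<subseteq> maximal_chordal_subgraphs (edge ` set es)" "distinct ([complete es {}] @ xs)"
    "\<forall>T \<in> set ([complete es {}] @ xs). set (neighbour_list es T) \<subseteq> set ([complete es {}] @ xs)"
    using run_main_loop[OF V tb 1(2) t4 st4 q4 _ S0] by auto
  define Ts where "Ts = complete es {} # xs"
  have all: "set Ts = ?S" unfolding Ts_def
    by (rule closed_under_neighbours[OF edges simple]) (use 2(4,6) edges in auto)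
  define t where "t = (t0 @ t1) @ concat ts @ [Tick]"
  have ex: "exec list_prog (init [w]) t \<sigma>"
    unfolding list_prog_def t_def append_assoc
    by (rule 0(1)[rule_format, OF exec.Seq[OF 1(1) 2(1)]])
  have "visible t1 = []" using 1(3) o4 by simp
  then have "visible t = output_events (map (edge_set_word es) Ts)"
    using 2(3) 0(3) unfolding t_def Ts_def by simp
  then have out: "outputs t = map (edge_set_word es) Ts"
    using outputs_visible[of t] outputs_output_events by metis
  \<comment> \<open>One of the two factors n is traded for 2P to bring the initialisation below the
    order of a single round.\<close>
  have "P ^ 3 * max 1 n ^ 2 \<le> P ^ 3 * (2 * P * max 1 n)"
    unfolding power2_eq_square by (intro mult_le_mono max_n_le order_refl)
  also have "\<dots> = 2 * Z" unfolding Z_def by (simp add: power_numeral_reduce)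
  finally have "coeff init_prog * (P ^ 3 * max 1 n ^ 2) \<le> coeff init_prog * (2 * Z)" by (rule mult_le_mono2)
  then have l1: "length t1 \<le> coeff init_prog * (2 * Z)"
    using 1(4) time_le[OF wf_progs(3) start_limits[of "[]"]] unfolding degree_progs by linarith
  have "P ^ 2 \<le> P ^ 4" by (intro power_increasing) auto
  also have "\<dots> \<le> Z" unfolding Z_def by simp
  finally have "length t0 \<le> 832 * Z" using 0(4) read_time[of "[]"] by simp
  then have "length (t0 @ t1) \<le> B" using l1 unfolding B_def by (simp add: algebra_simps)
  moreover have "length [Tick] \<le> B" unfolding B_def using Z1 by (simp add: algebra_simps)
  ultimately have "delay t \<le> 2 * B" unfolding t_def using 2(2) by (intro delay_bound) auto
  also have "\<dots> \<le> 2 * ((833 + 2 * coeff init_prog + coeff process_prog) * (card E ^ 4 * n + 1))"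
    unfolding B_def Z_def by (intro mult_le_mono2 main_time)
  finally have dl: "delay t \<le> 2 * ((833 + 2 * coeff init_prog + coeff process_prog) * (card E ^ 4 * n + 1))" .
  have "distinct Ts" using 2(5) unfolding Ts_def by simp
  then show ?thesis using ex out all dl by blast
qed

end

section \<open>Proximity searchability and the delay\<close>

lemma chordal_instance:
  "E \<in> instances chordal_listing \<Longrightarrow> inst_word chordal_listing E w \<Longrightarrow> graph_instance E w"
  unfolding chordal_listing_def graph_instance_def by simp

lemma chordal_listing_simps:
  "universe chordal_listing E = E" "solutions chordal_listing = maximal_chordal_subgraphs"
  "sol_word chordal_listing E = edges_word"
  unfolding chordal_listing_def by simp_all

lemma chordal_polytime_first_solution: "polytime_first_solution chordal_listing"
  unfolding polytime_first_solution_def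
proof (rule exI[of _ "with_input (compile first_prog)"], rule exI[of _ "832 + 4 * coeff first_prog"],
    rule exI[of _ 5], intro ballI allI impI)
  fix E w assume "E \<in> instances chordal_listing" "inst_word chordal_listing E w"
  then interpret graph_instance E w by (rule chordal_instance)
  obtain t s where t: "exec (with_input (compile first_prog)) (init [w]) t s"
    "outputs t = [edge_set_word es (complete es {})]"
    "length t \<le> (832 + 4 * coeff first_prog) * card E ^ 5 + (832 + 4 * coeff first_prog)"
    using run_first by blast
  have "complete es {} \<subseteq> E" using maximal_chordalD[OF first_maximal] by blast
  then have "list_all2 edges_word [complete es {}] (outputs t)" using sol_words[of "[complete es {}]"] t(2) by simp
  then show "\<exists>t. \<exists>S \<in> solutions chordal_listing E.
      run_lists chordal_listing E (with_input (compile first_prog)) [w] t [S] \<and>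
      length t \<le> (832 + 4 * coeff first_prog) * card (universe chordal_listing E) ^ 5 + (832 + 4 * coeff first_prog)"
    unfolding chordal_listing_simps run_lists_def using t(1,3) first_maximal by blast
qed

lemma chordal_polytime_neighbors:
  "polytime_neighbors chordal_listing (\<lambda>E S. set (neighbour_list (sorted_table E) S))"
  unfolding polytime_neighbors_def
proof (rule exI[of _ "with_input (compile neighbours_prog)"], rule exI[of _ "832 + 4 * coeff neighbours_prog"],
    rule exI[of _ 6], intro ballI allI impI)
  fix E w S v assume "E \<in> instances chordal_listing" "inst_word chordal_listing E w"
  then interpret graph_instance E w by (rule chordal_instance)
  assume "S \<in> solutions chordal_listing E" "sol_word chordal_listing E S v"
  then have S: "S \<in> maximal_chordal_subgraphs E" "edges_word S v" unfolding chordal_listing_simps .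
  obtain t s where t: "exec (with_input (compile neighbours_prog)) (init [w, v]) t s"
    "outputs t = map (edge_set_word es) (neighbour_list es S)"
    "length t \<le> (832 + 4 * coeff neighbours_prog) * card E ^ 6 + (832 + 4 * coeff neighbours_prog)"
    using run_neighbours[OF S] by blast
  have "list_all2 edges_word (neighbour_list es S) (outputs t)" unfolding t(2)
    by (rule sol_words) (use neighbour_list_maximal[OF S(1) edges simple] maximal_chordalD(1) in blast)
  then show "\<exists>t Ss. run_lists chordal_listing E (with_input (compile neighbours_prog)) [w, v] t Ss \<and>
      set Ss = set (neighbour_list es S) \<and>
      length t \<le> (832 + 4 * coeff neighbours_prog) * card (universe chordal_listing E) ^ 6 + (832 + 4 * coeff neighbours_prog)"
    unfolding chordal_listing_simps run_lists_def using t(1,3) by blast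
qed

lemma chordal_proximity_searchable: "proximity_searchable chordal_listing"
  unfolding proximity_searchable_def
proof (intro exI[of _ "\<lambda>_. proximity"] exI[of _ "\<lambda>E S. set (neighbour_list (sorted_table E) S)"] conjI ballI impI
    chordal_polytime_first_solution chordal_polytime_neighbors)
  fix E S S' assume "E \<in> instances chordal_listing"
  then have sE: "simple_graph E" "\<Union>E \<subseteq> {..<card (\<Union>E)}" unfolding chordal_listing_def by auto
  have es: "edge ` set (sorted_table E) = E" unfolding sorted_table_def by (rule edge_sorted_edges[OF sE])
  show "set (neighbour_list (sorted_table E) S) \<subseteq> solutions chordal_listing E"
    if "S \<in> solutions chordal_listing E"
    using that unfolding chordal_listing_simps by (rule neighbour_list_maximal[OF _ es sE(1)])
  assume S': "S' \<in> solutions chordal_listing E"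
  then have S'E: "S' \<subseteq> E" "chordal S'" unfolding chordal_listing_simps by (auto dest: maximal_chordalD)
  show "proximity S S' \<subseteq> universe chordal_listing E"
    using proximity_subset[OF S'E(2) simple_graph_mono[OF sE(1) S'E(1)], of S] S'E(1)
    unfolding chordal_listing_simps by blast
  show "\<exists>T \<in> set (neighbour_list (sorted_table E) S). card (proximity S S') < card (proximity T S')"
    if "S \<in> solutions chordal_listing E" "S \<noteq> S'"
    using that(1) S' unfolding chordal_listing_simps
    by (rule neighbour_list_proximity[OF _ _ that(2) es sE(1)])
qed

theorem theorem7p4:
  shows "proximity_searchable chordal_listing \<and>
    (\<exists>P C. lists_with_delay chordal_listing P (\<lambda>E. C * (card E ^ 4 * card (\<Union>E) + 1)))"
proof (intro conjI chordal_proximity_searchable exI[of _ list_prog]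
    exI[of _ "2 * (833 + 2 * coeff init_prog + coeff process_prog)"])
  show "lists_with_delay chordal_listing list_prog
     (\<lambda>E. 2 * (833 + 2 * coeff init_prog + coeff process_prog) * (card E ^ 4 * card (\<Union>E) + 1))"
    unfolding lists_with_delay_def
  proof (intro ballI allI impI)
    fix E w assume "E \<in> instances chordal_listing" "inst_word chordal_listing E w"
    then interpret graph_instance E w by (rule chordal_instance)
    obtain t s Ts where t: "exec list_prog (init [w]) t s" "outputs t = map (edge_set_word es) Ts" "distinct Ts"
      "set Ts = maximal_chordal_subgraphs E"
      "delay t \<le> 2 * ((833 + 2 * coeff init_prog + coeff process_prog) * (card E ^ 4 * n + 1))"
      using run_list by blast
    have "list_all2 edges_word Ts (outputs t)" unfolding t(2)
      by (rule sol_words) (use t(4) maximal_chordalD(1) in blast)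
    moreover have "delay t \<le> 2 * (833 + 2 * coeff init_prog + coeff process_prog) * (card E ^ 4 * n + 1)"
      using t(5) by (simp only: mult.assoc)
    ultimately show "\<exists>t Ss. run_lists chordal_listing E list_prog [w] t Ss \<and> distinct Ss \<and>
        set Ss = solutions chordal_listing E \<and>
        delay t \<le> 2 * (833 + 2 * coeff init_prog + coeff process_prog) * (card E ^ 4 * card (\<Union>E) + 1)"
      unfolding chordal_listing_simps run_lists_def using t(1,3,4) by blast
  qed
qed

end
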